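(* Let $(X_i)_{i\ge 1}$ be i.i.d. real random variables with $\mathbb E X_1=0$, $\mathbb E X_1^2=\sigma^2\in(0,\infty)$. Assume that $X_1$ is non-lattice and that $\mathbb E|X_1|^{2+\delta}<\infty$ for some $\delta>0$. Let $\eta\ge1$ be any fixed real number. Let $(\alpha_n)_{n\ge1}$ be any sequence of positive numbers satisfying $\lim_{n\to\infty}\alpha_n=0$ and $n^{1/4}\alpha_n\ge1$. Then, for any $\Delta_0>0$ and any sequence of positive numbers $(\beta_n)_{n\ge1}$ with $\lim_{n\to\infty}\beta_n=0$, we have, as $n\to\infty$, uniformly in $x\in[\eta^{-1}\sqrt n,\eta\sqrt n]$, $y\in[\alpha_n^{-1},\alpha_n\sqrt n]$ and $\Delta\in[\Delta_0,\beta_n y]$, $$\mathbb P\big(x+S_n\in[0,\Delta]+y,\ \tau_x>n\big)\sim\Delta\,\frac{2y}{\sqrt{2\pi}\,\sigma^2n}\,\phi^+\Big(\frac{x}{\sigma\sqrt n}\Big).$$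
   Context: Notation: $S_n=\sum_{i=1}^n X_i$; for $x\ge0$, $\tau_x=\inf\{k\ge1:\ x+S_k<0\}$. A random variable $X$ is non-lattice if for all $h>0$ and $a\in[0,h)$, $\mathbb P(X\in h\mathbb Z+a)\ne1$. $\phi^+(s)=s e^{-s^2/2}\mathbf 1_{\{s\ge0\}}$. $[0,\Delta]+y=[y,y+\Delta]$. Uniform asymptotic equivalence: $a_n(\theta)\sim b_n(\theta)$ uniformly in $\theta\in A_n$ as $n\to\infty$ means $\lim_{n\to\infty}\sup_{\theta\in A_n}\left|\frac{a_n(\theta)}{b_n(\theta)}-1\right|=0$. *)

theory Defs
  imports "HOL-Probability.Probability" "HOL-Library.Extended_Nat"
begin

definition walk :: "(nat \<Rightarrow> 'a \<Rightarrow> real) \<Rightarrow> nat \<Rightarrow> 'a \<Rightarrow> real" where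
  "walk X n \<omega> = (\<Sum>i=1..n. X i \<omega>)"

(* Values in enat: the infimum of the empty set is \<infinity>. *)
definition exit_time :: "(nat \<Rightarrow> 'a \<Rightarrow> real) \<Rightarrow> real \<Rightarrow> 'a \<Rightarrow> enat" where
  "exit_time X x \<omega> = Inf {enat k |k. 1 \<le> k \<and> x + walk X k \<omega> < 0}"

definition non_lattice :: "'a measure \<Rightarrow> ('a \<Rightarrow> real) \<Rightarrow> bool" where
  "non_lattice M X \<longleftrightarrow>
     (\<forall>h>0. \<forall>a\<in>{0..<h}.
        measure M {\<omega> \<in> space M. X \<omega> \<in> {h * of_int k + a |k::int. True}} \<noteq> 1)"

definition phi_plus :: "real \<Rightarrow> real" where
  "phi_plus s = s * exp (- s\<^sup>2 / 2) * indicator {0..} s"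

(* The supremum is taken in ennreal, so it is 0 if A n is empty and \<infinity> if the
   family is unbounded; Sup on real is unspecified in both cases. *)
definition unif_asymp_equiv ::
  "(nat \<Rightarrow> 't set) \<Rightarrow> (nat \<Rightarrow> 't \<Rightarrow> real) \<Rightarrow> (nat \<Rightarrow> 't \<Rightarrow> real) \<Rightarrow> bool" where
  "unif_asymp_equiv A a b \<longleftrightarrow>
     (\<lambda>n. SUP \<theta>\<in>A n. ennreal \<bar>a n \<theta> / b n \<theta> - 1\<bar>) \<longlonglongrightarrow> 0"

end

theory Submission
  imports Defs
begin

text \<open>
  Reversing time turns the event into: a walk with steps \<open>-X\<close> starts close to \<open>y = o(\<surd>n)\<close>, stays
  nonnegative and ends in a window of length \<open>\<Delta>\<close> at \<open>x\<close> of order \<open>\<surd>n\<close>.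

  Run the first \<open>(1 - \<epsilon>) n\<close> steps against the kernel of Brownian motion absorbed at zero. This kernel
  solves the heat equation and is odd in the starting point, so replacing the steps by Gaussian ones
  in Lindeberg's manner changes the killed expectation only by a Taylor error, of order
  \<open>n powr (- (3 + \<delta>) / 2)\<close> times the survival probability at each step, plus \<open>O(1/n)\<close> times the expected
  undershoot below zero. The undershoot is \<open>o(y)\<close> by a Lyapunov function, and the survival
  probability is \<open>O(y/\<surd>k)\<close> since it is positively correlated with the final position, whose killed
  expectation is \<open>y\<close> plus the undershoot. For \<open>y = o(\<surd>n)\<close> the kernel is
  \<open>2 x y / (\<sigma>\<^sup>2 n)\<close> times a Gaussian density up to a factor \<open>1 + o(1)\<close>.

  In the last \<open>\<epsilon> n\<close> steps the local limit theorem for nonlattice walks applies, with an error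
  \<open>o(\<Delta>/\<surd>n)\<close> that is multiplied by the survival probability \<open>O(y/\<surd>n)\<close>; killing matters little there,
  because a walk that has become negative must still climb to \<open>x\<close>.
\<close>

subsection \<open>Walks killed on leaving a set\<close>

text \<open>All estimates concern the operators \<open>Q\<close> and \<open>P\<close> acting on
  functions of the starting point; paths enter only when the walk is reversed. Two obstacles force
  the two stages. The bound on the third derivative of the kernel grows like the power -4 of its
  width, so the Lindeberg errors blow up as the remaining time tends to zero. The local limit
  theorem alone, on the other hand, does not see the survival factor \<open>y / sqrt n\<close>. The
  last stage therefore has length about \<open>e\<^sup>2 * n\<close>, where \<open>e\<close> is
  fixed before \<open>n\<close> grows, and it costs a multiple of \<open>e\<close> relative to the
  main term. The moment of order \<open>2 + \<delta>\<close> acts twice: it gives the Taylor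
  remainder an order that survives summation over \<open>n\<close> steps, and it bounds the total
  undershoot by a multiple of \<open>(1 + y) powr (1 - \<delta>)\<close>, which is small against
  \<open>y\<close> only for large \<open>y\<close>. The reversed walk has no fixed start, only one
  in a window of length \<Delta>; this costs a relative error of order \<Delta> / y, and here
  \<Delta> = o(y) enters.\<close>

definition quad_growth :: "(real \<Rightarrow> real) \<Rightarrow> bool" where
  "quad_growth f \<longleftrightarrow> f \<in> borel_measurable borel \<and> (\<exists>C\<ge>0. \<forall>u. \<bar>f u\<bar> \<le> C * (1 + u\<^sup>2))"

text \<open>Only the point reached is tested, not the start. Hence
  \<open>(killed_step M B ^^ k) f u\<close> is the expectation of \<open>f\<close> at time
  \<open>k\<close> over the paths that lie in \<open>B\<close> at times 1 to \<open>k\<close>, in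
  agreement with an exit time that counts from time 1.\<close>

definition killed_step :: "real measure \<Rightarrow> real set \<Rightarrow> (real \<Rightarrow> real) \<Rightarrow> real \<Rightarrow> real" where
  "killed_step M B f u = (\<integral>x. indicator B (u + x) * f (u + x) \<partial>M)"

lemma quad_growth_measurable [measurable_dest]: "quad_growth f \<Longrightarrow> f \<in> borel_measurable borel"
  by (simp add: quad_growth_def)

lemma quad_growthI:
  assumes "f \<in> borel_measurable borel" and "\<And>u. \<bar>f u\<bar> \<le> C * (1 + u\<^sup>2)"
  shows "quad_growth f"
proof -
  have "0 \<le> C" using assms(2)[of 0] by auto
  with assms show ?thesis unfolding quad_growth_def by blast
qed

lemma quad_growth_bounded:
  assumes "f \<in> borel_measurable borel" and "\<And>u. \<bar>f u\<bar> \<le> C"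
  shows "quad_growth f"
proof (rule quad_growthI)
  fix u
  have "0 \<le> C" using assms(2)[of 0] by auto
  then show "\<bar>f u\<bar> \<le> C * (1 + u\<^sup>2)"
    using assms(2)[of u] by (simp add: algebra_simps) (smt (verit) mult_nonneg_nonneg zero_le_power2)
qed (fact assms(1))

lemma quad_growth_const [simp, intro]: "quad_growth (\<lambda>_. c)"
  by (rule quad_growth_bounded[of _ "\<bar>c\<bar>"]) auto

lemma quad_growth_add [intro]:
  assumes "quad_growth f" "quad_growth g"
  shows "quad_growth (\<lambda>u. f u + g u)"
proof -
  obtain C D where "\<And>u. \<bar>f u\<bar> \<le> C * (1 + u\<^sup>2)" "\<And>u. \<bar>g u\<bar> \<le> D * (1 + u\<^sup>2)"
    using assms unfolding quad_growth_def by blast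
  then have "\<bar>f u + g u\<bar> \<le> C * (1 + u\<^sup>2) + D * (1 + u\<^sup>2)" for u
    by (meson abs_triangle_ineq add_mono order_trans)
  then have "\<bar>f u + g u\<bar> \<le> (C + D) * (1 + u\<^sup>2)" for u
    by (simp only: distrib_right)
  then show ?thesis using assms by (intro quad_growthI[of _ "C + D"]) (auto dest: quad_growth_measurable)
qed

lemma quad_growth_cmult [intro]:
  assumes "quad_growth f"
  shows "quad_growth (\<lambda>u. c * f u)"
proof -
  obtain C where C: "\<And>u. \<bar>f u\<bar> \<le> C * (1 + u\<^sup>2)"
    using assms unfolding quad_growth_def by blast
  have "\<bar>c * f u\<bar> \<le> (\<bar>c\<bar> * C) * (1 + u\<^sup>2)" for u
    using mult_left_mono[OF C[of u], of "\<bar>c\<bar>"] by (simp add: abs_mult mult.assoc)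
  then show ?thesis using assms by (intro quad_growthI[of _ "\<bar>c\<bar> * C"]) (auto dest: quad_growth_measurable)
qed

lemma quad_growth_uminus [intro]: "quad_growth f \<Longrightarrow> quad_growth (\<lambda>u. - f u)"
  using quad_growth_cmult[of f "-1"] by simp

lemma quad_growth_diff [intro]: "quad_growth f \<Longrightarrow> quad_growth g \<Longrightarrow> quad_growth (\<lambda>u. f u - g u)"
  using quad_growth_add[of f "\<lambda>u. - g u"] by auto

lemma quad_growth_dominated:
  assumes "quad_growth g" "f \<in> borel_measurable borel" "\<And>u. \<bar>f u\<bar> \<le> \<bar>g u\<bar>"
  shows "quad_growth f"
proof -
  obtain C where C: "\<And>u. \<bar>g u\<bar> \<le> C * (1 + u\<^sup>2)"
    using assms unfolding quad_growth_def by blast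
  show ?thesis by (rule quad_growthI[of _ C]) (use assms C order_trans in blast)+
qed

lemma quad_growth_square [simp, intro]: "quad_growth (\<lambda>u. u\<^sup>2)"
  by (rule quad_growthI[of _ 1]) auto

lemma quad_growth_ident [simp, intro]: "quad_growth (\<lambda>u. u)"
proof (rule quad_growthI[of _ 1])
  fix u :: real
  have "0 \<le> (\<bar>u\<bar> - 1)\<^sup>2" by simp
  then have "2 * \<bar>u\<bar> \<le> 1 + u\<^sup>2" by (simp add: power2_diff)
  then show "\<bar>u\<bar> \<le> 1 * (1 + u\<^sup>2)" by simp
qed simp

lemma quad_growth_pos_part [simp, intro]: "quad_growth (\<lambda>u. max 0 u)"
  by (rule quad_growth_dominated[OF quad_growth_ident]) auto

lemma quad_growth_indicator [intro]: "B \<in> sets borel \<Longrightarrow> quad_growth (indicator B)"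
  by (rule quad_growth_bounded[of _ 1]) (auto simp: indicator_def)

lemma quad_growth_indicator_mult [intro]:
  "B \<in> sets borel \<Longrightarrow> quad_growth f \<Longrightarrow> quad_growth (\<lambda>u. indicator B u * f u)"
  by (rule quad_growth_dominated[of f]) (auto simp: indicator_def dest: quad_growth_measurable)

lemma quad_growth_shift:
  assumes "quad_growth f"
  shows "\<exists>C\<ge>0. \<forall>u x. \<bar>f (u + x)\<bar> \<le> C * (1 + 2 * u\<^sup>2 + 2 * x\<^sup>2)"
proof -
  obtain C where C: "0 \<le> C" "\<And>u. \<bar>f u\<bar> \<le> C * (1 + u\<^sup>2)"
    using assms unfolding quad_growth_def by blast
  have "\<bar>f (u + x)\<bar> \<le> C * (1 + 2 * u\<^sup>2 + 2 * x\<^sup>2)" for u x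
  proof -
    have "0 \<le> (u - x)\<^sup>2" by simp
    then have "1 + (u + x)\<^sup>2 \<le> 1 + 2 * u\<^sup>2 + 2 * x\<^sup>2" by (simp add: power2_diff power2_sum)
    with C show ?thesis by (meson mult_left_mono order_trans)
  qed
  with C(1) show ?thesis by blast
qed

section \<open>Iterates of the killed step for a centred law of finite variance\<close>

locale centred_law = real_distribution M for M :: "real measure" +
  fixes \<sigma> :: real
  assumes sd_pos: "0 < \<sigma>"
    and square_integrable: "integrable M (\<lambda>x. x\<^sup>2)"
    and mean_zero: "(\<integral>x. x \<partial>M) = 0"
    and second_moment: "(\<integral>x. x\<^sup>2 \<partial>M) = \<sigma>\<^sup>2"
begin

abbreviation "K B \<equiv> killed_step M B"
abbreviation "P \<equiv> killed_step M UNIV"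
abbreviation "Q \<equiv> killed_step M {0..}"

lemma prob_UNIV [simp]: "prob UNIV = 1"
  using prob_space by (simp add: space_eq_univ)

lemma integrable_quad_growth_shift:
  assumes "quad_growth f"
  shows "integrable M (\<lambda>x. f (u + x))"
proof -
  obtain C where "\<forall>u x. \<bar>f (u + x)\<bar> \<le> C * (1 + 2 * u\<^sup>2 + 2 * x\<^sup>2)"
    using quad_growth_shift[OF assms] by blast
  then have C: "\<bar>f (u + x)\<bar> \<le> C * (1 + 2 * u\<^sup>2 + 2 * x\<^sup>2)" for x by simp
  note [measurable] = quad_growth_measurable[OF assms]
  show ?thesis
    by (rule Bochner_Integration.integrable_bound[of M "\<lambda>x. C * (1 + 2 * u\<^sup>2 + 2 * x\<^sup>2)"])
       (use C square_integrable in \<open>auto intro!: AE_I2 order_trans[OF _ abs_ge_self]\<close>)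
qed

lemma integrable_quad_growth: "quad_growth f \<Longrightarrow> integrable M f"
  using integrable_quad_growth_shift[of f 0] by simp

lemma integrable_killed:
  assumes "quad_growth f" "B \<in> sets borel"
  shows "integrable M (\<lambda>x. indicator B (u + x) * f (u + x))"
  using integrable_quad_growth_shift[of "\<lambda>v. indicator B v * f v" u] assms by auto

text \<open>This closure is the reason for working with quadratic growth: a finite second moment
  integrates such functions, and the step returns a function of the same class, so iterates carry no
  further integrability conditions.\<close>

lemma quad_growth_killed_step [intro]:
  assumes "quad_growth f" and [measurable]: "B \<in> sets borel"
  shows "quad_growth (K B f)"
proof -
  note [measurable] = quad_growth_measurable[OF assms(1)]
  obtain C where "0 \<le> C" "\<forall>u x. \<bar>f (u + x)\<bar> \<le> C * (1 + 2 * u\<^sup>2 + 2 * x\<^sup>2)"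
    using quad_growth_shift[OF assms(1)] by blast
  then have C: "0 \<le> C" "\<bar>f (u + x)\<bar> \<le> C * (1 + 2 * u\<^sup>2 + 2 * x\<^sup>2)" for u x by simp_all
  show ?thesis
  proof (rule quad_growthI[of _ "C * (2 + 2 * \<sigma>\<^sup>2)"])
    show "K B f \<in> borel_measurable borel"
      unfolding killed_step_def by measurable
    fix u
    have "\<bar>K B f u\<bar> \<le> (\<integral>x. C * (1 + 2 * u\<^sup>2 + 2 * x\<^sup>2) \<partial>M)"
      unfolding killed_step_def
    proof (rule order_trans[OF integral_abs_bound], rule integral_mono)
      show "integrable M (\<lambda>x. \<bar>indicator B (u + x) * f (u + x)\<bar>)"
        using integrable_killed[OF assms] by auto
      show "integrable M (\<lambda>x. C * (1 + 2 * u\<^sup>2 + 2 * x\<^sup>2))"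
        using square_integrable by auto
      fix x show "\<bar>indicator B (u + x) * f (u + x)\<bar> \<le> C * (1 + 2 * u\<^sup>2 + 2 * x\<^sup>2)"
        using C(2)[of u x] C(1) by (cases "u + x \<in> B") auto
    qed
    also have "\<dots> = C * (1 + 2 * u\<^sup>2 + 2 * \<sigma>\<^sup>2)"
      using square_integrable by (simp add: second_moment)
    also have "\<dots> \<le> C * ((2 + 2 * \<sigma>\<^sup>2) * (1 + u\<^sup>2))"
      using C(1) by (intro mult_left_mono) (auto simp: algebra_simps)
    finally show "\<bar>K B f u\<bar> \<le> C * (2 + 2 * \<sigma>\<^sup>2) * (1 + u\<^sup>2)" by (simp add: mult.assoc)
  qed
qed

lemma quad_growth_iter [intro]:
  "quad_growth f \<Longrightarrow> B \<in> sets borel \<Longrightarrow> quad_growth ((K B ^^ k) f)"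
  by (induction k) auto

lemma killed_step_mono:
  assumes "quad_growth f" "quad_growth g" "B \<in> sets borel" "\<And>u. u \<in> B \<Longrightarrow> f u \<le> g u"
  shows "K B f u \<le> K B g u"
  unfolding killed_step_def
  by (intro integral_mono integrable_killed assms) (auto simp: indicator_def assms)

text \<open>Comparison is required on \<open>B\<close> only, because the indicator discards
  everything else. One-step estimates valid for nonnegative positions can thus be iterated.
  Membership of \<open>u\<close> serves the case \<open>k = 0\<close>, where nothing has been killed
  yet.\<close>

lemma iter_mono:
  assumes "quad_growth f" "quad_growth g" "B \<in> sets borel" "\<And>u. u \<in> B \<Longrightarrow> f u \<le> g u" "u \<in> B"
  shows "(K B ^^ k) f u \<le> (K B ^^ k) g u"
  using assms(5)
proof (induction k arbitrary: u)
  case (Suc k)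
  then show ?case using assms by (auto intro!: killed_step_mono)
qed (use assms in auto)

lemma killed_step_lincomb:
  assumes "quad_growth f" "quad_growth g" "B \<in> sets borel"
  shows "K B (\<lambda>u. a * f u + b * g u) = (\<lambda>u. a * K B f u + b * K B g u)"
proof
  fix u
  have "K B (\<lambda>u. a * f u + b * g u) u
      = (\<integral>x. a * (indicator B (u + x) * f (u + x)) + b * (indicator B (u + x) * g (u + x)) \<partial>M)"
    unfolding killed_step_def by (intro Bochner_Integration.integral_cong) (auto simp: algebra_simps)
  also have "\<dots> = a * K B f u + b * K B g u"
    unfolding killed_step_def using integrable_killed assms by simp
  finally show "K B (\<lambda>u. a * f u + b * g u) u = a * K B f u + b * K B g u" .
qed

lemma iter_lincomb:
  assumes "quad_growth f" "quad_growth g" "B \<in> sets borel"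
  shows "(K B ^^ k) (\<lambda>u. a * f u + b * g u) = (\<lambda>u. a * (K B ^^ k) f u + b * (K B ^^ k) g u)"
proof (induction k)
  case (Suc k)
  then show ?case using assms by (simp add: killed_step_lincomb quad_growth_iter)
qed simp

lemma iter_diff:
  assumes "quad_growth f" "quad_growth g" "B \<in> sets borel"
  shows "(K B ^^ k) (\<lambda>u. f u - g u) u = (K B ^^ k) f u - (K B ^^ k) g u"
  using fun_cong[OF iter_lincomb[OF assms, of k 1 "-1"]] by simp

lemma iter_cmult:
  assumes "quad_growth f" "B \<in> sets borel"
  shows "(K B ^^ k) (\<lambda>u. c * f u) u = c * (K B ^^ k) f u"
  using fun_cong[OF iter_lincomb[OF assms(1) assms(1) assms(2), of k c 0]] by simp

lemma iter_Suc_apply: "(K B ^^ Suc k) f = (K B ^^ k) (K B f)"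
  by (simp add: funpow_swap1)

text \<open>A discrete Duhamel formula: each summand is the one-step defect of the family,
  transported by \<open>k\<close> killed steps. A constant family gives Dynkin's formula, used for
  the Lyapunov function and the positive part. A kernel whose remaining time decreases with
  \<open>k\<close> gives the Lindeberg replacement.\<close>

lemma iter_telescope:
  assumes "\<And>k. quad_growth (f k)" "B \<in> sets borel"
  shows "(K B ^^ m) (f m) y = f 0 y + (\<Sum>k<m. (K B ^^ k) (\<lambda>u. K B (f (Suc k)) u - f k u) y)"
proof (induction m)
  case (Suc m)
  have "(K B ^^ m) (\<lambda>u. K B (f (Suc m)) u - f m u) y = (K B ^^ Suc m) (f (Suc m)) y - (K B ^^ m) (f m) y"
    unfolding iter_Suc_apply using assms by (intro iter_diff) auto
  with Suc show ?case by simp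
qed simp

lemma iter_nonneg:
  assumes "quad_growth f" "B \<in> sets borel" "\<And>u. u \<in> B \<Longrightarrow> 0 \<le> f u" "u \<in> B"
  shows "0 \<le> (K B ^^ k) f u"
proof -
  have "(K B ^^ k) (\<lambda>_. 0) u = 0"
    using iter_cmult[of "\<lambda>_. 0" B k 0 u] assms by simp
  with iter_mono[of "\<lambda>_. 0" f B u k] assms show ?thesis by auto
qed

lemma iter_abs_le:
  assumes "quad_growth f" "quad_growth g" "B \<in> sets borel" "\<And>u. u \<in> B \<Longrightarrow> \<bar>f u\<bar> \<le> g u" "u \<in> B"
  shows "\<bar>(K B ^^ k) f u\<bar> \<le> (K B ^^ k) g u"
proof -
  have "(K B ^^ k) f u \<le> (K B ^^ k) g u"
    by (rule iter_mono) (use assms(4) in \<open>force intro: assms\<close>)+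
  moreover have "(K B ^^ k) (\<lambda>u. (-1) * f u) u \<le> (K B ^^ k) g u"
  proof (rule iter_mono)
    show "quad_growth (\<lambda>u. - 1 * f u)" using assms(1) by blast
    show "- 1 * f u \<le> g u" if "u \<in> B" for u using assms(4)[OF that] by linarith
  qed (use assms in auto)
  ultimately show ?thesis using iter_cmult[OF assms(1,3), of k "-1" u] by linarith
qed

end

subsection \<open>The total undershoot below zero\<close>

text \<open>Weighted arithmetic-geometric mean of \<open>1 + z\<close> and 1. The point
  \<open>z = -1\<close> is separate, since Young's inequality asks for positive arguments; there the
  left side is 0.\<close>

lemma powr_one_plus_le:
  fixes z \<gamma> :: real
  assumes "0 < \<gamma>" "\<gamma> < 1" "-1 \<le> z"
  shows "(1 + z) powr \<gamma> \<le> 1 + \<gamma> * z"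
proof (cases "z = -1")
  case False
  then show ?thesis using Youngs_inequality_0[of \<gamma> "1 - \<gamma>" "1 + z" 1] assms
    by (simp add: algebra_simps)
qed (use assms in auto)

text \<open>Taylor to second order. Half the second derivative at an intermediate point
  \<open>t\<close> contains \<open>(1 + t) powr (\<gamma> - 2)\<close>, which is at least
  \<open>(3 / 2) powr (- 2)\<close>, that is 4/9, as \<open>1 + t\<close> is at most 3/2. This gives
  the factor 2/9.\<close>

lemma powr_one_plus_le_quadratic:
  fixes z \<gamma> :: real
  assumes \<gamma>: "0 < \<gamma>" "\<gamma> < 1" and z: "\<bar>z\<bar> \<le> 1 / 2"
  shows "(1 + z) powr \<gamma> \<le> 1 + \<gamma> * z - 2 / 9 * \<gamma> * (1 - \<gamma>) * z\<^sup>2"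
proof -
  define d :: "nat \<Rightarrow> real \<Rightarrow> real" where
    "d = (\<lambda>m t. if m = 0 then (1 + t) powr \<gamma> else if m = 1 then \<gamma> * (1 + t) powr (\<gamma> - 1)
       else \<gamma> * (\<gamma> - 1) * (1 + t) powr (\<gamma> - 2))"
  have "\<exists>t. \<bar>t\<bar> \<le> \<bar>z\<bar> \<and> (1 + z) powr \<gamma> = (\<Sum>m<2. d m 0 / fact m * z ^ m) + d 2 t / fact 2 * z ^ 2"
  proof (rule Maclaurin_bi_le)
    show "d 0 = (\<lambda>t. (1 + t) powr \<gamma>)" by (auto simp: d_def)
    show "\<forall>m t. m < 2 \<and> \<bar>t\<bar> \<le> \<bar>z\<bar> \<longrightarrow> (d m has_real_derivative d (Suc m) t) (at t)"
    proof (intro allI impI)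
      fix m :: nat and t assume *: "m < 2 \<and> \<bar>t\<bar> \<le> \<bar>z\<bar>"
      then have "0 < 1 + t" using z by auto
      have D: "((\<lambda>t. (1 + t) powr r) has_real_derivative r * (1 + t) powr (r - 1)) (at t)" for r
        using DERIV_chain'[of "\<lambda>t. 1 + t" 1 t UNIV "\<lambda>z. z powr r" "r * (1 + t) powr (r - 1)"]
          has_real_derivative_powr[OF \<open>0 < 1 + t\<close>, of r]
        using \<open>0 < 1 + t\<close> by (auto intro!: derivative_eq_intros)
      show "(d m has_real_derivative d (Suc m) t) (at t)"
      proof (cases "m = 0")
        case True
        then show ?thesis using D[of \<gamma>] by (simp add: d_def)
      next
        case False
        then have "m = 1" using * by linarith
        then show ?thesis using DERIV_cmult[OF D[of "\<gamma> - 1"], of \<gamma>] by (simp add: d_def mult.assoc)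
      qed
    qed
  qed
  then obtain t where t: "\<bar>t\<bar> \<le> \<bar>z\<bar>"
    and "(1 + z) powr \<gamma> = (\<Sum>m<2. d m 0 / fact m * z ^ m) + d 2 t / fact 2 * z ^ 2" by blast
  moreover have "{..<2} = {0, 1 :: nat}" by auto
  ultimately have eq: "(1 + z) powr \<gamma> = 1 + \<gamma> * z + \<gamma> * (\<gamma> - 1) * (1 + t) powr (\<gamma> - 2) / 2 * z ^ 2"
    by (simp add: d_def)
  have t': "0 < 1 + t" "1 + t \<le> 3 / 2" using t z by auto
  have "4 / 9 \<le> (3 / 2 :: real) powr (\<gamma> - 2)"
  proof -
    have "(3 / 2 :: real) powr (- 2) \<le> (3 / 2) powr (\<gamma> - 2)"
      using \<gamma> by (intro powr_mono) auto
    also have "(3 / 2 :: real) powr (- 2) = 4 / 9"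
      by (simp add: powr_minus powr_numeral power2_eq_square divide_simps)
    finally show ?thesis .
  qed
  also have "\<dots> \<le> (1 + t) powr (\<gamma> - 2)"
    using t' \<gamma> by (intro powr_mono2') auto
  finally have "4 / 9 \<le> (1 + t) powr (\<gamma> - 2)" .
  then have "\<gamma> * (1 - \<gamma>) * z\<^sup>2 * (4 / 9) \<le> \<gamma> * (1 - \<gamma>) * z\<^sup>2 * (1 + t) powr (\<gamma> - 2)"
    using \<gamma> by (intro mult_left_mono) auto
  moreover have "\<gamma> * (\<gamma> - 1) * (1 + t) powr (\<gamma> - 2) / 2 * z ^ 2
      = - (\<gamma> * (1 - \<gamma>) * z\<^sup>2 * (1 + t) powr (\<gamma> - 2)) / 2"
    by (simp add: algebra_simps)
  moreover have "2 / 9 * \<gamma> * (1 - \<gamma>) * z\<^sup>2 = \<gamma> * (1 - \<gamma>) * z\<^sup>2 * (4 / 9) / 2" by simp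
  ultimately show ?thesis unfolding eq by linarith
qed

text \<open>The restriction to small \<delta> loses no generality, since higher moments control
  lower ones. It keeps the Lyapunov exponent \<open>1 - \<delta>\<close> strictly between 0 and 1
  and allows the interpolation of Taylor remainders between orders two and three.\<close>

locale moment_law = centred_law +
  fixes \<delta> :: real
  assumes \<delta>_pos: "0 < \<delta>" and \<delta>_le: "\<delta> \<le> 1 / 2"
    and moment: "integrable M (\<lambda>x. \<bar>x\<bar> powr (2 + \<delta>))"
begin

definition abs_moment :: real where "abs_moment = (\<integral>x. \<bar>x\<bar> powr (2 + \<delta>) \<partial>M)"

definition undershoot :: "real \<Rightarrow> real" where
  "undershoot u = (\<integral>x. max 0 (- (u + x)) \<partial>M)"

lemma abs_moment_nonneg: "0 \<le> abs_moment"
  unfolding abs_moment_def by (intro integral_nonneg_AE) auto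

lemma quad_growth_neg_part: "quad_growth (\<lambda>v. max 0 (- v))"
  by (rule quad_growth_dominated[OF quad_growth_ident]) auto

lemma integrable_undershoot: "integrable M (\<lambda>x. max 0 (- (u + x)))"
  by (rule integrable_quad_growth_shift[OF quad_growth_neg_part])

lemma undershoot_nonneg: "0 \<le> undershoot u"
  unfolding undershoot_def by (intro integral_nonneg_AE) auto

lemma quad_growth_undershoot: "quad_growth undershoot"
proof -
  have "undershoot = P (\<lambda>v. max 0 (- v))"
    by (simp add: undershoot_def killed_step_def fun_eq_iff)
  then show ?thesis using quad_growth_killed_step[OF quad_growth_neg_part, of UNIV] by simp
qed

lemma abs_powr_tail:
  fixes x b :: real
  assumes "0 < b" "b < \<bar>x\<bar>"
  shows "\<bar>x\<bar> \<le> b powr (- 1 - \<delta>) * \<bar>x\<bar> powr (2 + \<delta>)"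
    and "x\<^sup>2 \<le> b powr (- \<delta>) * \<bar>x\<bar> powr (2 + \<delta>)"
proof -
  have "\<bar>x\<bar> powr (2 + \<delta>) = \<bar>x\<bar> * \<bar>x\<bar> powr (1 + \<delta>)"
    using assms by (simp add: powr_add power2_eq_square)
  moreover have "b powr (1 + \<delta>) \<le> \<bar>x\<bar> powr (1 + \<delta>)"
    using assms \<delta>_pos by (intro powr_mono2) auto
  ultimately have "\<bar>x\<bar> * b powr (1 + \<delta>) \<le> \<bar>x\<bar> powr (2 + \<delta>)" by (simp add: mult_left_mono)
  moreover have "b powr (- 1 - \<delta>) = 1 / b powr (1 + \<delta>)"
    using powr_minus_divide[of b "1 + \<delta>"] by simp
  ultimately show "\<bar>x\<bar> \<le> b powr (- 1 - \<delta>) * \<bar>x\<bar> powr (2 + \<delta>)"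
    using assms by (simp add: pos_le_divide_eq)
  have "\<bar>x\<bar> powr (2 + \<delta>) = x\<^sup>2 * \<bar>x\<bar> powr \<delta>"
    using assms by (simp add: powr_add powr_numeral power2_eq_square)
  moreover have "b powr \<delta> \<le> \<bar>x\<bar> powr \<delta>"
    using assms \<delta>_pos by (intro powr_mono2) auto
  ultimately have "x\<^sup>2 * b powr \<delta> \<le> \<bar>x\<bar> powr (2 + \<delta>)" by (simp add: mult_left_mono)
  then show "x\<^sup>2 \<le> b powr (- \<delta>) * \<bar>x\<bar> powr (2 + \<delta>)"
    using assms by (simp add: powr_minus_divide pos_le_divide_eq)
qed

text \<open>Three ranges of the step. For \<open>\<bar>x\<bar> \<le> A / 2\<close> the ratio
  \<open>x / b\<close> is at most 1/2 in absolute value and the quadratic gain is available. For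
  larger steps only the tangent bound holds, but there \<open>x\<^sup>2\<close> is at most the
  subtracted moment term, so no gain is claimed. For \<open>x < - b\<close> the left side vanishes
  while the tangent line may be negative, and the last term pays for this.\<close>

lemma lyapunov_pointwise:
  fixes u x A :: real
  assumes A: "0 < A" and u: "0 \<le> u" and b: "b = u + A" and \<gamma>: "\<gamma> = 1 - \<delta>"
  shows "indicator {0..} (u + x) * (\<bar>u + x\<bar> + A) powr \<gamma> \<le>
    b powr \<gamma> + \<gamma> * b powr (\<gamma> - 1) * x
    - 2 / 9 * \<gamma> * (1 - \<gamma>) * b powr (\<gamma> - 2) * (x\<^sup>2 - (A / 2) powr (- \<delta>) * \<bar>x\<bar> powr (2 + \<delta>))
    + \<gamma> * b powr (\<gamma> - 2) * A powr (- \<delta>) * \<bar>x\<bar> powr (2 + \<delta>)"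
    (is "?L \<le> ?T - ?c * b powr (\<gamma> - 2) * (x\<^sup>2 - ?m) + ?r")
proof -
  have \<gamma>': "0 < \<gamma>" "\<gamma> < 1" using \<gamma> \<delta>_pos \<delta>_le by auto
  have bpos: "0 < b" "A \<le> b" using A u b by auto
  have c: "0 \<le> ?c" using \<gamma>' by simp
  have r: "0 \<le> ?r" using \<gamma>' by simp
  define z where "z = x / b"
  have scale: "(b + x) powr \<gamma> = b powr \<gamma> * (1 + z) powr \<gamma>" if "- b \<le> x"
  proof -
    have "b + x = b * (1 + z)" using bpos by (simp add: z_def field_simps)
    moreover have "0 \<le> 1 + z" using that bpos by (simp add: z_def field_simps)
    ultimately show ?thesis using bpos by (simp add: powr_mult)
  qed
  have T: "?T = b powr \<gamma> * (1 + \<gamma> * z)"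
    using bpos by (simp add: z_def powr_diff field_simps)
  have L: "?L \<le> (b + x) powr \<gamma>" if "- b \<le> x"
  proof (cases "0 \<le> u + x")
    case True then show ?thesis using b by (simp add: add.commute add.left_commute)
  qed auto
  show ?thesis
  proof (cases "\<bar>x\<bar> \<le> A / 2")
    case True
    have z: "\<bar>z\<bar> \<le> 1 / 2" using True bpos by (simp add: z_def field_simps)
    have xb: "- b \<le> x" using True bpos A by linarith
    have "?L \<le> b powr \<gamma> * (1 + z) powr \<gamma>" using L[OF xb] scale[OF xb] by simp
    also have "\<dots> \<le> b powr \<gamma> * (1 + \<gamma> * z - ?c * z\<^sup>2)"
      using powr_one_plus_le_quadratic[OF \<gamma>' z] by (intro mult_left_mono) auto
    also have "\<dots> = ?T - ?c * b powr (\<gamma> - 2) * x\<^sup>2"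
      unfolding T using bpos by (simp add: z_def powr_diff powr_numeral field_simps)
    also have "\<dots> \<le> ?T - ?c * b powr (\<gamma> - 2) * (x\<^sup>2 - ?m)"
      using c by (intro diff_left_mono mult_left_mono) auto
    finally show ?thesis using r by linarith
  next
    case False
    then have m: "x\<^sup>2 \<le> ?m" using abs_powr_tail(2)[of "A / 2" x] A by auto
    have neg: "?c * b powr (\<gamma> - 2) * (x\<^sup>2 - ?m) \<le> 0"
      using m c by (intro mult_nonneg_nonpos) auto
    show ?thesis
    proof (cases "- b \<le> x")
      case True
      have "?L \<le> b powr \<gamma> * (1 + z) powr \<gamma>" using L[OF True] scale[OF True] by simp
      also have "\<dots> \<le> ?T" unfolding T
        using True bpos by (intro mult_left_mono powr_one_plus_le \<gamma>') (auto simp: z_def field_simps)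
      finally show ?thesis using r neg by linarith
    next
      case xb: False
      then have L0: "?L = 0" using b A by (auto simp: indicator_def)
      have "\<bar>x\<bar> \<le> b powr (- 1 - \<delta>) * \<bar>x\<bar> powr (2 + \<delta>)"
        using xb bpos by (intro abs_powr_tail) auto
      then have "\<gamma> * b powr (\<gamma> - 1) * \<bar>x\<bar> \<le> \<gamma> * b powr (\<gamma> - 1) * (b powr (- 1 - \<delta>) * \<bar>x\<bar> powr (2 + \<delta>))"
        using \<gamma>' by (intro mult_left_mono) auto
      also have "\<dots> = \<gamma> * b powr (\<gamma> - 2) * b powr (- \<delta>) * \<bar>x\<bar> powr (2 + \<delta>)"
        by (simp add: mult.assoc flip: powr_add) (simp add: algebra_simps)
      also have "\<dots> \<le> ?r"
        using bpos A \<delta>_pos \<gamma>' by (intro mult_right_mono mult_left_mono powr_mono2') auto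
      finally have "- (\<gamma> * b powr (\<gamma> - 1) * x) \<le> ?r" using xb bpos by simp
      moreover have "0 \<le> b powr \<gamma>" by simp
      ultimately show ?thesis using L0 neg by linarith
    qed
  qed
qed

text \<open>When a step undershoots, \<open>\<bar>x\<bar> + A\<close> exceeds \<open>u + A\<close>,
  so the power \<open>1 + \<delta>\<close> of their ratio can be inserted. The resulting power of
  \<open>u + A\<close> is exactly that of the Lyapunov gain, because
  \<open>\<gamma> - 2 = - 1 - \<delta>\<close> for \<open>\<gamma> = 1 - \<delta>\<close>.\<close>

lemma undershoot_le:
  assumes A: "0 < A" and u: "0 \<le> u"
  shows "undershoot u \<le> (u + A) powr (- 1 - \<delta>) * (\<integral>x. (\<bar>x\<bar> + A) powr (2 + \<delta>) \<partial>M)"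
    and "integrable M (\<lambda>x. (\<bar>x\<bar> + A) powr (2 + \<delta>))"
proof -
  show int: "integrable M (\<lambda>x. (\<bar>x\<bar> + A) powr (2 + \<delta>))"
  proof (rule Bochner_Integration.integrable_bound)
    show "integrable M (\<lambda>x. 2 powr (2 + \<delta>) * \<bar>x\<bar> powr (2 + \<delta>) + (2 * A) powr (2 + \<delta>))"
      using moment by auto
    have "(\<bar>x\<bar> + A) powr (2 + \<delta>) \<le> (2 * \<bar>x\<bar>) powr (2 + \<delta>) + (2 * A) powr (2 + \<delta>)" for x
    proof (cases "\<bar>x\<bar> \<le> A")
      case True
      have "(\<bar>x\<bar> + A) powr (2 + \<delta>) \<le> (2 * A) powr (2 + \<delta>)"
        using True A \<delta>_pos by (intro powr_mono2) auto
      then show ?thesis by (simp add: add_increasing)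
    next
      case False
      have "(\<bar>x\<bar> + A) powr (2 + \<delta>) \<le> (2 * \<bar>x\<bar>) powr (2 + \<delta>)"
        using False A \<delta>_pos by (intro powr_mono2) auto
      then show ?thesis by (simp add: add_increasing2)
    qed
    then show "AE x in M. norm ((\<bar>x\<bar> + A) powr (2 + \<delta>)) \<le>
        norm (2 powr (2 + \<delta>) * \<bar>x\<bar> powr (2 + \<delta>) + (2 * A) powr (2 + \<delta>))"
      by (auto simp: powr_mult)
  qed auto
  have "undershoot u \<le> (\<integral>x. (u + A) powr (- 1 - \<delta>) * (\<bar>x\<bar> + A) powr (2 + \<delta>) \<partial>M)"
    unfolding undershoot_def
  proof (rule integral_mono)
    show "integrable M (\<lambda>x. max 0 (- (u + x)))" by (rule integrable_undershoot)
    show "integrable M (\<lambda>x. (u + A) powr (- 1 - \<delta>) * (\<bar>x\<bar> + A) powr (2 + \<delta>))" using int by auto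
    fix x :: real
    show "max 0 (- (u + x)) \<le> (u + A) powr (- 1 - \<delta>) * (\<bar>x\<bar> + A) powr (2 + \<delta>)"
    proof (cases "u < - x")
      case True
      have "max 0 (- (u + x)) \<le> \<bar>x\<bar> + A" using A u by auto
      also have "\<dots> = (\<bar>x\<bar> + A) powr (- 1 - \<delta>) * (\<bar>x\<bar> + A) powr (2 + \<delta>)"
        using A by (simp flip: powr_add)
      also have "\<dots> \<le> (u + A) powr (- 1 - \<delta>) * (\<bar>x\<bar> + A) powr (2 + \<delta>)"
        using True u A \<delta>_pos by (intro mult_right_mono powr_mono2') auto
      finally show ?thesis .
    qed auto
  qed
  then show "undershoot u \<le> (u + A) powr (- 1 - \<delta>) * (\<integral>x. (\<bar>x\<bar> + A) powr (2 + \<delta>) \<partial>M)" by simp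
qed

end

context moment_law begin

text \<open>By concavity \<open>(u + A) powr (1 - \<delta>)\<close> loses about \<open>(u + A) powr (- 1 - \<delta>)\<close> in each step, which is
  also the order of the expected undershoot of one step from \<open>u\<close>.\<close>

lemma lyapunov_drift:
  "\<exists>A\<ge>1. \<exists>c>0. \<forall>u\<ge>0. Q (\<lambda>v. (\<bar>v\<bar> + A) powr (1 - \<delta>)) u \<le> (\<bar>u\<bar> + A) powr (1 - \<delta>) - c * undershoot u"
proof -
  define \<gamma> where "\<gamma> = 1 - \<delta>"
  define k where "k = 2 / 9 * \<gamma> * (1 - \<gamma>)"
  have \<gamma>': "0 < \<gamma>" "\<gamma> < 1" "0 < k" using \<delta>_pos \<delta>_le by (auto simp: \<gamma>_def k_def)
  have t1: "((\<lambda>A. A powr (- \<delta>)) \<longlongrightarrow> 0) at_top"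
    using \<delta>_pos by (intro tendsto_neg_powr filterlim_ident) auto
  have "filterlim (\<lambda>A. 1 / 2 * A) at_top (at_top :: real filter)"
    by (rule filterlim_tendsto_pos_mult_at_top[OF tendsto_const _ filterlim_ident]) auto
  then have t2: "((\<lambda>A. (A / 2) powr (- \<delta>)) \<longlongrightarrow> 0) at_top"
    using \<delta>_pos by (intro tendsto_neg_powr) (auto simp: mult.commute)
  \<comment> \<open>The limit is a positive multiple of the variance: a large shift \<open>A\<close>
    makes both moment corrections negligible.\<close>
  have "((\<lambda>A. k * (\<sigma>\<^sup>2 - (A / 2) powr (- \<delta>) * abs_moment) - \<gamma> * A powr (- \<delta>) * abs_moment)
     \<longlongrightarrow> k * (\<sigma>\<^sup>2 - 0 * abs_moment) - \<gamma> * 0 * abs_moment) at_top"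
    using t1 t2 by (intro tendsto_intros)
  moreover have "0 < k * (\<sigma>\<^sup>2 - 0 * abs_moment) - \<gamma> * 0 * abs_moment"
    using \<gamma>' sd_pos by simp
  ultimately have "\<forall>\<^sub>F A in at_top. 0 < k * (\<sigma>\<^sup>2 - (A / 2) powr (- \<delta>) * abs_moment) - \<gamma> * A powr (- \<delta>) * abs_moment"
    by (rule order_tendstoD(1))
  then have "\<forall>\<^sub>F A in at_top. 1 \<le> A \<and> 0 < k * (\<sigma>\<^sup>2 - (A / 2) powr (- \<delta>) * abs_moment) - \<gamma> * A powr (- \<delta>) * abs_moment"
    using eventually_ge_at_top[of "1::real"] by eventually_elim auto
  then obtain A where A: "1 \<le> A"
    and pos: "0 < k * (\<sigma>\<^sup>2 - (A / 2) powr (- \<delta>) * abs_moment) - \<gamma> * A powr (- \<delta>) * abs_moment" (is "0 < ?g")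
    unfolding eventually_at_top_linorder by blast
  define E where "E = (\<integral>x. (\<bar>x\<bar> + A) powr (2 + \<delta>) \<partial>M)"
  have "0 \<le> E" unfolding E_def by (intro integral_nonneg_AE) auto
  \<comment> \<open>With this choice \<open>c * E\<close> is at most the gain, and
    \<open>E + 1\<close> is a positive denominator.\<close>
  define c where "c = ?g / (E + 1)"
  have "0 < c" using pos \<open>0 \<le> E\<close> by (simp add: c_def)
  have "Q (\<lambda>v. (\<bar>v\<bar> + A) powr \<gamma>) u \<le> (\<bar>u\<bar> + A) powr \<gamma> - c * undershoot u" if u: "0 \<le> u" for u
  proof -
    define b where "b = u + A"
    have qg: "quad_growth (\<lambda>v. (\<bar>v\<bar> + A) powr \<gamma>)"
    proof (rule quad_growth_dominated[of "\<lambda>v. (1 + v\<^sup>2) + A"])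
      fix v :: real
      have "0 \<le> (\<bar>v\<bar> - 1)\<^sup>2" by simp
      then have "\<bar>v\<bar> \<le> 1 + v\<^sup>2" by (simp add: power2_diff)
      moreover have "(\<bar>v\<bar> + A) powr \<gamma> \<le> (\<bar>v\<bar> + A) powr 1" using A \<gamma>' by (intro powr_mono) auto
      ultimately show "\<bar>(\<bar>v\<bar> + A) powr \<gamma>\<bar> \<le> \<bar>(1 + v\<^sup>2) + A\<bar>" using A by simp
    qed (auto intro!: quad_growth_add quad_growth_square)
    have "Q (\<lambda>v. (\<bar>v\<bar> + A) powr \<gamma>) u \<le> (\<integral>x. b powr \<gamma> + \<gamma> * b powr (\<gamma> - 1) * x
       - k * b powr (\<gamma> - 2) * (x\<^sup>2 - (A / 2) powr (- \<delta>) * \<bar>x\<bar> powr (2 + \<delta>))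
       + \<gamma> * b powr (\<gamma> - 2) * A powr (- \<delta>) * \<bar>x\<bar> powr (2 + \<delta>) \<partial>M)"
      unfolding killed_step_def
    proof (rule integral_mono)
      show "integrable M (\<lambda>x. indicator {0..} (u + x) * (\<bar>u + x\<bar> + A) powr \<gamma>)"
        using qg by (intro integrable_killed) auto
      show "integrable M (\<lambda>x. b powr \<gamma> + \<gamma> * b powr (\<gamma> - 1) * x
       - k * b powr (\<gamma> - 2) * (x\<^sup>2 - (A / 2) powr (- \<delta>) * \<bar>x\<bar> powr (2 + \<delta>))
       + \<gamma> * b powr (\<gamma> - 2) * A powr (- \<delta>) * \<bar>x\<bar> powr (2 + \<delta>))"
        using moment square_integrable integrable_quad_growth[OF quad_growth_ident] by auto
    qed (use lyapunov_pointwise[OF _ u b_def \<gamma>_def] A in \<open>auto simp: k_def\<close>)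
    also have "\<dots> = b powr \<gamma> - b powr (\<gamma> - 2) * ?g"
      using moment square_integrable integrable_quad_growth[OF quad_growth_ident]
      by (simp add: mean_zero second_moment flip: abs_moment_def) (simp add: algebra_simps)
    also have "\<dots> \<le> b powr \<gamma> - c * undershoot u"
    proof -
      have "c * undershoot u \<le> c * (b powr (- 1 - \<delta>) * E)"
        using undershoot_le(1)[of A u] A u \<open>0 < c\<close> by (intro mult_left_mono) (auto simp: b_def E_def)
      also have "\<dots> = b powr (\<gamma> - 2) * (?g * (E / (E + 1)))"
        by (simp add: c_def \<gamma>_def)
      also have "\<dots> \<le> b powr (\<gamma> - 2) * (?g * 1)"
        using pos \<open>0 \<le> E\<close> by (intro mult_left_mono) auto
      finally show ?thesis by simp
    qed
    finally show ?thesis using u by (simp add: b_def)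
  qed
  with A \<open>0 < c\<close> show ?thesis unfolding \<gamma>_def by blast
qed

text \<open>The drift is summed along the killed walk. The Lyapunov function stays nonnegative, so
  the total loss is at most its initial value, whatever the number of steps.\<close>

lemma total_undershoot_le:
  "\<exists>C>0. \<forall>m. \<forall>y\<ge>0. (\<Sum>k<m. (Q ^^ k) undershoot y) \<le> C * (1 + y) powr (1 - \<delta>)"
proof -
  obtain A c where A: "1 \<le> A" and c: "0 < c"
    and drift: "\<forall>u\<ge>0. Q (\<lambda>v. (\<bar>v\<bar> + A) powr (1 - \<delta>)) u \<le> (\<bar>u\<bar> + A) powr (1 - \<delta>) - c * undershoot u"
    using lyapunov_drift by blast
  define h where [abs_def]: "h v = (\<bar>v\<bar> + A) powr (1 - \<delta>)" for v
  have qg: "quad_growth h"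
  proof (rule quad_growth_dominated[of "\<lambda>v. (1 + v\<^sup>2) + A"])
    fix v :: real
    have "0 \<le> (\<bar>v\<bar> - 1)\<^sup>2" by simp
    then have "\<bar>v\<bar> \<le> 1 + v\<^sup>2" by (simp add: power2_diff)
    moreover have "h v \<le> (\<bar>v\<bar> + A) powr 1" unfolding h_def using A \<delta>_pos by (intro powr_mono) auto
    moreover have "0 \<le> h v" by (simp add: h_def)
    ultimately show "\<bar>h v\<bar> \<le> \<bar>(1 + v\<^sup>2) + A\<bar>" using A by simp
  qed (auto intro!: quad_growth_add quad_growth_square simp: h_def)
  have "c * (\<Sum>k<m. (Q ^^ k) undershoot y) \<le> h y" if y: "0 \<le> y" for m y
  proof -
    have "0 \<le> (Q ^^ m) h y" using qg y by (intro iter_nonneg) (auto simp: h_def)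
    also have "\<dots> = h y + (\<Sum>k<m. (Q ^^ k) (\<lambda>u. Q h u - h u) y)"
      using qg by (subst iter_telescope[of "\<lambda>_. h"]) auto
    also have "\<dots> \<le> h y + (\<Sum>k<m. (Q ^^ k) (\<lambda>u. (- c) * undershoot u) y)"
    proof (intro add_left_mono sum_mono iter_mono)
      fix u :: real assume "u \<in> {0..}"
      then show "Q h u - h u \<le> - c * undershoot u" using drift[rule_format, of u] by (simp add: h_def)
    qed (use qg y quad_growth_undershoot in \<open>auto intro!: quad_growth_cmult quad_growth_diff\<close>)
    also have "\<dots> = h y - c * (\<Sum>k<m. (Q ^^ k) undershoot y)"
      using iter_cmult[OF quad_growth_undershoot, of "{0..}" _ "- c" y] by (simp add: sum_distrib_left sum_negf)
    finally show ?thesis by simp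
  qed
  moreover have "h y \<le> A powr (1 - \<delta>) * (1 + y) powr (1 - \<delta>)" if "0 \<le> y" for y
  proof -
    have "y + A \<le> A * (1 + y)" using A that mult_right_mono[of 1 A y] by (simp add: algebra_simps)
    then have "h y \<le> (A * (1 + y)) powr (1 - \<delta>)"
      unfolding h_def using A that \<delta>_le by (intro powr_mono2) auto
    then show ?thesis using A that by (simp add: powr_mult)
  qed
  ultimately have "c * (\<Sum>k<m. (Q ^^ k) undershoot y) \<le> A powr (1 - \<delta>) * (1 + y) powr (1 - \<delta>)" if "0 \<le> y" for m y
    using that order_trans by blast
  then have "(\<Sum>k<m. (Q ^^ k) undershoot y) \<le> (A powr (1 - \<delta>) / c) * (1 + y) powr (1 - \<delta>)" if "0 \<le> y" for m y
    using that c by (simp add: pos_le_divide_eq mult.commute)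
  moreover have "0 < A powr (1 - \<delta>) / c" using A c by simp
  ultimately show ?thesis by blast
qed

end

subsection \<open>Survival probabilities\<close>

text \<open>Chebyshev's correlation inequality: \<open>(F s - F t) * (G s - G t)\<close> is
  nonnegative and is integrated over two copies of the variable, one after the other.\<close>

lemma (in prob_space) integral_mono_mult_ge:
  fixes F G :: "real \<Rightarrow> real" and X :: "'a \<Rightarrow> real"
  assumes "mono F" "mono G"
    and F: "integrable M (\<lambda>x. F (X x))" and G: "integrable M (\<lambda>x. G (X x))"
    and FG: "integrable M (\<lambda>x. F (X x) * G (X x))"
  shows "expectation (\<lambda>x. F (X x)) * expectation (\<lambda>x. G (X x)) \<le> expectation (\<lambda>x. F (X x) * G (X x))"
proof -
  define a b c where "a = expectation (\<lambda>x. F (X x))" and "b = expectation (\<lambda>x. G (X x))"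
    and "c = expectation (\<lambda>x. F (X x) * G (X x))"
  have "0 \<le> (F s - F t) * (G s - G t)" for s t
    using assms(1,2) by (cases s t rule: linorder_cases) (auto simp: mono_def zero_le_mult_iff less_imp_le)
  then have "0 \<le> F s * G s - F s * G t - G s * F t + F t * G t" for s t
    by (simp add: algebra_simps)
  then have "0 \<le> expectation (\<lambda>y. F s * G s - F s * G (X y) - G s * F (X y) + F (X y) * G (X y))" for s
    by (intro integral_nonneg_AE) auto
  also have "expectation (\<lambda>y. F s * G s - F s * G (X y) - G s * F (X y) + F (X y) * G (X y))
      = F s * G s - F s * b - G s * a + c" for s
    using F G FG by (simp add: a_def b_def c_def prob_space)
  finally have "0 \<le> F s * G s - F s * b - G s * a + c" for s .
  then have "0 \<le> expectation (\<lambda>x. F (X x) * G (X x) - F (X x) * b - G (X x) * a + c)"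
    by (intro integral_nonneg_AE) auto
  also have "\<dots> = c - a * b - b * a + c"
    using F G FG by (simp add: a_def b_def c_def prob_space)
  finally show ?thesis unfolding a_def b_def c_def by simp
qed

context centred_law
begin

text \<open>Nonnegativity of \<open>f\<close> is essential for monotonicity: killing replaces
  \<open>f\<close> by 0 below zero, and the jump at zero must go upwards.\<close>

lemma killed_step_mono_fun:
  assumes f: "quad_growth f" "mono f" "\<And>u. 0 \<le> f u"
  shows "mono (Q f)" "0 \<le> Q f u"
proof -
  have *: "indicator {0..} u * f u \<le> indicator {0..} v * f v" if "u \<le> v" for u v :: real
    using that f(3) monoD[OF f(2) that] by (auto simp: indicator_def)
  show "mono (Q f)" unfolding killed_step_def
    by (intro monoI integral_mono integrable_killed f(1)) (auto intro: *)
  show "0 \<le> Q f u" unfolding killed_step_def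
    using f(3) by (intro integral_nonneg_AE) auto
qed

lemma iter_mono_fun:
  assumes f: "quad_growth f" "mono f" "\<And>u. 0 \<le> f u"
  shows "mono ((Q ^^ k) f)" "0 \<le> (Q ^^ k) f u"
proof -
  have "mono ((Q ^^ k) f) \<and> (\<forall>u. 0 \<le> (Q ^^ k) f u)"
  proof (induction k)
    case (Suc k)
    moreover have "quad_growth ((Q ^^ k) f)" using f by auto
    ultimately show ?case using killed_step_mono_fun[of "(Q ^^ k) f"] by simp
  qed (simp add: f)
  then show "mono ((Q ^^ k) f)" "0 \<le> (Q ^^ k) f u" by auto
qed

lemma free_step_mono_fun:
  assumes "quad_growth f" "mono f"
  shows "mono (P f)"
proof (rule monoI)
  fix u v :: real assume "u \<le> v"
  then have "f (u + x) \<le> f (v + x)" for x by (intro monoD[OF assms(2)]) simp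
  then show "P f u \<le> P f v"
    unfolding killed_step_def using integrable_quad_growth_shift[OF assms(1)]
    by (intro integral_mono) simp_all
qed

lemma free_iter_mono_fun: "quad_growth f \<Longrightarrow> mono f \<Longrightarrow> mono ((P ^^ k) f)"
proof (induction k)
  case (Suc k)
  then show ?case using free_step_mono_fun[of "(P ^^ k) f"] quad_growth_iter[of f UNIV k] by simp
qed simp

lemma iter_one_le: "(Q ^^ k) (\<lambda>_. 1) u \<le> 1"
proof (induction k arbitrary: u)
  case (Suc k)
  have int: "integrable M (\<lambda>x. indicator {0..} (u + x) * (Q ^^ k) (\<lambda>_. 1) (u + x))"
    by (intro integrable_killed) auto
  have "Q ((Q ^^ k) (\<lambda>_. 1)) u \<le> (\<integral>x. 1 \<partial>M)"
    unfolding killed_step_def[of M _ "(Q ^^ k) (\<lambda>_. 1)"]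
    by (rule integral_mono[OF int]) (use Suc in \<open>auto simp: indicator_def\<close>)
  then show ?case by simp
qed simp

lemma quad_growth_mult_bounded:
  assumes "quad_growth f" "g \<in> borel_measurable borel" "\<And>u. \<bar>g u\<bar> \<le> 1"
  shows "quad_growth (\<lambda>u. f u * g u)"
proof (rule quad_growth_dominated[OF assms(1)])
  show "(\<lambda>u. f u * g u) \<in> borel_measurable borel"
    using quad_growth_measurable[OF assms(1)] assms(2) by measurable
  show "\<bar>f u * g u\<bar> \<le> \<bar>f u\<bar>" for u
    using assms(3)[of u] by (simp add: abs_mult mult_left_le)
qed

text \<open>Survival and the final position are increasing functions of the steps, hence positively
  correlated (Harris).\<close>

lemma iter_survival_association:
  assumes f: "quad_growth f" "mono f" "\<And>u. 0 \<le> f u"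
  shows "(P ^^ k) f u * (Q ^^ k) (\<lambda>_. 1) u \<le> (Q ^^ k) f u"
proof (induction k arbitrary: u)
  case (Suc k)
  define a p where "a = (P ^^ k) f" and "p = (Q ^^ k) (\<lambda>_. 1)"
  have qa: "quad_growth a" and qp: "quad_growth p" using f by (auto simp: a_def p_def)
  have p01: "0 \<le> p v" "p v \<le> 1" for v
    using iter_mono_fun(2)[of "\<lambda>_. 1" k v] iter_one_le[of k v] by (auto simp: p_def mono_def)
  have mp: "mono p" using iter_mono_fun(1)[of "\<lambda>_. 1" k] by (auto simp: p_def mono_def)
  have ma: "mono a" unfolding a_def by (rule free_iter_mono_fun[OF f(1,2)])
  have qap: "quad_growth (\<lambda>v. a v * p v)"
    using p01 by (intro quad_growth_mult_bounded qa quad_growth_measurable[OF qp]) (auto simp: abs_le_iff intro: order_trans)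
  have *: "indicator {0..} (u + x) * p (u + x) \<le> indicator {0..} (u + y) * p (u + y)" if "x \<le> y" for x y :: real
    using that p01 monoD[OF mp, of "u + x" "u + y"] by (auto simp: indicator_def)
  have eq: "a (u + x) * (indicator {0..} (u + x) * p (u + x)) = indicator {0..} (u + x) * (a (u + x) * p (u + x))" for x
    by simp
  \<comment> \<open>Only one step is random here, and both factors increase with it, so the
    one-dimensional inequality applies. The induction hypothesis then bounds the product
    pointwise.\<close>
  have "P a u * Q p u \<le> Q (\<lambda>v. a v * p v) u"
  proof -
    have "(\<integral>x. a (u + x) \<partial>M) * (\<integral>x. indicator {0..} (u + x) * p (u + x) \<partial>M)
       \<le> (\<integral>x. a (u + x) * (indicator {0..} (u + x) * p (u + x)) \<partial>M)"
    proof (rule integral_mono_mult_ge[of "\<lambda>x. a (u + x)" "\<lambda>x. indicator {0..} (u + x) * p (u + x)" "\<lambda>x. x"])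
      show "mono (\<lambda>x. a (u + x))" using ma by (auto simp: mono_def)
      show "mono (\<lambda>x. indicator {0..} (u + x) * p (u + x))" by (rule monoI) (rule *)
      show "integrable M (\<lambda>x. a (u + x))" by (rule integrable_quad_growth_shift[OF qa])
      show "integrable M (\<lambda>x. indicator {0..} (u + x) * p (u + x))"
        by (rule integrable_killed[OF qp]) simp
      show "integrable M (\<lambda>x. a (u + x) * (indicator {0..} (u + x) * p (u + x)))"
        unfolding eq by (rule integrable_killed[OF qap]) simp
    qed
    then show ?thesis unfolding eq by (simp add: killed_step_def)
  qed
  also have "Q (\<lambda>v. a v * p v) u \<le> Q ((Q ^^ k) f) u"
    using Suc f(1) qap by (intro killed_step_mono) (auto simp: a_def p_def)
  finally show ?case by (simp add: a_def p_def)
qed simp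

text \<open>Exponentials are eigenfunctions of the free step with eigenvalue
  \<open>char M t\<close>. The real part keeps the functions real-valued, and the arbitrary factor
  \<open>z\<close> absorbs the eigenvalue in the induction.\<close>

lemma free_iter_iexp:
  "(P ^^ k) (\<lambda>u. Re (z * iexp (t * u))) u = Re (z * char M t ^ k * iexp (t * u))"
proof (induction k arbitrary: z u)
  case (Suc k)
  have step: "P (\<lambda>u. Re (z * iexp (t * u))) = (\<lambda>u. Re (z * char M t * iexp (t * u)))"
  proof
    fix u
    have int: "integrable M (\<lambda>x. iexp (t * x))" by (rule integrable_iexp) auto
    have "P (\<lambda>u. Re (z * iexp (t * u))) u = (\<integral>x. Re (z * iexp (t * u) * iexp (t * x)) \<partial>M)"
      unfolding killed_step_def by (intro Bochner_Integration.integral_cong) (auto simp: exp_add distrib_left mult.assoc)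
    also have "\<dots> = Re (\<integral>x. z * iexp (t * u) * iexp (t * x) \<partial>M)"
      using int by (intro integral_Re) auto
    also have "\<dots> = Re (z * iexp (t * u) * char M t)"
      using int by (simp add: char_def)
    finally show "P (\<lambda>u. Re (z * iexp (t * u))) u = Re (z * char M t * iexp (t * u))"
      by (simp add: mult_ac)
  qed
  show ?case unfolding iter_Suc_apply step Suc by (simp add: mult_ac)
qed simp

lemma free_iter_ident: "(P ^^ k) (\<lambda>u. u) u = u"
proof (induction k)
  case (Suc k)
  have "P (\<lambda>u. u) = (\<lambda>u. u)"
    using integrable_quad_growth[OF quad_growth_ident] by (auto simp: killed_step_def mean_zero)
  then show ?case using Suc by (simp add: iter_Suc_apply del: funpow.simps)
qed simp

lemma free_iter_const: "(P ^^ k) (\<lambda>_. c) u = c"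
proof (induction k)
  case (Suc k)
  have "P (\<lambda>_. c) = (\<lambda>_. c)" by (auto simp: killed_step_def)
  then show ?case using Suc by (simp add: iter_Suc_apply del: funpow.simps)
qed simp

text \<open>The positive part is \<open>(\<bar>u\<bar> + u) / 2\<close>. The linear half has mean
  zero under the free walk from 0, and \<open>1 - cos (t * u)\<close> is at most
  \<open>t * \<bar>u\<bar>\<close>, which turns the other half into a characteristic
  function.\<close>

lemma free_iter_pos_part_ge:
  assumes "0 < t"
  shows "(1 - Re (char M t ^ k)) / (2 * t) \<le> (P ^^ k) (max 0) 0"
proof -
  have cos_le: "1 - cos y \<le> \<bar>y\<bar>" for y :: real
  proof -
    have "1 - cos y = 2 * (sin (y / 2))\<^sup>2" using cos_double_sin[of "y / 2"] by simp
    also have "\<dots> \<le> 2 * \<bar>sin (y / 2)\<bar>"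
      using abs_sin_le_one[of "y / 2"] power_decreasing[of 1 2 "\<bar>sin (y / 2)\<bar>"] by simp
    also have "\<dots> \<le> \<bar>y\<bar>" using abs_sin_x_le_abs_x[of "y / 2"] by simp
    finally show ?thesis .
  qed
  have cos_qg: "quad_growth (\<lambda>u. Re (1 * iexp (t * u)))"
    by (rule quad_growth_bounded[of _ 1]) (auto simp: Re_exp)
  define g where "g u = (1 / (2 * t)) * 1 + (- 1 / (2 * t)) * Re (1 * iexp (t * u))" for u
  have g_qg: "quad_growth g"
    unfolding g_def by (rule quad_growth_add[OF quad_growth_cmult[OF quad_growth_const] quad_growth_cmult[OF cos_qg]])
  have "(P ^^ k) g = (\<lambda>u. (1 / (2 * t)) * (P ^^ k) (\<lambda>_. 1) u + (- 1 / (2 * t)) * (P ^^ k) (\<lambda>u. Re (1 * iexp (t * u))) u)"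
    unfolding g_def by (rule iter_lincomb[OF quad_growth_const cos_qg]) simp
  then have "(P ^^ k) g 0 = (1 - Re (char M t ^ k)) / (2 * t)"
    by (simp only: free_iter_iexp free_iter_const) (simp add: diff_divide_distrib)
  moreover have "(P ^^ k) (\<lambda>u. 1 * g u + 1 / 2 * u) = (\<lambda>u. 1 * (P ^^ k) g u + 1 / 2 * (P ^^ k) (\<lambda>u. u) u)"
    by (rule iter_lincomb[OF g_qg quad_growth_ident]) simp
  ultimately have "(1 - Re (char M t ^ k)) / (2 * t) = (P ^^ k) (\<lambda>u. 1 * g u + 1 / 2 * u) 0"
    by (simp only: free_iter_ident)
  also have "\<dots> \<le> (P ^^ k) (max 0) 0"
  proof (rule iter_mono)
    show "quad_growth (\<lambda>u. 1 * g u + 1 / 2 * u)"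
      by (rule quad_growth_add[OF quad_growth_cmult[OF g_qg] quad_growth_cmult[OF quad_growth_ident]])
    show "quad_growth (max 0)" by (rule quad_growth_pos_part)
    fix u
    have "(1 - cos (t * u)) / (2 * t) \<le> \<bar>t * u\<bar> / (2 * t)"
      using assms by (intro divide_right_mono cos_le) auto
    also have "\<dots> = \<bar>u\<bar> / 2" using assms by (simp add: abs_mult)
    finally have "(1 - cos (t * u)) / (2 * t) + u / 2 \<le> max 0 u" by linarith
    then show "1 * g u + 1 / 2 * u \<le> max 0 u"
      by (simp add: g_def Re_exp diff_divide_distrib)
  qed auto
  finally show ?thesis .
qed

end

section \<open>The characteristic function near zero, and the survival bound\<close>

context moment_law
begin

text \<open>With only \<open>2 + \<delta>\<close> moments the cubic remainder is not integrable, but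
  the minimum of the quadratic and the cubic bound is at most the interpolated power; the crossover
  is at \<open>\<bar>t * x\<bar> = 1\<close>.\<close>

lemma char_second_order:
  "cmod (char M t - of_real (1 - \<sigma>\<^sup>2 * t\<^sup>2 / 2)) \<le> \<bar>t\<bar> powr (2 + \<delta>) * abs_moment"
proof (cases "t = 0")
  case True
  then show ?thesis by (simp add: char_zero)
next
  case False
  have ptw: "min (6 * x\<^sup>2) (\<bar>t\<bar> * \<bar>x\<bar> ^ 3) \<le> 6 * \<bar>t\<bar> powr \<delta> * \<bar>x\<bar> powr (2 + \<delta>)" for x
  proof (cases "x = 0")
    case x: False
    have eq: "6 * \<bar>t\<bar> powr \<delta> * \<bar>x\<bar> powr (2 + \<delta>) = 6 * x\<^sup>2 * \<bar>t * x\<bar> powr \<delta>"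
      using x by (simp add: powr_add powr_mult abs_mult)
    show ?thesis
    proof (cases "\<bar>t * x\<bar> \<le> 1")
      case True
      have "\<bar>t\<bar> * \<bar>x\<bar> ^ 3 = x\<^sup>2 * \<bar>t * x\<bar> powr 1"
        using x False by (simp add: abs_mult power3_eq_cube power2_eq_square)
      also have "\<dots> \<le> x\<^sup>2 * \<bar>t * x\<bar> powr \<delta>"
        using True \<delta>_le \<delta>_pos by (intro mult_left_mono powr_mono') auto
      also have "\<dots> \<le> 6 * x\<^sup>2 * \<bar>t * x\<bar> powr \<delta>" by simp
      finally show ?thesis unfolding eq by simp
    next
      case False
      then have "1 \<le> \<bar>t * x\<bar> powr \<delta>" using \<delta>_pos by (intro ge_one_powr_ge_zero) auto
      then have "6 * x\<^sup>2 * 1 \<le> 6 * x\<^sup>2 * \<bar>t * x\<bar> powr \<delta>" by (intro mult_left_mono) auto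
      then show ?thesis unfolding eq by simp
    qed
  qed simp
  have "cmod (char M t - (1 - t\<^sup>2 * \<sigma>\<^sup>2 / 2)) \<le>
      (t\<^sup>2 / 6) * expectation (\<lambda>x. min (6 * x\<^sup>2) (\<bar>t\<bar> * \<bar>x\<bar> ^ 3))"
    using integrable_quad_growth[OF quad_growth_ident]
    by (intro char_approx3) (auto simp: mean_zero second_moment square_integrable)
  also have "\<dots> \<le> (t\<^sup>2 / 6) * expectation (\<lambda>x. 6 * \<bar>t\<bar> powr \<delta> * \<bar>x\<bar> powr (2 + \<delta>))"
  proof (intro mult_left_mono integral_mono ptw)
    show "integrable M (\<lambda>x. min (6 * x\<^sup>2) (\<bar>t\<bar> * \<bar>x\<bar> ^ 3))"
      by (rule Bochner_Integration.integrable_bound[of M "\<lambda>x. 6 * \<bar>t\<bar> powr \<delta> * \<bar>x\<bar> powr (2 + \<delta>)"])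
         (use moment ptw in auto)
    show "integrable M (\<lambda>x. 6 * \<bar>t\<bar> powr \<delta> * \<bar>x\<bar> powr (2 + \<delta>))" using moment by auto
  qed simp
  also have "\<dots> = \<bar>t\<bar> powr (2 + \<delta>) * abs_moment"
    using False by (simp add: abs_moment_def powr_add)
  finally show ?thesis by (simp add: mult.commute)
qed

lemma char_gaussian_decay:
  "\<exists>c>0. c \<le> 1 \<and> (\<forall>t. \<bar>t\<bar> \<le> c \<longrightarrow> cmod (char M t) \<le> exp (- (\<sigma>\<^sup>2 * t\<^sup>2 / 4)))"
proof -
  \<comment> \<open>Below \<open>c1\<close> the remainder is at most half of the quadratic term,
    which leaves a quarter of \<open>\<sigma>\<^sup>2 * t\<^sup>2\<close>. The bound
    \<open>1 / \<sigma>\<close> keeps \<open>1 - \<sigma>\<^sup>2 * t\<^sup>2 / 2\<close>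
    nonnegative.\<close>
  define c1 where "c1 = (\<sigma>\<^sup>2 / (4 * (abs_moment + 1))) powr (1 / \<delta>)"
  define c where "c = min 1 (min (1 / \<sigma>) c1)"
  have m: "0 < \<sigma>\<^sup>2 / (4 * (abs_moment + 1))" using sd_pos abs_moment_nonneg by simp
  have "0 < c1" unfolding c1_def powr_gt_zero using m by linarith
  then have "0 < c" using sd_pos by (simp add: c_def)
  have "cmod (char M t) \<le> exp (- (\<sigma>\<^sup>2 * t\<^sup>2 / 4))" if t: "\<bar>t\<bar> \<le> c" for t
  proof -
    have "\<bar>t\<bar> powr \<delta> \<le> c1 powr \<delta>" using t \<delta>_pos by (intro powr_mono2) (auto simp: c_def)
    also have "\<dots> = \<sigma>\<^sup>2 / (4 * (abs_moment + 1))" using m \<delta>_pos abs_moment_nonneg by (simp add: c1_def powr_powr)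
    finally have "\<bar>t\<bar> powr \<delta> * (abs_moment + 1) \<le> \<sigma>\<^sup>2 / 4"
      using abs_moment_nonneg by (simp add: field_simps)
    then have "\<bar>t\<bar> powr \<delta> * abs_moment + \<bar>t\<bar> powr \<delta> \<le> \<sigma>\<^sup>2 / 4"
      by (simp only: distrib_left mult_1_right)
    moreover have "0 \<le> \<bar>t\<bar> powr \<delta>" by simp
    ultimately have small: "\<bar>t\<bar> powr \<delta> * abs_moment \<le> \<sigma>\<^sup>2 / 4" by linarith
    have "\<bar>t\<bar> powr (2 + \<delta>) * abs_moment = t\<^sup>2 * (\<bar>t\<bar> powr \<delta> * abs_moment)"
      by (cases "t = 0") (simp_all add: powr_add)
    also have "\<dots> \<le> t\<^sup>2 * (\<sigma>\<^sup>2 / 4)" using small by (intro mult_left_mono) auto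
    finally have 1: "\<bar>t\<bar> powr (2 + \<delta>) * abs_moment \<le> \<sigma>\<^sup>2 * t\<^sup>2 / 4" by (simp add: mult.commute)
    have "\<sigma> * \<bar>t\<bar> \<le> 1" using t sd_pos by (simp add: c_def field_simps)
    then have "(\<sigma> * \<bar>t\<bar>)\<^sup>2 \<le> 1" using sd_pos by (simp add: power_le_one)
    then have "\<sigma>\<^sup>2 * t\<^sup>2 \<le> 1" by (simp add: power_mult_distrib)
    then have "cmod (of_real (1 - \<sigma>\<^sup>2 * t\<^sup>2 / 2)) = 1 - \<sigma>\<^sup>2 * t\<^sup>2 / 2"
      unfolding norm_of_real by linarith
    moreover have "cmod (char M t) \<le> cmod (char M t - of_real (1 - \<sigma>\<^sup>2 * t\<^sup>2 / 2)) + cmod (of_real (1 - \<sigma>\<^sup>2 * t\<^sup>2 / 2))"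
      by (metis diff_add_cancel norm_triangle_ineq)
    ultimately have "cmod (char M t) \<le> 1 + (- (\<sigma>\<^sup>2 * t\<^sup>2 / 4))"
      using char_second_order[of t] 1 by linarith
    also have "\<dots> \<le> exp (- (\<sigma>\<^sup>2 * t\<^sup>2 / 4))" by (rule exp_ge_add_one_self)
    finally show ?thesis .
  qed
  with \<open>0 < c\<close> show ?thesis by (intro exI[of _ c]) (auto simp: c_def)
qed

text \<open>At frequency \<open>c / sqrt k\<close> the \<open>k\<close>-th power of the
  characteristic function stays below one by an amount independent of \<open>k\<close>, and dividing
  by that frequency produces \<open>sqrt k\<close>.\<close>

lemma free_pos_part_growth: "\<exists>c>0. \<forall>k\<ge>1. c * sqrt (real k) \<le> (P ^^ k) (max 0) 0"
proof -
  obtain c where c: "0 < c" and dec: "\<forall>t. \<bar>t\<bar> \<le> c \<longrightarrow> cmod (char M t) \<le> exp (- (\<sigma>\<^sup>2 * t\<^sup>2 / 4))"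
    using char_gaussian_decay by blast
  define q where "q = (1 - exp (- (\<sigma>\<^sup>2 * c\<^sup>2 / 4))) / (2 * c)"
  have "0 < q" using c sd_pos by (simp add: q_def)
  moreover have "q * sqrt (real k) \<le> (P ^^ k) (max 0) 0" if k: "1 \<le> k" for k
  proof -
    define t where "t = c / sqrt (real k)"
    have t: "0 < t" "t \<le> c" "real k * t\<^sup>2 = c\<^sup>2"
      using c k by (auto simp: t_def divide_le_eq power_divide)
    have "Re (char M t ^ k) \<le> cmod (char M t) ^ k"
      using complex_Re_le_cmod[of "char M t ^ k"] by (simp add: norm_power)
    also have "\<dots> \<le> exp (- (\<sigma>\<^sup>2 * t\<^sup>2 / 4)) ^ k" using dec t by (intro power_mono) auto
    also have "\<dots> = exp (- (\<sigma>\<^sup>2 * (real k * t\<^sup>2) / 4))" by (simp add: mult_ac flip: exp_of_nat_mult)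
    finally have "Re (char M t ^ k) \<le> exp (- (\<sigma>\<^sup>2 * c\<^sup>2 / 4))" unfolding t(3) .
    then have "(1 - exp (- (\<sigma>\<^sup>2 * c\<^sup>2 / 4))) / (2 * t) \<le> (1 - Re (char M t ^ k)) / (2 * t)"
      using t by (intro divide_right_mono) auto
    also have "\<dots> \<le> (P ^^ k) (max 0) 0" by (rule free_iter_pos_part_ge[OF t(1)])
    also have "(1 - exp (- (\<sigma>\<^sup>2 * c\<^sup>2 / 4))) / (2 * t) = q * sqrt (real k)"
      using c k by (simp add: q_def t_def field_simps)
    finally show ?thesis .
  qed
  ultimately show ?thesis by blast
qed

text \<open>The identity is preserved in mean by a centred step, and killing removes precisely its
  negative part. The undershoot is therefore the exact defect of the positive part.\<close>

lemma killed_pos_part: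
  assumes "0 \<le> u"
  shows "Q (max 0) u = u + undershoot u"
proof -
  have "Q (max 0) u = (\<integral>x. (u + x) + max 0 (- (u + x)) \<partial>M)"
    unfolding killed_step_def by (intro Bochner_Integration.integral_cong) (auto simp: indicator_def max_def)
  also have "\<dots> = u + undershoot u"
    using integrable_undershoot[of u] integrable_quad_growth[OF quad_growth_ident]
    by (simp add: undershoot_def mean_zero)
  finally show ?thesis .
qed

lemma killed_pos_part_iter_le: "\<exists>C>0. \<forall>k. \<forall>y\<ge>0. (Q ^^ k) (max 0) y \<le> C * (1 + y)"
proof -
  obtain C where C: "0 < C" and le: "\<forall>m. \<forall>y\<ge>0. (\<Sum>k<m. (Q ^^ k) undershoot y) \<le> C * (1 + y) powr (1 - \<delta>)"
    using total_undershoot_le by blast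
  have "(Q ^^ k) (max 0) y \<le> (1 + C) * (1 + y)" if y: "0 \<le> y" for k y
  proof -
    have "(Q ^^ k) (max 0) y = max 0 y + (\<Sum>j<k. (Q ^^ j) (\<lambda>u. Q (max 0) u - max 0 u) y)"
      by (rule iter_telescope[of "\<lambda>_. max 0"]) auto
    also have "\<dots> \<le> y + (\<Sum>j<k. (Q ^^ j) undershoot y)"
      using y by (intro add_mono sum_mono iter_mono quad_growth_undershoot quad_growth_diff
          quad_growth_killed_step quad_growth_pos_part) (auto simp: killed_pos_part)
    also have "\<dots> \<le> y + C * (1 + y) powr (1 - \<delta>)" using le y by auto
    also have "\<dots> \<le> (1 + y) + C * (1 + y) powr 1"
      using y C \<delta>_pos by (intro add_mono mult_left_mono powr_mono) auto
    finally show ?thesis using y by (simp add: algebra_simps)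
  qed
  then show ?thesis using C by (intro exI[of _ "1 + C"]) auto
qed

lemma survival_le:
  "\<exists>C>0. \<forall>k. \<forall>y\<ge>0. (Q ^^ k) (\<lambda>_. 1) y \<le> C * (1 + y) / sqrt (real (k + 1))"
proof -
  obtain C where C: "0 < C" and le: "\<forall>k. \<forall>y\<ge>0. (Q ^^ k) (max 0) y \<le> C * (1 + y)"
    using killed_pos_part_iter_le by blast
  obtain c where c: "0 < c" and ge: "\<forall>k\<ge>1. c * sqrt (real k) \<le> (P ^^ k) (max 0) 0"
    using free_pos_part_growth by blast
  \<comment> \<open>The 1 serves \<open>k = 0\<close>; the factor 2 pays for passing from
    \<open>sqrt k\<close> to \<open>sqrt (k + 1)\<close>.\<close>
  define D where "D = max 1 (2 * C / c)"
  have "(Q ^^ k) (\<lambda>_. 1) y \<le> D * (1 + y) / sqrt (real (k + 1))" if y: "0 \<le> y" for k y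
  proof (cases "k = 0")
    case True
    have "1 * 1 \<le> D * (1 + y)" using y by (intro mult_mono) (auto simp: D_def)
    then show ?thesis using True by simp
  next
    case False
    define p where "p = (Q ^^ k) (\<lambda>_. 1) y"
    have p: "0 \<le> p" using iter_mono_fun(2)[of "\<lambda>_. 1" k y] by (auto simp: p_def mono_def)
    have "mono (max (0 :: real))" by (auto simp: mono_def)
    have "c * sqrt (real k) * p \<le> (P ^^ k) (max 0) 0 * p"
      using ge False p by (intro mult_right_mono) auto
    also have "\<dots> \<le> (P ^^ k) (max 0) y * p"
      using y p monoD[OF free_iter_mono_fun[OF quad_growth_pos_part \<open>mono (max 0)\<close>] y]
      by (intro mult_right_mono) auto
    also have "\<dots> \<le> (Q ^^ k) (max 0) y"
      unfolding p_def using \<open>mono (max 0)\<close> by (intro iter_survival_association) auto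
    also have "\<dots> \<le> C * (1 + y)" using le y by blast
    finally have 1: "c * sqrt (real k) * p \<le> C * (1 + y)" .
    have "sqrt (real (k + 1)) \<le> sqrt (2\<^sup>2 * real k)" using False by (intro real_sqrt_le_mono) simp
    then have "sqrt (real (k + 1)) \<le> 2 * sqrt (real k)" by (simp add: real_sqrt_mult)
    then have "sqrt (real (k + 1)) * (c * p) \<le> 2 * sqrt (real k) * (c * p)"
      using c p by (intro mult_right_mono) auto
    also have "\<dots> = 2 * (c * sqrt (real k) * p)" by simp
    also have "\<dots> \<le> 2 * (C * (1 + y))" using 1 by (rule mult_left_mono) simp
    finally have "p * sqrt (real (k + 1)) \<le> (2 * C / c) * (1 + y)"
      using c by (simp add: field_simps)
    also have "\<dots> \<le> D * (1 + y)" using y by (intro mult_right_mono) (auto simp: D_def)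
    finally show ?thesis by (simp add: p_def pos_le_divide_eq)
  qed
  then show ?thesis by (intro exI[of _ D]) (auto simp: D_def)
qed

end

subsection \<open>The Gaussian kernel with absorption at zero\<close>

lemma exp_quartic_lower: "1 + x\<^sup>2 / 2 + x ^ 4 / 8 \<le> exp (x\<^sup>2 / 2)" for x :: real
  using exp_lower_Taylor_quadratic[of "x\<^sup>2 / 2"] by (simp add: power_divide flip: power_mult)

text \<open>The quartic lower bound for the exponential reduces each estimate to a polynomial
  inequality, which follows from the squares \<open>(w - 1)\<^sup>2\<close> and
  \<open>(w\<^sup>2 / 2 - 1)\<^sup>2\<close> and from
  \<open>w\<^sup>2 * (w - 1)\<^sup>2\<close>.\<close>

lemma power_mult_gaussian_le:
  fixes z :: real
  shows "\<bar>z\<bar> * exp (- z\<^sup>2 / 2) \<le> 1" "z\<^sup>2 * exp (- z\<^sup>2 / 2) \<le> 1" "\<bar>z\<bar> ^ 3 * exp (- z\<^sup>2 / 2) \<le> 4"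
proof -
  define w where "w = \<bar>z\<bar>"
  have conv: "a * exp (- w\<^sup>2 / 2) \<le> b" if "a \<le> b * (1 + w\<^sup>2 / 2 + w ^ 4 / 8)" "0 \<le> b" for a b
  proof -
    have "a \<le> b * exp (w\<^sup>2 / 2)" using that mult_left_mono[OF exp_quartic_lower[of w] that(2)] by linarith
    then show ?thesis by (simp add: exp_minus field_simps)
  qed
  have e: "(w - 1)\<^sup>2 = w\<^sup>2 - 2 * w + 1" "(w\<^sup>2 / 2 - 1)\<^sup>2 = w ^ 4 / 4 - w\<^sup>2 + 1"
    "w\<^sup>2 * (w - 1)\<^sup>2 = w ^ 4 - 2 * w ^ 3 + w\<^sup>2"
    by (simp_all add: power2_eq_square power3_eq_cube power4_eq_xxxx algebra_simps)
  have s: "0 \<le> w\<^sup>2 - 2 * w + 1" unfolding e(1)[symmetric] by simp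
  have s2: "0 \<le> w ^ 4 / 4 - w\<^sup>2 + 1" unfolding e(2)[symmetric] by simp
  have s3: "0 \<le> w ^ 4 - 2 * w ^ 3 + w\<^sup>2" unfolding e(3)[symmetric] by simp
  have s4: "0 \<le> w ^ 4" "0 \<le> w\<^sup>2" by simp_all
  \<comment> \<open>Abstracting the powers of \<open>w\<close> leaves a purely linear
    inequality.\<close>
  have "\<And>p q :: real. 0 \<le> p - 2 * w + 1 \<Longrightarrow> 0 \<le> q \<Longrightarrow> w \<le> 1 * (1 + p / 2 + q / 8)"
    unfolding mult_1 by linarith
  from this[OF s s4(1)] have "w \<le> 1 * (1 + w\<^sup>2 / 2 + w ^ 4 / 8)" .
  then have "w * exp (- w\<^sup>2 / 2) \<le> 1" by (rule conv) simp
  then show "\<bar>z\<bar> * exp (- z\<^sup>2 / 2) \<le> 1" by (simp add: w_def)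
  have "w\<^sup>2 \<le> 1 * (1 + w\<^sup>2 / 2 + w ^ 4 / 8)" using s2 s4 by (simp add: algebra_simps)
  then have "w\<^sup>2 * exp (- w\<^sup>2 / 2) \<le> 1" by (rule conv) simp
  then show "z\<^sup>2 * exp (- z\<^sup>2 / 2) \<le> 1" by (simp add: w_def)
  have "w ^ 3 \<le> 4 + 2 * w\<^sup>2 + w ^ 4 / 2" using s3 s4 by linarith
  then have "w ^ 3 \<le> 4 * (1 + w\<^sup>2 / 2 + w ^ 4 / 8)" by (simp add: algebra_simps)
  then have "w ^ 3 * exp (- w\<^sup>2 / 2) \<le> 4" by (rule conv) simp
  then show "\<bar>z\<bar> ^ 3 * exp (- z\<^sup>2 / 2) \<le> 4" by (simp add: w_def)
qed

text \<open>\<open>gauss k s\<close> is the \<open>k\<close>-th derivative of the centred normal density for \<open>k \<le> 3\<close>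
  (larger \<open>k\<close> give the third derivative).\<close>

definition gauss :: "nat \<Rightarrow> real \<Rightarrow> real \<Rightarrow> real" where
  "gauss k s u = (if k = 0 then 1 else if k = 1 then - (u / s\<^sup>2)
     else if k = 2 then u\<^sup>2 / s ^ 4 - 1 / s\<^sup>2 else 3 * u / s ^ 4 - u ^ 3 / s ^ 6) * normal_density 0 s u"

lemma gauss_0 [simp]: "gauss 0 s u = normal_density 0 s u"
  by (simp add: gauss_def)

lemma gauss_deriv:
  assumes "0 < s" "k < 3"
  shows "(gauss k s has_real_derivative gauss (Suc k) s u) (at u)"
proof -
  have N: "(normal_density 0 s has_real_derivative - (u / s\<^sup>2) * normal_density 0 s u) (at u)"
    unfolding normal_density_def[abs_def] using assms(1)
    by (auto intro!: derivative_eq_intros simp: power2_eq_square field_simps)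
  have "k = 0 \<or> k = 1 \<or> k = 2" using assms(2) by linarith
  then show ?thesis
  proof (elim disjE)
    assume k: "k = 0"
    show ?thesis using N unfolding k gauss_def by simp
  next
    assume k: "k = 1"
    have "((\<lambda>u. - (u / s\<^sup>2) * normal_density 0 s u) has_real_derivative
        - (1 / s\<^sup>2) * normal_density 0 s u + (- (u / s\<^sup>2) * normal_density 0 s u) * - (u / s\<^sup>2)) (at u)"
      by (rule DERIV_mult[OF DERIV_minus[OF DERIV_cdivide[OF DERIV_ident]] N])
    moreover have "- (1 / s\<^sup>2) * normal_density 0 s u + (- (u / s\<^sup>2) * normal_density 0 s u) * - (u / s\<^sup>2)
        = (u\<^sup>2 / s ^ 4 - 1 / s\<^sup>2) * normal_density 0 s u"
      using assms(1) by (simp add: divide_simps) (simp add: algebra_simps eval_nat_numeral)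
    ultimately show ?thesis unfolding k gauss_def by simp
  next
    assume k: "k = 2"
    have "((\<lambda>u. (u\<^sup>2 / s ^ 4 - 1 / s\<^sup>2) * normal_density 0 s u) has_real_derivative
        (2 * u / s ^ 4) * normal_density 0 s u + (- (u / s\<^sup>2) * normal_density 0 s u) * (u\<^sup>2 / s ^ 4 - 1 / s\<^sup>2)) (at u)"
    proof (rule DERIV_mult[OF _ N])
      have "((\<lambda>u. u\<^sup>2 / s ^ 4 - 1 / s\<^sup>2) has_real_derivative (2 * u) / s ^ 4 - 0) (at u)"
        by (intro DERIV_diff DERIV_cdivide DERIV_const) (auto intro!: derivative_eq_intros)
      then show "((\<lambda>u. u\<^sup>2 / s ^ 4 - 1 / s\<^sup>2) has_real_derivative 2 * u / s ^ 4) (at u)" by simp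
    qed
    moreover have "(2 * u / s ^ 4) * normal_density 0 s u + (- (u / s\<^sup>2) * normal_density 0 s u) * (u\<^sup>2 / s ^ 4 - 1 / s\<^sup>2)
        = (3 * u / s ^ 4 - u ^ 3 / s ^ 6) * normal_density 0 s u"
      using assms(1) by (simp add: divide_simps) (simp add: algebra_simps eval_nat_numeral)
    ultimately show ?thesis unfolding k gauss_def by simp
  qed
qed

lemma normal_density_le: "0 \<le> s \<Longrightarrow> normal_density 0 s u \<le> exp (- (u / s)\<^sup>2 / 2) / s"
proof -
  assume s: "0 \<le> s"
  have "1 \<le> sqrt (2 * pi)" using pi_gt3 by simp
  then have "s \<le> sqrt (2 * pi) * s" using s mult_right_mono[of 1 "sqrt (2 * pi)" s] by simp
  then have "1 / (sqrt (2 * pi) * s) \<le> 1 / s" using s by (cases "s = 0") (auto intro!: divide_left_mono)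
  moreover have "sqrt (2 * pi * s\<^sup>2) = sqrt (2 * pi) * s" using s by (simp add: real_sqrt_mult)
  ultimately have "normal_density 0 s u \<le> 1 / s * exp (- (u - 0)\<^sup>2 / (2 * s\<^sup>2))"
    unfolding normal_density_def by (intro mult_right_mono) simp_all
  then show ?thesis by (simp add: power_divide mult.commute)
qed

text \<open>Writing \<open>u = z * s\<close> pulls out the power of \<open>s\<close>. The numerators
  come from the bounds on powers of \<open>z\<close> times the Gaussian factor: 2 is 1 + 1, and 7 is
  3 * 1 + 4.\<close>

lemma gauss_bounds:
  assumes s: "0 < s"
  shows "\<bar>gauss 0 s u\<bar> \<le> 1 / s" "\<bar>gauss (Suc 0) s u\<bar> \<le> 1 / s\<^sup>2" "\<bar>gauss 2 s u\<bar> \<le> 2 / s ^ 3" "\<bar>gauss 3 s u\<bar> \<le> 7 / s ^ 4"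
proof -
  define z where "z = u / s"
  define E where "E = exp (- z\<^sup>2 / 2)"
  have u: "u = z * s" using s by (simp add: z_def)
  have N: "normal_density 0 s u \<le> E / s" "0 \<le> normal_density 0 s u"
    using normal_density_le[of s u] s by (simp_all add: E_def z_def)
  have E: "0 < E" "E \<le> 1" by (simp_all add: E_def)
  note p = power_mult_gaussian_le[of z, folded E_def]
  have bd: "\<bar>a * normal_density 0 s u\<bar> \<le> \<bar>a\<bar> * E / s" for a
    using N mult_left_mono[OF N(1), of "\<bar>a\<bar>"] by (simp add: abs_mult)
  have "\<bar>gauss 0 s u\<bar> \<le> E / s" using N by (simp add: gauss_def)
  also have "\<dots> \<le> 1 / s" using E s by (intro divide_right_mono) auto
  finally show "\<bar>gauss 0 s u\<bar> \<le> 1 / s" .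
  have "\<bar>gauss (Suc 0) s u\<bar> \<le> \<bar>- (u / s\<^sup>2)\<bar> * E / s" using bd[of "- (u / s\<^sup>2)"] by (simp add: gauss_def)
  also have "\<dots> = (\<bar>z\<bar> * E) / s\<^sup>2" using s by (simp add: u abs_mult power2_eq_square field_simps)
  also have "\<dots> \<le> 1 / s\<^sup>2" using p(1) by (intro divide_right_mono) auto
  finally show "\<bar>gauss (Suc 0) s u\<bar> \<le> 1 / s\<^sup>2" .
  have "\<bar>gauss 2 s u\<bar> \<le> \<bar>u\<^sup>2 / s ^ 4 - 1 / s\<^sup>2\<bar> * E / s"
    using bd[of "u\<^sup>2 / s ^ 4 - 1 / s\<^sup>2"] by (simp add: gauss_def)
  also have "u\<^sup>2 / s ^ 4 - 1 / s\<^sup>2 = (z\<^sup>2 - 1) / s\<^sup>2"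
    using s by (simp add: u divide_simps) (simp add: algebra_simps eval_nat_numeral)
  also have "\<bar>(z\<^sup>2 - 1) / s\<^sup>2\<bar> * E / s \<le> (z\<^sup>2 + 1) / s\<^sup>2 * E / s"
  proof -
    have "\<bar>z\<^sup>2 - 1\<bar> \<le> z\<^sup>2 + 1" using zero_le_power2[of z] by linarith
    then show ?thesis using s E
      by (intro divide_right_mono mult_right_mono) (auto simp: abs_divide intro!: divide_right_mono)
  qed
  also have "\<dots> = (z\<^sup>2 * E + E) / s ^ 3"
    using s by (simp add: power2_eq_square power3_eq_cube field_simps)
  also have "\<dots> \<le> 2 / s ^ 3" using p(2) E s by (intro divide_right_mono) auto
  finally show "\<bar>gauss 2 s u\<bar> \<le> 2 / s ^ 3" .
  have "\<bar>gauss 3 s u\<bar> \<le> \<bar>3 * u / s ^ 4 - u ^ 3 / s ^ 6\<bar> * E / s"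
    using bd[of "3 * u / s ^ 4 - u ^ 3 / s ^ 6"] by (simp add: gauss_def)
  also have "3 * u / s ^ 4 - u ^ 3 / s ^ 6 = (3 * z - z ^ 3) / s ^ 3"
    using s by (simp add: u divide_simps) (simp add: algebra_simps eval_nat_numeral)
  also have "\<bar>(3 * z - z ^ 3) / s ^ 3\<bar> * E / s \<le> (3 * \<bar>z\<bar> + \<bar>z\<bar> ^ 3) / s ^ 3 * E / s"
  proof -
    have "\<bar>3 * z - z ^ 3\<bar> \<le> 3 * \<bar>z\<bar> + \<bar>z\<bar> ^ 3"
      using abs_triangle_ineq4[of "3 * z" "z ^ 3"] by (simp add: abs_mult power_abs)
    then show ?thesis using s E
      by (intro divide_right_mono mult_right_mono) (auto simp: abs_divide intro!: divide_right_mono)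
  qed
  also have "\<dots> = (3 * (\<bar>z\<bar> * E) + \<bar>z\<bar> ^ 3 * E) / s ^ 4"
    using s by (simp add: divide_simps) (simp add: algebra_simps eval_nat_numeral)
  also have "\<dots> \<le> 7 / s ^ 4" using p(1,3) s by (intro divide_right_mono) auto
  finally show "\<bar>gauss 3 s u\<bar> \<le> 7 / s ^ 4" .
qed

text \<open>\<open>dipole 0 s x\<close> is the density at \<open>x\<close> at time \<open>s\<^sup>2\<close> of Brownian motion absorbed at zero, given
  by an image charge. It is odd in the starting point, so that the walk loses only a
  multiple of its undershoot when it is killed.\<close>

definition dipole :: "nat \<Rightarrow> real \<Rightarrow> real \<Rightarrow> real \<Rightarrow> real" where
  "dipole k s x u = gauss k s (u - x) - gauss k s (u + x)"

lemma dipole_deriv: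
  assumes "0 < s" "k < 3"
  shows "(dipole k s x has_real_derivative dipole (Suc k) s x u) (at u)"
proof -
  have "((\<lambda>u. gauss k s (u - x)) has_real_derivative gauss (Suc k) s (u - x) * 1) (at u)"
    by (rule DERIV_chain'[of "\<lambda>u. u - x", OF _ gauss_deriv[OF assms], simplified mult.commute[of _ 1]])
       (auto intro!: derivative_eq_intros)
  moreover have "((\<lambda>u. gauss k s (u + x)) has_real_derivative gauss (Suc k) s (u + x) * 1) (at u)"
    by (rule DERIV_chain'[of "\<lambda>u. u + x", OF _ gauss_deriv[OF assms], simplified mult.commute[of _ 1]])
       (auto intro!: derivative_eq_intros)
  ultimately show ?thesis unfolding dipole_def[abs_def] by (auto intro: DERIV_diff)
qed

lemma dipole_bounds:
  assumes s: "0 < s"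
  shows "\<bar>dipole 0 s x u\<bar> \<le> 2 / s" "\<bar>dipole (Suc 0) s x u\<bar> \<le> 2 / s\<^sup>2"
    "\<bar>dipole 2 s x u\<bar> \<le> 4 / s ^ 3" "\<bar>dipole 3 s x u\<bar> \<le> 14 / s ^ 4"
proof -
  have tri: "\<bar>dipole k s x u\<bar> \<le> \<bar>gauss k s (u - x)\<bar> + \<bar>gauss k s (u + x)\<bar>" for k
    unfolding dipole_def by (rule abs_triangle_ineq4)
  note b = gauss_bounds[OF s, of "u - x"] gauss_bounds[OF s, of "u + x"]
  show "\<bar>dipole 0 s x u\<bar> \<le> 2 / s" using order_trans[OF tri add_mono[OF b(1) b(5)]] by simp
  show "\<bar>dipole (Suc 0) s x u\<bar> \<le> 2 / s\<^sup>2" using order_trans[OF tri add_mono[OF b(2) b(6)]] by simp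
  show "\<bar>dipole 2 s x u\<bar> \<le> 4 / s ^ 3" using order_trans[OF tri add_mono[OF b(3) b(7)]] by simp
  show "\<bar>dipole 3 s x u\<bar> \<le> 14 / s ^ 4" using order_trans[OF tri add_mono[OF b(4) b(8)]] by simp
qed

lemma dipole_zero: "dipole 0 s x 0 = 0"
  by (simp add: dipole_def normal_density_def)

text \<open>Two bounds for one remainder: the first, through the second derivative, is the better
  one for large \<open>h\<close>, the second, through the third derivative, for small
  \<open>h\<close>.\<close>

lemma dipole_taylor:
  assumes s: "0 < s"
  shows "\<bar>dipole 0 s x (u + h) - dipole 0 s x u - dipole (Suc 0) s x u * h - dipole 2 s x u * h\<^sup>2 / 2\<bar> \<le> 4 / s ^ 3 * h\<^sup>2"
    "\<bar>dipole 0 s x (u + h) - dipole 0 s x u - dipole (Suc 0) s x u * h - dipole 2 s x u * h\<^sup>2 / 2\<bar> \<le> 14 / s ^ 4 * \<bar>h\<bar> ^ 3"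
proof -
  define d where "d = (\<lambda>m t. dipole m s x (t + u))"
  have D: "\<forall>m t. m < n \<and> \<bar>t\<bar> \<le> \<bar>h\<bar> \<longrightarrow> (d m has_real_derivative d (Suc m) t) (at t)" if "n \<le> 3" for n
  proof (intro allI impI)
    fix m t assume "m < n \<and> \<bar>t\<bar> \<le> \<bar>h\<bar>"
    then have "m < 3" using that by simp
    from dipole_deriv[OF s this, of x "t + u"]
    show "(d m has_real_derivative d (Suc m) t) (at t)"
      unfolding d_def by (rule DERIV_shift[THEN iffD1])
  qed
  have sets: "{..<2} = {0, 1 :: nat}" "{..<3} = {0, 1, 2 :: nat}" by auto
  obtain t where t: "d 0 h = (\<Sum>m<2. d m 0 / fact m * h ^ m) + d 2 t / fact 2 * h ^ 2"
    using Maclaurin_bi_le[OF refl D[of 2]] by auto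
  have "d 0 h - d 0 0 - d 1 0 * h - d 2 0 * h\<^sup>2 / 2 = (d 2 t - d 2 0) * h\<^sup>2 / 2"
    unfolding t sets by (simp add: field_simps)
  then have "\<bar>d 0 h - d 0 0 - d 1 0 * h - d 2 0 * h\<^sup>2 / 2\<bar> = \<bar>d 2 t - d 2 0\<bar> * h\<^sup>2 / 2"
    by (simp only: abs_mult abs_divide) simp
  also have "\<dots> \<le> (4 / s ^ 3 + 4 / s ^ 3) * h\<^sup>2 / 2"
    using dipole_bounds(3)[OF s, of x "t + u"] dipole_bounds(3)[OF s, of x "0 + u"]
    by (intro divide_right_mono mult_right_mono) (auto simp: d_def)
  finally show "\<bar>dipole 0 s x (u + h) - dipole 0 s x u - dipole (Suc 0) s x u * h - dipole 2 s x u * h\<^sup>2 / 2\<bar> \<le> 4 / s ^ 3 * h\<^sup>2"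
    by (simp add: d_def add.commute)
  obtain t where t: "d 0 h = (\<Sum>m<3. d m 0 / fact m * h ^ m) + d 3 t / fact 3 * h ^ 3"
    using Maclaurin_bi_le[OF refl D[of 3]] by auto
  have "d 0 h - d 0 0 - d 1 0 * h - d 2 0 * h\<^sup>2 / 2 = d 3 t / fact 3 * h ^ 3"
    unfolding t sets by (simp add: field_simps)
  then have "\<bar>d 0 h - d 0 0 - d 1 0 * h - d 2 0 * h\<^sup>2 / 2\<bar> = \<bar>d 3 t\<bar> / fact 3 * \<bar>h\<bar> ^ 3"
    by (simp only: abs_mult abs_divide power_abs) simp
  also have "\<dots> \<le> (14 / s ^ 4) / 1 * \<bar>h\<bar> ^ 3"
    using dipole_bounds(4)[OF s, of x "t + u"] fact_ge_1[of 3, where 'a=real]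
    by (intro mult_right_mono frac_le) (auto simp: d_def)
  finally show "\<bar>dipole 0 s x (u + h) - dipole 0 s x u - dipole (Suc 0) s x u * h - dipole 2 s x u * h\<^sup>2 / 2\<bar> \<le> 14 / s ^ 4 * \<bar>h\<bar> ^ 3"
    by (simp add: d_def add.commute)
qed

text \<open>Both bounds have the same order at \<open>\<bar>h\<bar> = s\<close>. On either side the
  factor \<open>(\<bar>h\<bar> / s) powr \<delta>\<close> can be inserted, which leaves a power of
  \<open>h\<close> that the step law integrates.\<close>

lemma dipole_taylor_interpolated:
  assumes s: "0 < s" and \<delta>: "0 < \<delta>" "\<delta> \<le> 1"
  shows "\<bar>dipole 0 s x (u + h) - dipole 0 s x u - dipole (Suc 0) s x u * h - dipole 2 s x u * h\<^sup>2 / 2\<bar>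
    \<le> 14 * s powr (- 3 - \<delta>) * \<bar>h\<bar> powr (2 + \<delta>)" (is "\<bar>?R\<bar> \<le> _")
proof (cases "h = 0")
  case h: False
  have eq: "14 * s powr (- 3 - \<delta>) * \<bar>h\<bar> powr (2 + \<delta>) = 14 / s ^ 3 * h\<^sup>2 * (\<bar>h\<bar> / s) powr \<delta>"
    using s h by (simp add: powr_add powr_diff powr_divide powr_minus powr_numeral field_simps)
  show ?thesis
  proof (cases "\<bar>h\<bar> \<le> s")
    case True
    have "\<bar>?R\<bar> \<le> 14 / s ^ 4 * \<bar>h\<bar> ^ 3" by (rule dipole_taylor(2)[OF s])
    also have "\<dots> = 14 / s ^ 3 * h\<^sup>2 * (\<bar>h\<bar> / s) powr 1"
      using s h by (simp add: power3_eq_cube power2_eq_square power4_eq_xxxx field_simps)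
    also have "\<dots> \<le> 14 / s ^ 3 * h\<^sup>2 * (\<bar>h\<bar> / s) powr \<delta>"
      using True \<delta> s by (intro mult_left_mono powr_mono') (auto simp: field_simps)
    finally show ?thesis unfolding eq .
  next
    case False
    have "\<bar>?R\<bar> \<le> 4 / s ^ 3 * h\<^sup>2" by (rule dipole_taylor(1)[OF s])
    also have "\<dots> \<le> 14 / s ^ 3 * h\<^sup>2 * 1" using s by (auto intro!: mult_right_mono divide_right_mono)
    also have "\<dots> \<le> 14 / s ^ 3 * h\<^sup>2 * (\<bar>h\<bar> / s) powr \<delta>"
      using False \<delta> s by (intro mult_left_mono ge_one_powr_ge_zero) auto
    finally show ?thesis unfolding eq .
  qed
qed simp

text \<open>This prices the killing: since the kernel vanishes at zero, its value at a point below
  zero is at most a multiple of the depth reached.\<close>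

lemma dipole_lipschitz:
  assumes s: "0 < s"
  shows "\<bar>dipole 0 s x u\<bar> \<le> 2 / s\<^sup>2 * \<bar>u\<bar>"
proof -
  have "norm (dipole 0 s x u - dipole 0 s x 0) \<le> 2 / s\<^sup>2 * norm (u - 0)"
    by (rule field_differentiable_bound[of UNIV "dipole 0 s x" "dipole (Suc 0) s x"])
       (use dipole_deriv[OF s, of 0 x] dipole_bounds(2)[OF s] in auto)
  then show ?thesis by (simp add: dipole_zero)
qed

text \<open>At the origin the image charge cancels the value and the second derivative, so the slope
  alone remains; it is the profile of the limit theorem.\<close>

lemma dipole_linear_approx:
  assumes s: "0 < s"
  shows "\<bar>dipole 0 s x u - 2 * x / s\<^sup>2 * normal_density 0 s x * u\<bar> \<le> 4 / s ^ 3 * u\<^sup>2"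
proof -
  have e: "normal_density 0 s (- v) = normal_density 0 s v" for v by (simp add: normal_density_def)
  have "dipole (Suc 0) s x 0 = 2 * x / s\<^sup>2 * normal_density 0 s x"
    using e[of x] by (simp add: dipole_def gauss_def)
  moreover have "dipole 2 s x 0 = 0"
    using e[of x] by (simp add: dipole_def gauss_def)
  ultimately show ?thesis
    using dipole_taylor(1)[OF s, of x 0 u] by (simp add: dipole_zero)
qed

lemma gauss_measurable [measurable]: "gauss k s \<in> borel_measurable borel"
  unfolding gauss_def[abs_def] by measurable

lemma quad_growth_dipole:
  assumes "0 \<le> s"
  shows "quad_growth (dipole 0 s x)"
proof (rule quad_growth_bounded[of _ "2 / s"])
  show "dipole 0 s x \<in> borel_measurable borel" unfolding dipole_def[abs_def] by measurable
  show "\<bar>dipole 0 s x u\<bar> \<le> 2 / s" for u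
    using dipole_bounds(1)[of s x u] assms
    by (cases "s = 0") (auto simp: dipole_def normal_density_def)
qed

subsection \<open>Lindeberg replacement for the killed walk\<close>

text \<open>The Gaussian law is an instance of the same locale, so every expansion proved for the
  step law also holds for its replacement, and the two can be subtracted.\<close>

lemma gaussian_moment_law:
  assumes \<sigma>: "0 < \<sigma>" and \<delta>: "0 < \<delta>" "\<delta> \<le> 1 / 2"
  shows "moment_law (density lborel (normal_density 0 \<sigma>)) \<sigma> \<delta>"
proof -
  let ?G = "density lborel (normal_density 0 \<sigma>)"
  interpret G: prob_space ?G by (rule prob_space_normal_density[OF \<sigma>])
  interpret G: real_distribution ?G by unfold_locales auto
  have int: "integrable ?G f \<longleftrightarrow> integrable lborel (\<lambda>x. normal_density 0 \<sigma> x * f x)"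
    if "f \<in> borel_measurable borel" for f :: "real \<Rightarrow> real"
    using that by (subst integrable_density) auto
  have intg: "(\<integral>x. f x \<partial>?G) = (\<integral>x. normal_density 0 \<sigma> x * f x \<partial>lborel)"
    if "f \<in> borel_measurable borel" for f :: "real \<Rightarrow> real"
    using that by (subst integral_density) auto
  show ?thesis
  proof unfold_locales
    show "integrable ?G (\<lambda>x. x\<^sup>2)" using integrable_normal_moment[OF \<sigma>, of 0 2] by (simp add: int)
    show "(\<integral>x. x \<partial>?G) = 0"
      using has_bochner_integral_integral_eq[OF normal_moment_nz_1[OF \<sigma>, of 0]] by (simp add: intg)
    show "(\<integral>x. x\<^sup>2 \<partial>?G) = \<sigma>\<^sup>2"
      using has_bochner_integral_integral_eq[OF normal_moment_even[OF \<sigma>, of 0 1]] by (simp add: intg)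
    have 3: "integrable ?G (\<lambda>x. 1 + \<bar>x\<bar> ^ 3)"
      using integrable_normal_moment_abs[OF \<sigma>, of 0 3] by (intro Bochner_Integration.integrable_add) (simp_all add: int)
    show "integrable ?G (\<lambda>x. \<bar>x\<bar> powr (2 + \<delta>))"
    proof (rule Bochner_Integration.integrable_bound[OF 3])
      have "\<bar>x\<bar> powr (2 + \<delta>) \<le> 1 + \<bar>x\<bar> ^ 3" for x :: real
      proof (cases "\<bar>x\<bar> \<le> 1")
        case True
        then have "\<bar>x\<bar> powr (2 + \<delta>) \<le> 1" using \<delta> by (intro powr_le1) auto
        then show ?thesis by (simp add: add_increasing2)
      next
        case False
        then have "\<bar>x\<bar> powr (2 + \<delta>) \<le> \<bar>x\<bar> powr 3" using \<delta> by (intro powr_mono) auto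
        also have "\<dots> = \<bar>x\<bar> ^ 3" using False by (subst powr_numeral) auto
        finally show ?thesis by simp
      qed
      then show "AE x in ?G. norm (\<bar>x\<bar> powr (2 + \<delta>)) \<le> norm (1 + \<bar>x\<bar> ^ 3)"
        by (intro AE_I2) (simp add: abs_of_nonneg add_nonneg_nonneg)
    qed auto
  qed (use assms in auto)
qed

text \<open>The convolution formula evaluates the density at a difference; evenness converts the sum
  \<open>v + h\<close> into the difference \<open>- v - h\<close>.\<close>

lemma normal_density_convolution_even:
  assumes "0 < s" "0 < \<sigma>"
  shows "has_bochner_integral (density lborel (normal_density 0 \<sigma>)) (\<lambda>h. normal_density 0 s (v + h))
     (normal_density 0 (sqrt (s\<^sup>2 + \<sigma>\<^sup>2)) v)"
proof -
  have e: "normal_density 0 a (- w) = normal_density 0 a w" for a w by (simp add: normal_density_def)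
  have sym: "normal_density 0 s (- v - h) = normal_density 0 s (v + h)" for h
    using e[of s "v + h"] by (simp only: minus_add_distrib diff_conv_add_uminus)
  have "(\<integral>\<^sup>+h. ennreal (normal_density 0 s (v + h)) \<partial>density lborel (normal_density 0 \<sigma>))
      = (\<integral>\<^sup>+h. ennreal (normal_density 0 s (- v - h) * normal_density 0 \<sigma> h) \<partial>lborel)"
    unfolding sym by (subst nn_integral_density) (simp_all add: mult.commute flip: ennreal_mult')
  also have "\<dots> = ennreal (normal_density 0 (sqrt (s\<^sup>2 + \<sigma>\<^sup>2)) (- v))"
    using fun_cong[OF conv_normal_density_zero_mean[OF assms], of "- v"] by simp
  finally show ?thesis unfolding e by (intro has_bochner_integral_nn_integral) auto
qed

lemma sum_inverse_sqrt_le: "(\<Sum>k<m. 1 / sqrt (real (k + 1))) \<le> 2 * sqrt (real m)"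
proof (induction m)
  case (Suc m)
  define a b where "a = sqrt (real m)" and "b = sqrt (real (m + 1))"
  have ab: "0 \<le> a" "a \<le> b" "0 < b" "b\<^sup>2 = a\<^sup>2 + 1" by (auto simp: a_def b_def)
  have "1 = (b - a) * (b + a)" using ab by (simp add: algebra_simps power2_eq_square)
  also have "\<dots> \<le> (b - a) * (2 * b)" using ab by (intro mult_left_mono) auto
  finally have "1 / b \<le> 2 * (b - a)" using ab by (simp add: field_simps)
  moreover have "sqrt (real (Suc m)) = b" "1 / sqrt (real (m + 1)) = 1 / b" "sqrt (real m) = a"
    by (simp_all add: a_def b_def add.commute)
  ultimately show ?case using Suc by simp
qed simp

section \<open>One-step and accumulated replacement errors\<close>

context moment_law
begin

abbreviation "gaussian_law \<equiv> density lborel (normal_density 0 \<sigma>)"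

definition moment_sum :: real where
  "moment_sum = abs_moment + moment_law.abs_moment gaussian_law \<delta>"

lemma moment_sum_nonneg: "0 \<le> moment_sum"
  using abs_moment_nonneg moment_law.abs_moment_nonneg[OF gaussian_moment_law[OF sd_pos \<delta>_pos \<delta>_le]]
  by (simp add: moment_sum_def)

lemma dipole_mean:
  assumes s: "0 < s"
  shows "\<bar>(\<integral>h. dipole 0 s x (u + h) \<partial>M) - dipole 0 s x u - dipole 2 s x u * \<sigma>\<^sup>2 / 2\<bar>
    \<le> 14 * s powr (- 3 - \<delta>) * abs_moment"
proof -
  have i1: "integrable M (\<lambda>h. dipole 0 s x (u + h))"
    using s by (intro integrable_quad_growth_shift quad_growth_dipole) auto
  note i2 = integrable_quad_growth[OF quad_growth_ident]
  have "(\<integral>h. dipole 0 s x (u + h) \<partial>M) - dipole 0 s x u - dipole 2 s x u * \<sigma>\<^sup>2 / 2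
     = (\<integral>h. dipole 0 s x (u + h) - dipole 0 s x u - dipole (Suc 0) s x u * h - dipole 2 s x u * h\<^sup>2 / 2 \<partial>M)"
    (is "?L = ?R")
    using i1 i2 square_integrable by (simp add: mean_zero second_moment)
  then have "\<bar>?L\<bar> = \<bar>?R\<bar>" by simp
  also have "\<dots> \<le> (\<integral>h. 14 * s powr (- 3 - \<delta>) * \<bar>h\<bar> powr (2 + \<delta>) \<partial>M)"
  proof (rule order_trans[OF integral_abs_bound], rule integral_mono)
    show "integrable M (\<lambda>h. \<bar>dipole 0 s x (u + h) - dipole 0 s x u - dipole (Suc 0) s x u * h - dipole 2 s x u * h\<^sup>2 / 2\<bar>)"
      using i1 i2 square_integrable by (intro integrable_abs Bochner_Integration.integrable_diff) auto
    show "integrable M (\<lambda>h. 14 * s powr (- 3 - \<delta>) * \<bar>h\<bar> powr (2 + \<delta>))" using moment by auto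
    have "\<delta> \<le> 1" using \<delta>_le by simp
    then show "\<bar>dipole 0 s x (u + h) - dipole 0 s x u - dipole (Suc 0) s x u * h - dipole 2 s x u * h\<^sup>2 / 2\<bar>
        \<le> 14 * s powr (- 3 - \<delta>) * \<bar>h\<bar> powr (2 + \<delta>)" for h
      by (rule dipole_taylor_interpolated[OF s \<delta>_pos])
  qed
  also have "\<dots> = 14 * s powr (- 3 - \<delta>) * abs_moment" by (simp add: abs_moment_def)
  finally show ?thesis .
qed

text \<open>Both laws are compared with the same second-order expansion, which depends on the first
  two moments only. For the Gaussian step the mean is exact: the kernel returns with its variance
  raised by \<open>\<sigma>\<^sup>2\<close>.\<close>

lemma lindeberg_step:
  assumes s: "0 < s"
  shows "\<bar>(\<integral>h. dipole 0 s x (u + h) \<partial>M) - dipole 0 (sqrt (s\<^sup>2 + \<sigma>\<^sup>2)) x u\<bar>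
    \<le> 14 * s powr (- 3 - \<delta>) * moment_sum"
proof -
  have a: "has_bochner_integral gaussian_law (\<lambda>h. dipole 0 s x (u + h)) (dipole 0 (sqrt (s\<^sup>2 + \<sigma>\<^sup>2)) x u)"
    using has_bochner_integral_diff[OF normal_density_convolution_even[OF s sd_pos, of "u - x"]
        normal_density_convolution_even[OF s sd_pos, of "u + x"]]
    by (simp add: dipole_def algebra_simps)
  have "\<bar>dipole 0 (sqrt (s\<^sup>2 + \<sigma>\<^sup>2)) x u - dipole 0 s x u - dipole 2 s x u * \<sigma>\<^sup>2 / 2\<bar>
    \<le> 14 * s powr (- 3 - \<delta>) * moment_law.abs_moment gaussian_law \<delta>"
    using moment_law.dipole_mean[OF gaussian_moment_law[OF sd_pos \<delta>_pos \<delta>_le] s, of x u]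
    unfolding has_bochner_integral_integral_eq[OF a] .
  with dipole_mean[OF s, of x u] show ?thesis
    unfolding moment_sum_def distrib_left by linarith
qed

lemma killed_lindeberg_step:
  assumes s: "0 < s" and u: "0 \<le> u"
  shows "\<bar>Q (dipole 0 s x) u - dipole 0 (sqrt (s\<^sup>2 + \<sigma>\<^sup>2)) x u\<bar>
    \<le> 14 * s powr (- 3 - \<delta>) * moment_sum + 2 / s\<^sup>2 * undershoot u"
proof -
  have i: "integrable M (\<lambda>h. dipole 0 s x (u + h))"
    using s by (intro integrable_quad_growth_shift quad_growth_dipole) auto
  have j: "integrable M (\<lambda>h. indicator {0..} (u + h) * dipole 0 s x (u + h))"
    using s by (intro integrable_killed quad_growth_dipole) auto
  have "\<bar>(\<integral>h. dipole 0 s x (u + h) \<partial>M) - Q (dipole 0 s x) u\<bar>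
      = \<bar>\<integral>h. dipole 0 s x (u + h) - indicator {0..} (u + h) * dipole 0 s x (u + h) \<partial>M\<bar>"
    unfolding killed_step_def using i j by simp
  also have "\<dots> \<le> (\<integral>h. 2 / s\<^sup>2 * max 0 (- (u + h)) \<partial>M)"
  proof (rule order_trans[OF integral_abs_bound], rule integral_mono)
    show "integrable M (\<lambda>h. \<bar>dipole 0 s x (u + h) - indicator {0..} (u + h) * dipole 0 s x (u + h)\<bar>)"
      using i j by (intro integrable_abs Bochner_Integration.integrable_diff)
    show "integrable M (\<lambda>h. 2 / s\<^sup>2 * max 0 (- (u + h)))" using integrable_undershoot by auto
    fix h
    show "\<bar>dipole 0 s x (u + h) - indicator {0..} (u + h) * dipole 0 s x (u + h)\<bar> \<le> 2 / s\<^sup>2 * max 0 (- (u + h))"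
      using dipole_lipschitz[OF s, of x "u + h"] s by (cases "0 \<le> u + h") (auto simp: max_def)
  qed
  also have "\<dots> = 2 / s\<^sup>2 * undershoot u" by (simp add: undershoot_def)
  finally show ?thesis using lindeberg_step[OF s, of x u] by linarith
qed

lemma killed_dipole_approx:
  "\<exists>C>0. \<forall>n r x y. 1 \<le> r \<longrightarrow> r \<le> n \<longrightarrow> 0 \<le> y \<longrightarrow>
    \<bar>(Q ^^ (n - r)) (dipole 0 (\<sigma> * sqrt (real r)) x) y - dipole 0 (\<sigma> * sqrt (real n)) x y\<bar>
    \<le> C * ((1 + y) * sqrt (real n) * real r powr (- (3 + \<delta>) / 2) + (1 + y) powr (1 - \<delta>) / real r)"
proof -
  obtain C1 where C1: "0 < C1" and surv: "\<forall>k. \<forall>y\<ge>0. (Q ^^ k) (\<lambda>_. 1) y \<le> C1 * (1 + y) / sqrt (real (k + 1))"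
    using survival_le by blast
  obtain C2 where C2: "0 < C2" and und: "\<forall>m. \<forall>y\<ge>0. (\<Sum>k<m. (Q ^^ k) undershoot y) \<le> C2 * (1 + y) powr (1 - \<delta>)"
    using total_undershoot_le by blast
  define D where "D = 28 * \<sigma> powr (- 3 - \<delta>) * moment_sum * C1"
  define E where "E = 2 / \<sigma>\<^sup>2 * C2"
  have "0 \<le> D" "0 < E" using moment_sum_nonneg C1 C2 sd_pos by (auto simp: D_def E_def)
  have main: "\<bar>(Q ^^ (n - r)) (dipole 0 (\<sigma> * sqrt (real r)) x) y - dipole 0 (\<sigma> * sqrt (real n)) x y\<bar>
    \<le> (D + E) * ((1 + y) * sqrt (real n) * real r powr (- (3 + \<delta>) / 2) + (1 + y) powr (1 - \<delta>) / real r)"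
    if r: "1 \<le> r" and rn: "r \<le> n" and y: "0 \<le> y" for n r x y
  proof -
    \<comment> \<open>At time \<open>k\<close> the kernel has variance
      \<open>\<sigma>\<^sup>2 * (n - k)\<close> left, so a Gaussian step would map
      \<open>f (Suc k)\<close> exactly to \<open>f k\<close>. The replacement stops with
      \<open>r\<close> steps to go.\<close>
    define f where "f k = dipole 0 (\<sigma> * sqrt (real (n - k))) x" for k
    define m where "m = n - r"
    \<comment> \<open>\<open>A\<close> and \<open>B\<close> are the one-step errors at the smallest
      width, \<open>\<sigma> * sqrt r\<close>; all earlier widths are larger and their errors
      smaller. Weighted by survival, the first sums to order \<open>sqrt n\<close>; the second meets
      the total undershoot.\<close>
    define A where "A = 14 * (\<sigma> * sqrt (real r)) powr (- 3 - \<delta>) * moment_sum"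
    define B where "B = 2 / (\<sigma>\<^sup>2 * real r)"
    have A: "0 \<le> A" using moment_sum_nonneg by (simp add: A_def)
    have B: "0 \<le> B" by (simp add: B_def)
    have qf: "quad_growth (f k)" for k unfolding f_def using sd_pos by (intro quad_growth_dipole) auto
    have step: "\<bar>Q (f (Suc k)) u - f k u\<bar> \<le> A * 1 + B * undershoot u" if k: "k < m" and u: "0 \<le> u" for k u
    proof -
      define s where "s = \<sigma> * sqrt (real (n - Suc k))"
      have nk: "r \<le> n - Suc k" "real (n - k) = real (n - Suc k) + 1" using k by (auto simp: m_def)
      have s0: "0 < s" using nk r sd_pos by (auto simp: s_def)
      have sr: "\<sigma> * sqrt (real r) \<le> s" using nk sd_pos by (auto simp: s_def)
      have r0: "0 < \<sigma> * sqrt (real r)" using r sd_pos by auto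
      have "s\<^sup>2 + \<sigma>\<^sup>2 = \<sigma>\<^sup>2 * real (n - k)"
        unfolding nk(2) by (simp add: s_def power_mult_distrib distrib_left)
      then have sq: "sqrt (s\<^sup>2 + \<sigma>\<^sup>2) = \<sigma> * sqrt (real (n - k))" using sd_pos by (simp add: real_sqrt_mult)
      have "\<bar>Q (f (Suc k)) u - f k u\<bar> \<le> 14 * s powr (- 3 - \<delta>) * moment_sum + 2 / s\<^sup>2 * undershoot u"
        using killed_lindeberg_step[OF s0 u, of x] unfolding sq by (simp add: f_def s_def)
      also have "\<dots> \<le> A * 1 + B * undershoot u"
      proof (intro add_mono mult_right_mono undershoot_nonneg)
        have "s powr (- 3 - \<delta>) \<le> (\<sigma> * sqrt (real r)) powr (- 3 - \<delta>)"
          using sr r0 \<delta>_pos by (intro powr_mono2') auto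
        then show "14 * s powr (- 3 - \<delta>) * moment_sum \<le> A * 1"
          unfolding A_def using moment_sum_nonneg by (simp add: mult_right_mono)
        have "\<sigma>\<^sup>2 * real r = (\<sigma> * sqrt (real r))\<^sup>2" by (simp add: power_mult_distrib)
        also have "\<dots> \<le> s\<^sup>2" using sr r0 by (intro power_mono) auto
        finally show "2 / s\<^sup>2 \<le> B" unfolding B_def using r sd_pos s0 by (intro divide_left_mono) auto
      qed
      finally show ?thesis .
    qed
    have "\<bar>(Q ^^ m) (f m) y - f 0 y\<bar> = \<bar>\<Sum>k<m. (Q ^^ k) (\<lambda>u. Q (f (Suc k)) u - f k u) y\<bar>"
      using iter_telescope[of f "{0..}" m y] qf by simp
    also have "\<dots> \<le> (\<Sum>k<m. (Q ^^ k) (\<lambda>u. A * 1 + B * undershoot u) y)"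
    proof (rule order_trans[OF sum_abs sum_mono])
      fix k assume "k \<in> {..<m}"
      then show "\<bar>(Q ^^ k) (\<lambda>u. Q (f (Suc k)) u - f k u) y\<bar> \<le> (Q ^^ k) (\<lambda>u. A * 1 + B * undershoot u) y"
        using y step[of k]
        by (intro iter_abs_le quad_growth_diff quad_growth_killed_step qf
            quad_growth_add[OF quad_growth_cmult[OF quad_growth_const] quad_growth_cmult[OF quad_growth_undershoot]]) simp_all
    qed
    also have "\<dots> = (\<Sum>k<m. A * (Q ^^ k) (\<lambda>_. 1) y + B * (Q ^^ k) undershoot y)"
      by (intro sum.cong refl) (simp only: iter_lincomb[OF quad_growth_const quad_growth_undershoot borel_closed[OF closed_atLeast]])
    also have "\<dots> = A * (\<Sum>k<m. (Q ^^ k) (\<lambda>_. 1) y) + B * (\<Sum>k<m. (Q ^^ k) undershoot y)"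
      by (simp add: sum.distrib sum_distrib_left)
    also have "\<dots> \<le> A * (C1 * (1 + y) * (2 * sqrt (real n))) + B * (C2 * (1 + y) powr (1 - \<delta>))"
    proof (intro add_mono mult_left_mono A B)
      have "(\<Sum>k<m. (Q ^^ k) (\<lambda>_. 1) y) \<le> (\<Sum>k<m. C1 * (1 + y) * (1 / sqrt (real (k + 1))))"
        using surv y by (intro sum_mono) simp
      also have "\<dots> = C1 * (1 + y) * (\<Sum>k<m. 1 / sqrt (real (k + 1)))" by (simp add: sum_distrib_left)
      also have "\<dots> \<le> C1 * (1 + y) * (2 * sqrt (real m))"
        using C1 y sum_inverse_sqrt_le by (intro mult_left_mono) auto
      also have "\<dots> \<le> C1 * (1 + y) * (2 * sqrt (real n))"
        using C1 y by (intro mult_left_mono) (auto simp: m_def)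
      finally show "(\<Sum>k<m. (Q ^^ k) (\<lambda>_. 1) y) \<le> C1 * (1 + y) * (2 * sqrt (real n))" .
    qed (use und y in auto)
    also have "A * (C1 * (1 + y) * (2 * sqrt (real n))) = D * ((1 + y) * sqrt (real n) * real r powr (- (3 + \<delta>) / 2))"
    proof -
      have "(\<sigma> * sqrt (real r)) powr (- 3 - \<delta>) = \<sigma> powr (- 3 - \<delta>) * (real r powr (1 / 2)) powr (- 3 - \<delta>)"
        using sd_pos by (simp add: powr_mult powr_half_sqrt)
      also have "(real r powr (1 / 2)) powr (- 3 - \<delta>) = real r powr (- (3 + \<delta>) / 2)"
        by (simp add: powr_powr)
      finally show ?thesis by (simp add: A_def D_def)
    qed
    also have "B * (C2 * (1 + y) powr (1 - \<delta>)) = E * ((1 + y) powr (1 - \<delta>) / real r)"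
      by (simp add: B_def E_def)
    also have "D * ((1 + y) * sqrt (real n) * real r powr (- (3 + \<delta>) / 2)) + E * ((1 + y) powr (1 - \<delta>) / real r)
       \<le> (D + E) * ((1 + y) * sqrt (real n) * real r powr (- (3 + \<delta>) / 2)) + (D + E) * ((1 + y) powr (1 - \<delta>) / real r)"
      using \<open>0 \<le> D\<close> \<open>0 < E\<close> y by (intro add_mono mult_right_mono) auto
    finally show ?thesis using rn by (simp add: f_def m_def distrib_left)
  qed
  have "0 < D + E" using \<open>0 \<le> D\<close> \<open>0 < E\<close> by simp
  with main show ?thesis by blast
qed

end

subsection \<open>A smoothing inequality for interval probabilities\<close>

text \<open>The triangle on \<open>[-T, T]\<close> folded onto the positive half-line, whence the
  factor 2 and the cosine transform. Its bounded support means that only characteristic functions on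
  \<open>[0, T]\<close> enter.\<close>

definition fejer_weight :: "real \<Rightarrow> real measure" where
  "fejer_weight T = density lborel (\<lambda>t. ennreal (indicator {0..T} t * (2 * (1 - t / T))))"

text \<open>Unnormalised: the integral of \<open>fejer T\<close> over \<open>[-\<kappa>, \<kappa>]\<close> is only shown to be at least \<open>1\<close>, which
  is enough because it multiplies both sides in the comparison below.\<close>

definition fejer :: "real \<Rightarrow> real \<Rightarrow> real" where
  "fejer T z = (\<integral>t. cos (t * z) \<partial>fejer_weight T)"

lemma sets_fejer_weight [simp, measurable_cong]: "sets (fejer_weight T) = sets borel"
  by (simp add: fejer_weight_def)

lemma integral_fejer_weight:
  fixes f :: "real \<Rightarrow> real"
  assumes T: "0 < T" and [measurable]: "f \<in> borel_measurable borel"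
  shows "(\<integral>t. f t \<partial>fejer_weight T) = (\<integral>t. 2 * (1 - t / T) * f t * indicator {0..T} t \<partial>lborel)"
proof -
  have "(\<integral>t. f t \<partial>fejer_weight T) = (\<integral>t. (indicator {0..T} t * (2 * (1 - t / T))) *\<^sub>R f t \<partial>lborel)"
    unfolding fejer_weight_def using T by (intro integral_density) (auto simp: indicator_def field_simps)
  then show ?thesis by (simp add: mult_ac)
qed

text \<open>Nonnegativity, the inverse square tail and the bound by \<open>T\<close> are all read
  off this closed form.\<close>

lemma fejer_eq:
  assumes T: "0 < T"
  shows "fejer T z = (if z = 0 then T else 2 * (1 - cos (T * z)) / (T * z\<^sup>2))"
proof (cases "z = 0")
  case True
  have "(\<integral>t. 2 * (1 - t / T) * indicator {0..T} t \<partial>lborel) = (2 * T - T\<^sup>2 / T) - (2 * 0 - 0\<^sup>2 / T)"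
    by (rule integral_FTC_Icc_real) (use T in \<open>auto intro!: derivative_eq_intros simp: field_simps\<close>)
  then show ?thesis using True T integral_fejer_weight[OF T, of "\<lambda>_. 1"]
    by (simp add: fejer_def power2_eq_square)
next
  case False
  let ?F = "\<lambda>t. 2 * (1 - t / T) * sin (t * z) / z - 2 * cos (t * z) / (T * z\<^sup>2)"
  have "(\<integral>t. 2 * (1 - t / T) * cos (t * z) * indicator {0..T} t \<partial>lborel) = ?F T - ?F 0"
  proof (rule integral_FTC_Icc_real)
    fix t
    show "(?F has_real_derivative 2 * (1 - t / T) * cos (t * z)) (at t)"
      using T False by (auto intro!: derivative_eq_intros simp: field_simps power2_eq_square)
  qed (use T in auto)
  also have "\<dots> = 2 * (1 - cos (T * z)) / (T * z\<^sup>2)"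
    using T False by (simp add: field_simps)
  finally show ?thesis using False T integral_fejer_weight[OF T, of "\<lambda>t. cos (t * z)"]
    by (simp add: fejer_def)
qed

lemma finite_fejer_weight: "0 < T \<Longrightarrow> finite_measure (fejer_weight T)"
proof (rule finite_measureI)
  assume T: "0 < T"
  have "emeasure (fejer_weight T) (space (fejer_weight T))
      = (\<integral>\<^sup>+t. ennreal (indicator {0..T} t * (2 * (1 - t / T))) \<partial>lborel)"
    unfolding fejer_weight_def by (simp add: emeasure_density)
  also have "\<dots> \<le> (\<integral>\<^sup>+t. 2 * indicator {0..T} t \<partial>lborel)"
  proof (intro nn_integral_mono)
    fix t :: real
    show "ennreal (indicator {0..T} t * (2 * (1 - t / T))) \<le> 2 * indicator {0..T} t"
    proof (cases "t \<in> {0..T}")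
      case True
      then have "2 * (1 - t / T) \<le> 2" using T by simp
      from ennreal_leI[OF this] True show ?thesis by simp
    qed simp
  qed
  also have "\<dots> < \<infinity>" using T by (simp add: nn_integral_cmult ennreal_mult_less_top)
  finally show "emeasure (fejer_weight T) (space (fejer_weight T)) \<noteq> \<infinity>" by simp
qed

lemma fejer_nonneg: "0 < T \<Longrightarrow> 0 \<le> fejer T z"
  by (simp add: fejer_eq)

lemma one_minus_cos_le: "1 - cos y \<le> y\<^sup>2 / 2" for y :: real
proof -
  have "1 - cos y = 2 * \<bar>sin (y / 2)\<bar>\<^sup>2" using cos_double_sin[of "y / 2"] by simp
  also have "\<dots> \<le> 2 * \<bar>y / 2\<bar>\<^sup>2"
    using abs_sin_x_le_abs_x[of "y / 2"] by (intro mult_left_mono power_mono) auto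
  finally show ?thesis by (simp add: power_divide)
qed

lemma fejer_tail: "0 < T \<Longrightarrow> fejer T z \<le> 4 / (T * z\<^sup>2)" if "z \<noteq> 0"
proof -
  assume T: "0 < T"
  have "1 - cos (T * z) \<le> 2" using cos_ge_minus_one[of "T * z"] by linarith
  then have "2 * (1 - cos (T * z)) \<le> 2 * 2" by (rule mult_left_mono) simp
  then show ?thesis using that T by (simp add: fejer_eq divide_right_mono)
qed

lemma fejer_lower:
  assumes T: "0 < T" and z: "\<bar>z\<bar> \<le> 1 / T"
  shows "T / 2 \<le> fejer T z"
proof -
  interpret finite_measure "fejer_weight T" by (rule finite_fejer_weight[OF T])
  have m: "(\<integral>t. 1 \<partial>fejer_weight T) = T" using fejer_eq[OF T, of 0] by (simp add: fejer_def)
  have "T / 2 = (\<integral>t. 1 / 2 \<partial>fejer_weight T)" using m by simp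
  also have "\<dots> \<le> fejer T z"
    unfolding fejer_def
  proof (rule integral_mono_AE)
    show "integrable (fejer_weight T) (\<lambda>t. 1 / 2 :: real)" by simp
    show "integrable (fejer_weight T) (\<lambda>t. cos (t * z))" by (rule integrable_const_bound[of _ 1]) auto
    show "AE t in fejer_weight T. 1 / 2 \<le> cos (t * z)"
      unfolding fejer_weight_def
    proof (subst AE_density; (rule AE_I2)?)
      fix t :: real
      show "0 < ennreal (indicator {0..T} t * (2 * (1 - t / T))) \<longrightarrow> 1 / 2 \<le> cos (t * z)"
      proof
        assume "0 < ennreal (indicator {0..T} t * (2 * (1 - t / T)))"
        then have "t \<in> {0..T}" by (cases "t \<in> {0..T}") simp_all
        then have "0 \<le> t" "t \<le> T" by simp_all
        then have "t * \<bar>z\<bar> \<le> T * (1 / T)" using z T by (intro mult_mono) auto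
        then have "\<bar>t * z\<bar> \<le> 1" using T \<open>0 \<le> t\<close> by (simp add: abs_mult)
        then have "(t * z)\<^sup>2 \<le> 1" by (simp add: abs_square_le_1)
        then show "1 / 2 \<le> cos (t * z)" using one_minus_cos_le[of "t * z"] by simp
      qed
    qed auto
  qed
  finally show ?thesis .
qed

lemma fejer_measurable [measurable]: "0 < T \<Longrightarrow> fejer T \<in> borel_measurable borel"
proof -
  assume "0 < T"
  then have "fejer T = (\<lambda>z. if z = 0 then T else 2 * (1 - cos (T * z)) / (T * z\<^sup>2))"
    using fejer_eq by blast
  then show ?thesis by simp
qed

definition fejer_core :: "real \<Rightarrow> real \<Rightarrow> ennreal" where
  "fejer_core T \<kappa> = (\<integral>\<^sup>+z. ennreal (fejer T z) * indicator {-\<kappa>..\<kappa>} z \<partial>lborel)"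

text \<open>Within distance \<open>1 / T\<close> of zero the cosine in the transform is at least 1/2
  and the total weight is \<open>T\<close>, so the kernel is at least \<open>T / 2\<close> on an
  interval of length \<open>2 / T\<close>.\<close>

lemma fejer_core_ge:
  assumes T: "0 < T" and \<kappa>: "1 / T \<le> \<kappa>"
  shows "1 \<le> fejer_core T \<kappa>"
proof -
  have "1 = (\<integral>\<^sup>+z. ennreal (T / 2) * indicator {- (1 / T)..1 / T} z \<partial>lborel)"
    using T by (simp add: nn_integral_cmult flip: ennreal_mult ennreal_1)
  also have "\<dots> \<le> fejer_core T \<kappa>"
    unfolding fejer_core_def
  proof (intro nn_integral_mono)
    fix z :: real
    show "ennreal (T / 2) * indicator {- (1 / T)..1 / T} z \<le> ennreal (fejer T z) * indicator {-\<kappa>..\<kappa>} z"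
    proof (cases "\<bar>z\<bar> \<le> 1 / T")
      case True
      then have "ennreal (T / 2) \<le> ennreal (fejer T z)" using fejer_lower[OF T] by (intro ennreal_leI) auto
      then show ?thesis using True \<kappa> by (auto simp: indicator_def abs_le_iff)
    qed (auto simp: indicator_def abs_le_iff)
  qed
  finally show ?thesis .
qed

lemma nn_integral_inverse_square_tail:
  assumes \<kappa>: "0 < \<kappa>"
  shows "(\<integral>\<^sup>+z. ennreal (1 / z\<^sup>2) * indicator {\<kappa>..} z \<partial>lborel) = ennreal (1 / \<kappa>)"
proof -
  have "(\<integral>\<^sup>+z. ennreal (1 / z\<^sup>2) * indicator {\<kappa>..} z \<partial>lborel) = ennreal (0 - (- 1 / \<kappa>))"
  proof (rule nn_integral_FTC_atLeast)
    have "(\<lambda>z. - 1 / z) = (\<lambda>z. - inverse z :: real)" by (auto simp: divide_inverse)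
    then show "((\<lambda>z. - 1 / z :: real) \<longlongrightarrow> 0) at_top"
      using tendsto_minus[OF tendsto_inverse_0_at_top[OF filterlim_ident]] by simp
    fix z assume "\<kappa> \<le> z"
    then show "((\<lambda>z. - 1 / z) has_real_derivative 1 / z\<^sup>2) (at z)"
      using \<kappa> by (auto intro!: derivative_eq_intros simp: power2_eq_square)
  qed (use \<kappa> in auto)
  then show ?thesis by simp
qed

lemma fejer_tail_mass:
  assumes T: "0 < T" and \<kappa>: "0 < \<kappa>"
  shows "(\<integral>\<^sup>+z. ennreal (fejer T z) * indicator (- {-\<kappa>..\<kappa>}) z \<partial>lborel) \<le> ennreal (8 / (T * \<kappa>))"
proof -
  let ?h = "\<lambda>z :: real. ennreal (1 / z\<^sup>2) * indicator {\<kappa>..} z"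
  have "(\<integral>\<^sup>+z. ennreal (fejer T z) * indicator (- {-\<kappa>..\<kappa>}) z \<partial>lborel)
      \<le> (\<integral>\<^sup>+z. ennreal (4 / T) * (?h z + ?h (0 + (- 1) * z)) \<partial>lborel)"
  proof (intro nn_integral_mono)
    fix z :: real
    show "ennreal (fejer T z) * indicator (- {-\<kappa>..\<kappa>}) z \<le> ennreal (4 / T) * (?h z + ?h (0 + (- 1) * z))"
    proof (cases "z \<in> {-\<kappa>..\<kappa>}")
      case False
      then have z: "z \<noteq> 0" and ind: "(1 :: ennreal) \<le> indicator {\<kappa>..} z + indicator {\<kappa>..} (- z)"
        using \<kappa> by (auto simp: indicator_def)
      have "ennreal (fejer T z) \<le> ennreal (4 / T * (1 / z\<^sup>2))"
        using fejer_tail[OF z T] by (intro ennreal_leI) (simp add: field_simps)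
      also have "\<dots> = ennreal (4 / T) * ennreal (1 / z\<^sup>2)" using T by (subst ennreal_mult) auto
      also have "\<dots> * 1 \<le> ennreal (4 / T) * ennreal (1 / z\<^sup>2) * (indicator {\<kappa>..} z + indicator {\<kappa>..} (- z))"
        by (intro mult_left_mono ind) auto
      finally show ?thesis using False by (simp add: distrib_left mult.assoc)
    qed simp
  qed
  also have "\<dots> = ennreal (4 / T) * ((\<integral>\<^sup>+z. ?h z \<partial>lborel) + (\<integral>\<^sup>+z. ?h (0 + (- 1) * z) \<partial>lborel))"
    by (subst nn_integral_cmult) (auto simp: nn_integral_add)
  also have "(\<integral>\<^sup>+z. ?h (0 + (- 1) * z) \<partial>lborel) = (\<integral>\<^sup>+z. ?h z \<partial>lborel)"
    by (subst (2) nn_integral_real_affine[where c = "-1" and t = 0]) auto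
  also have "ennreal (4 / T) * ((\<integral>\<^sup>+z. ?h z \<partial>lborel) + (\<integral>\<^sup>+z. ?h z \<partial>lborel)) = ennreal (8 / (T * \<kappa>))"
    unfolding nn_integral_inverse_square_tail[OF \<kappa>] using T \<kappa>
    by (simp flip: ennreal_plus ennreal_mult)
  finally show ?thesis .
qed

lemma fejer_le:
  assumes T: "0 < T"
  shows "fejer T z \<le> T"
proof (cases "z = 0")
  case False
  have "2 * (1 - cos (T * z)) \<le> 2 * ((T * z)\<^sup>2 / 2)"
    by (intro mult_left_mono one_minus_cos_le) simp
  also have "\<dots> = T * (T * z\<^sup>2)" by (simp add: power2_eq_square)
  finally show ?thesis using False T by (simp add: fejer_eq pos_divide_le_eq)
qed (use T in \<open>simp add: fejer_eq\<close>)

definition fejer_density :: "real \<Rightarrow> real measure \<Rightarrow> real \<Rightarrow> real" where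
  "fejer_density T N z = (\<integral>s. fejer T (z - s) \<partial>N)"

section \<open>Laws smoothed by the Fejer kernel\<close>

context real_distribution
begin

text \<open>Inversion formula for the smoothed law; the finite weight permits exchanging the
  integrals.\<close>

lemma fejer_density_fourier:
  assumes T: "0 < T"
  shows "fejer_density T M z = (\<integral>t. Re (iexp (- (t * z)) * char M t) \<partial>fejer_weight T)"
proof -
  interpret K: finite_measure "fejer_weight T" by (rule finite_fejer_weight[OF T])
  interpret pair_sigma_finite "fejer_weight T" M ..
  interpret KM: finite_measure "fejer_weight T \<Otimes>\<^sub>M M"
    by (intro finite_measure_pair_measure K.finite_measure_axioms finite_measure_axioms)
  have int: "integrable (fejer_weight T \<Otimes>\<^sub>M M) (case_prod (\<lambda>t s. cos (t * (z - s))))"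
    by (rule KM.integrable_const_bound[of _ 1]) auto
  have "fejer_density T M z = (\<integral>t. (\<integral>s. cos (t * (z - s)) \<partial>M) \<partial>fejer_weight T)"
    unfolding fejer_density_def fejer_def by (rule Fubini_integral[OF int])
  also have "\<dots> = (\<integral>t. Re (iexp (- (t * z)) * char M t) \<partial>fejer_weight T)"
  proof (rule Bochner_Integration.integral_cong[OF refl])
    fix t
    have i: "integrable M (\<lambda>s. iexp (t * s))" by (rule integrable_iexp) auto
    have "(\<integral>s. cos (t * (z - s)) \<partial>M) = (\<integral>s. Re (iexp (- (t * z)) * iexp (t * s)) \<partial>M)"
    proof (rule Bochner_Integration.integral_cong[OF refl])
      fix s
      have "iexp (- (t * z)) * iexp (t * s) = iexp (- (t * (z - s)))"
        by (simp add: algebra_simps flip: exp_add)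
      then show "cos (t * (z - s)) = Re (iexp (- (t * z)) * iexp (t * s))"
        by (simp only: cis_conv_exp[symmetric]) simp
    qed
    also have "\<dots> = Re (\<integral>s. iexp (- (t * z)) * iexp (t * s) \<partial>M)"
      using i by (intro integral_Re) auto
    also have "\<dots> = Re (iexp (- (t * z)) * char M t)" using i by (simp add: char_def)
    finally show "(\<integral>s. cos (t * (z - s)) \<partial>M) = Re (iexp (- (t * z)) * char M t)" .
  qed
  finally show ?thesis .
qed

lemma ennreal_fejer_density:
  assumes T: "0 < T"
  shows "ennreal (fejer_density T M z) = (\<integral>\<^sup>+s. ennreal (fejer T (z - s)) \<partial>M)"
  unfolding fejer_density_def
proof (rule nn_integral_eq_integral[symmetric])
  note [measurable] = fejer_measurable[OF T]
  show "integrable M (\<lambda>s. fejer T (z - s))"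
    by (rule integrable_const_bound[of _ T]) (use fejer_le[OF T] fejer_nonneg[OF T] in auto)
qed (use fejer_nonneg[OF T] in auto)

lemma fejer_density_nonneg: "0 < T \<Longrightarrow> 0 \<le> fejer_density T M z"
  unfolding fejer_density_def by (intro integral_nonneg_AE) (auto simp: fejer_nonneg)

lemma nn_integral_fejer_density:
  assumes T: "0 < T" and [measurable]: "I \<in> sets borel"
  shows "(\<integral>\<^sup>+z. ennreal (fejer_density T M z) * indicator I z \<partial>lborel)
    = (\<integral>\<^sup>+s. \<integral>\<^sup>+z. ennreal (fejer T z) * indicator I (z + s) \<partial>lborel \<partial>M)"
proof -
  note [measurable] = fejer_measurable[OF T]
  interpret pair_sigma_finite M lborel ..
  have "(\<integral>\<^sup>+z. ennreal (fejer_density T M z) * indicator I z \<partial>lborel)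
      = (\<integral>\<^sup>+z. \<integral>\<^sup>+s. ennreal (fejer T (z - s)) * indicator I z \<partial>M \<partial>lborel)"
    unfolding ennreal_fejer_density[OF T] by (intro nn_integral_cong) (simp add: nn_integral_multc)
  also have "\<dots> = (\<integral>\<^sup>+s. \<integral>\<^sup>+z. ennreal (fejer T (z - s)) * indicator I z \<partial>lborel \<partial>M)"
    by (rule Fubini') measurable
  also have "\<dots> = (\<integral>\<^sup>+s. \<integral>\<^sup>+z. ennreal (fejer T z) * indicator I (z + s) \<partial>lborel \<partial>M)"
  proof (rule nn_integral_cong)
    fix s
    show "(\<integral>\<^sup>+z. ennreal (fejer T (z - s)) * indicator I z \<partial>lborel)
      = (\<integral>\<^sup>+z. ennreal (fejer T z) * indicator I (z + s) \<partial>lborel)"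
      by (subst nn_integral_real_affine[where c = 1 and t = s]) (simp_all add: add.commute)
  qed
  finally show ?thesis .
qed

text \<open>A point of \<open>{a..b}\<close> moved by at most \<kappa> stays in the enlarged
  interval, so the core of the kernel captures its mass.\<close>

lemma fejer_core_le_density:
  assumes T: "0 < T"
  shows "fejer_core T \<kappa> * emeasure M {a..b}
    \<le> (\<integral>\<^sup>+z. ennreal (fejer_density T M z) * indicator {a - \<kappa>..b + \<kappa>} z \<partial>lborel)"
proof -
  note [measurable] = fejer_measurable[OF T]
  have "fejer_core T \<kappa> * emeasure M {a..b} = (\<integral>\<^sup>+s. fejer_core T \<kappa> * indicator {a..b} s \<partial>M)"
    by (simp add: nn_integral_cmult)
  also have "\<dots> \<le> (\<integral>\<^sup>+s. \<integral>\<^sup>+z. ennreal (fejer T z) * indicator {a - \<kappa>..b + \<kappa>} (z + s) \<partial>lborel \<partial>M)"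
  proof (rule nn_integral_mono)
    fix s
    show "fejer_core T \<kappa> * indicator {a..b} s
      \<le> (\<integral>\<^sup>+z. ennreal (fejer T z) * indicator {a - \<kappa>..b + \<kappa>} (z + s) \<partial>lborel)"
      unfolding fejer_core_def
      by (cases "s \<in> {a..b}") (auto intro!: nn_integral_mono mult_left_mono simp: indicator_def)
  qed
  finally show ?thesis by (simp add: nn_integral_fejer_density[OF T])
qed

text \<open>The kernel is split at distance \<kappa>. Core displacements can come only from the
  interval enlarged once more. For tail displacements the law is integrated first: every shift of
  the window has mass at most \<open>S\<close>, and only the small tail mass of the kernel
  remains.\<close>

lemma fejer_density_le_core:
  assumes T: "0 < T" and \<kappa>: "0 < \<kappa>" and S: "\<And>v. measure M {v..v + (b - a + 2 * \<kappa>)} \<le> S"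
  shows "(\<integral>\<^sup>+z. ennreal (fejer_density T M z) * indicator {a - \<kappa>..b + \<kappa>} z \<partial>lborel)
    \<le> fejer_core T \<kappa> * emeasure M {a - 2 * \<kappa>..b + 2 * \<kappa>} + ennreal (8 / (T * \<kappa>)) * ennreal S"
proof -
  note [measurable] = fejer_measurable[OF T]
  interpret pair_sigma_finite M lborel ..
  let ?I = "{a - \<kappa>..b + \<kappa>}"
  have "(\<integral>\<^sup>+z. ennreal (fejer_density T M z) * indicator ?I z \<partial>lborel)
    \<le> (\<integral>\<^sup>+s. (\<integral>\<^sup>+z. ennreal (fejer T z) * indicator {-\<kappa>..\<kappa>} z * indicator {a - 2 * \<kappa>..b + 2 * \<kappa>} s
        + ennreal (fejer T z) * indicator (- {-\<kappa>..\<kappa>}) z * indicator ?I (z + s) \<partial>lborel) \<partial>M)"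
    unfolding nn_integral_fejer_density[OF T borel_closed[OF closed_atLeastAtMost]]
    by (intro nn_integral_mono) (auto simp: indicator_def)
  also have "\<dots> = (\<integral>\<^sup>+s. fejer_core T \<kappa> * indicator {a - 2 * \<kappa>..b + 2 * \<kappa>} s \<partial>M)
      + (\<integral>\<^sup>+s. \<integral>\<^sup>+z. ennreal (fejer T z) * indicator (- {-\<kappa>..\<kappa>}) z * indicator ?I (z + s) \<partial>lborel \<partial>M)"
    by (subst nn_integral_add[symmetric])
       (auto simp: nn_integral_add nn_integral_multc fejer_core_def intro!: nn_integral_cong)
  also have "(\<integral>\<^sup>+s. \<integral>\<^sup>+z. ennreal (fejer T z) * indicator (- {-\<kappa>..\<kappa>}) z * indicator ?I (z + s) \<partial>lborel \<partial>M)
      = (\<integral>\<^sup>+z. \<integral>\<^sup>+s. ennreal (fejer T z) * indicator (- {-\<kappa>..\<kappa>}) z * indicator ?I (z + s) \<partial>M \<partial>lborel)"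
    by (rule Fubini'[symmetric]) measurable
  also have "\<dots> \<le> (\<integral>\<^sup>+z. ennreal (fejer T z) * indicator (- {-\<kappa>..\<kappa>}) z * ennreal S \<partial>lborel)"
  proof (intro nn_integral_mono)
    fix z :: real
    have "(\<integral>\<^sup>+s. ennreal (fejer T z) * indicator (- {-\<kappa>..\<kappa>}) z * indicator ?I (z + s) \<partial>M)
      = ennreal (fejer T z) * indicator (- {-\<kappa>..\<kappa>}) z * (\<integral>\<^sup>+s. indicator {a - \<kappa> - z..b + \<kappa> - z} s \<partial>M)"
      by (subst nn_integral_cmult[symmetric]) (auto intro!: nn_integral_cong simp: indicator_def)
    also have "(\<integral>\<^sup>+s. indicator {a - \<kappa> - z..b + \<kappa> - z} s \<partial>M) = ennreal (measure M {a - \<kappa> - z..b + \<kappa> - z})"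
      by (simp add: emeasure_eq_measure)
    also have "\<dots> \<le> ennreal S"
      using S[of "a - \<kappa> - z"] by (intro ennreal_leI) (simp add: algebra_simps)
    finally show "(\<integral>\<^sup>+s. ennreal (fejer T z) * indicator (- {-\<kappa>..\<kappa>}) z * indicator ?I (z + s) \<partial>M)
      \<le> ennreal (fejer T z) * indicator (- {-\<kappa>..\<kappa>}) z * ennreal S"
      by (simp add: mult_left_mono)
  qed
  also have "\<dots> \<le> ennreal (8 / (T * \<kappa>)) * ennreal S"
    using fejer_tail_mass[OF T \<kappa>] by (simp add: nn_integral_multc mult_right_mono)
  finally show ?thesis by (simp add: nn_integral_cmult add_left_mono)
qed

end

lemma fejer_core_finite: "0 < T \<Longrightarrow> fejer_core T \<kappa> < \<infinity>"
proof -
  assume T: "0 < T"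
  have "fejer_core T \<kappa> \<le> (\<integral>\<^sup>+z. ennreal T * indicator {-\<kappa>..\<kappa>} z \<partial>lborel)"
    unfolding fejer_core_def using fejer_le[OF T] by (intro nn_integral_mono mult_right_mono ennreal_leI) auto
  also have "\<dots> < \<infinity>" by (cases "- \<kappa> \<le> \<kappa>") (simp_all add: nn_integral_cmult ennreal_mult_less_top)
  finally show ?thesis .
qed

text \<open>The smoothed densities differ, uniformly in position, by at most the weighted integral
  of the difference of characteristic functions. Integration over the enlarged interval and the two
  core estimates give the claim. Concentration is required of \<open>G\<close> alone, and the roles
  can be exchanged, so upper and lower bounds both follow.\<close>

lemma smoothing_inequality:
  assumes "real_distribution N" "real_distribution G" and T: "0 < T" and \<kappa>: "1 / T \<le> \<kappa>" and ab: "a \<le> b"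
    and S: "\<And>v. measure G {v..v + (b - a + 2 * \<kappa>)} \<le> S"
  shows "measure N {a..b} \<le> measure G {a - 2 * \<kappa>..b + 2 * \<kappa>} + 8 / (T * \<kappa>) * S
    + (b - a + 2 * \<kappa>) * (\<integral>t. cmod (char N t - char G t) \<partial>fejer_weight T)"
proof -
  interpret N: real_distribution N by fact
  interpret G: real_distribution G by fact
  interpret K: finite_measure "fejer_weight T" by (rule finite_fejer_weight[OF T])
  define D where "D = (\<integral>t. cmod (char N t - char G t) \<partial>fejer_weight T)"
  have \<kappa>0: "0 < \<kappa>" using T \<kappa> by (meson less_le_trans zero_less_divide_1_iff)
  have D0: "0 \<le> D" unfolding D_def by (intro integral_nonneg_AE) auto
  have S0: "0 \<le> S" using order_trans[OF measure_nonneg S] .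
  have iD: "integrable (fejer_weight T) (\<lambda>t. cmod (char N t - char G t))"
  proof (rule K.integrable_const_bound[of _ 2])
    show "AE t in fejer_weight T. norm (cmod (char N t - char G t)) \<le> 2"
    proof (rule AE_I2)
      fix t
      have "cmod (char N t - char G t) \<le> 1 + 1"
        by (rule order_trans[OF norm_triangle_ineq4 add_mono[OF N.cmod_char_le_1 G.cmod_char_le_1]])
      then show "norm (cmod (char N t - char G t)) \<le> 2" by simp
    qed
  qed auto
  have i: "integrable (fejer_weight T) (\<lambda>t. Re (iexp (- (t * z)) * char L t))"
    if "real_distribution L" for L z
  proof (rule K.integrable_const_bound[of _ 1])
    interpret L: real_distribution L by fact
    show "AE t in fejer_weight T. norm (Re (iexp (- (t * z)) * char L t)) \<le> 1"
    proof (rule AE_I2)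
      fix t
      have "\<bar>Re (iexp (- (t * z)) * char L t)\<bar> \<le> cmod (iexp (- (t * z)) * char L t)" by (rule abs_Re_le_cmod)
      also have "\<dots> = cmod (char L t)" by (simp only: norm_mult norm_exp_i_times mult_1)
      also have "\<dots> \<le> 1" by (rule L.cmod_char_le_1)
      finally show "norm (Re (iexp (- (t * z)) * char L t)) \<le> 1" unfolding real_norm_def .
    qed
    show "(\<lambda>t. Re (iexp (- (t * z)) * char L t)) \<in> borel_measurable (fejer_weight T)" by measurable
  qed
  have dens: "fejer_density T N z \<le> fejer_density T G z + D" for z
  proof -
    have "fejer_density T N z - fejer_density T G z
        = (\<integral>t. Re (iexp (- (t * z)) * char N t) - Re (iexp (- (t * z)) * char G t) \<partial>fejer_weight T)"
      using i[OF assms(1)] i[OF assms(2)]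
      by (simp add: N.fejer_density_fourier[OF T] G.fejer_density_fourier[OF T])
    also have "\<dots> \<le> D"
      unfolding D_def
    proof (rule integral_mono)
      show "integrable (fejer_weight T) (\<lambda>t. Re (iexp (- (t * z)) * char N t) - Re (iexp (- (t * z)) * char G t))"
        using i[OF assms(1)] i[OF assms(2)] by (rule Bochner_Integration.integrable_diff)
      fix t
      have "Re (iexp (- (t * z)) * char N t) - Re (iexp (- (t * z)) * char G t) = Re (iexp (- (t * z)) * (char N t - char G t))"
        by (simp only: right_diff_distrib minus_complex.sel)
      also have "\<dots> \<le> cmod (iexp (- (t * z)) * (char N t - char G t))" by (rule complex_Re_le_cmod)
      also have "\<dots> = cmod (char N t - char G t)" by (simp only: norm_mult norm_exp_i_times mult_1)
      finally show "Re (iexp (- (t * z)) * char N t) - Re (iexp (- (t * z)) * char G t) \<le> cmod (char N t - char G t)" .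
    qed (rule iD)
    finally show ?thesis by simp
  qed
  note [measurable] = fejer_measurable[OF T]
  obtain c where c: "fejer_core T \<kappa> = ennreal c" "1 \<le> c"
    using fejer_core_ge[OF T \<kappa>] fejer_core_finite[OF T, of \<kappa>]
    by (cases "fejer_core T \<kappa>") (auto simp: ennreal_1[symmetric] simp del: ennreal_1)
  have meas: "fejer_density T G \<in> borel_measurable borel"
    unfolding fejer_density_def by measurable
  have "ennreal c * emeasure N {a..b}
      \<le> (\<integral>\<^sup>+z. ennreal (fejer_density T N z) * indicator {a - \<kappa>..b + \<kappa>} z \<partial>lborel)"
    using N.fejer_core_le_density[OF T, of \<kappa> a b] c(1) by simp
  also have "\<dots> \<le> (\<integral>\<^sup>+z. ennreal (fejer_density T G z) * indicator {a - \<kappa>..b + \<kappa>} z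
       + ennreal D * indicator {a - \<kappa>..b + \<kappa>} z \<partial>lborel)"
  proof (rule nn_integral_mono)
    fix z
    have "ennreal (fejer_density T N z) \<le> ennreal (fejer_density T G z + D)" by (rule ennreal_leI[OF dens])
    also have "\<dots> = ennreal (fejer_density T G z) + ennreal D"
      using G.fejer_density_nonneg[OF T] D0 by simp
    finally show "ennreal (fejer_density T N z) * indicator {a - \<kappa>..b + \<kappa>} z
      \<le> ennreal (fejer_density T G z) * indicator {a - \<kappa>..b + \<kappa>} z + ennreal D * indicator {a - \<kappa>..b + \<kappa>} z"
      unfolding distrib_right[symmetric] by (rule mult_right_mono) simp
  qed
  also have "\<dots> = (\<integral>\<^sup>+z. ennreal (fejer_density T G z) * indicator {a - \<kappa>..b + \<kappa>} z \<partial>lborel)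
       + ennreal D * ennreal (b - a + 2 * \<kappa>)"
    using meas ab \<kappa>0 by (subst nn_integral_add) (auto simp: nn_integral_cmult algebra_simps)
  also have "\<dots> \<le> (ennreal c * emeasure G {a - 2 * \<kappa>..b + 2 * \<kappa>} + ennreal (8 / (T * \<kappa>)) * ennreal S)
       + ennreal D * ennreal (b - a + 2 * \<kappa>)"
    using G.fejer_density_le_core[OF T \<kappa>0 S] c(1) by (intro add_right_mono) simp
  finally have "ennreal (c * measure N {a..b}) \<le> ennreal (c * measure G {a - 2 * \<kappa>..b + 2 * \<kappa>}
      + 8 / (T * \<kappa>) * S + D * (b - a + 2 * \<kappa>))"
    using c(2) T \<kappa>0 S0 D0 ab
    by (simp add: N.emeasure_eq_measure G.emeasure_eq_measure flip: ennreal_mult ennreal_plus)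
  then have "c * measure N {a..b} \<le> c * measure G {a - 2 * \<kappa>..b + 2 * \<kappa>} + (8 / (T * \<kappa>) * S + D * (b - a + 2 * \<kappa>))"
    using c(2) T \<kappa>0 S0 D0 ab by (subst (asm) ennreal_le_iff) auto
  \<comment> \<open>Since the core mass \<open>c\<close> is at least 1, the errors may be multiplied
    by it as well, and \<open>c\<close> can then be cancelled.\<close>
  also have "\<dots> \<le> c * measure G {a - 2 * \<kappa>..b + 2 * \<kappa>} + c * (8 / (T * \<kappa>) * S + D * (b - a + 2 * \<kappa>))"
    using c(2) T \<kappa>0 S0 D0 ab
      mult_right_mono[of 1 c "8 / (T * \<kappa>) * S + D * (b - a + 2 * \<kappa>)"] by simp
  finally have "c * measure N {a..b} \<le> c * (measure G {a - 2 * \<kappa>..b + 2 * \<kappa>} + (8 / (T * \<kappa>) * S + D * (b - a + 2 * \<kappa>)))"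
    by (simp only: distrib_left)
  then show ?thesis using c(2) unfolding D_def by (simp add: mult.commute add.assoc)
qed

subsection \<open>The local limit theorem for the free walk\<close>

text \<open>The new step stands on the left, so that integrals unfold as
  \<open>P ((P ^^ k) f)\<close> does.\<close>

primrec walk_law :: "real measure \<Rightarrow> nat \<Rightarrow> real measure" where
  "walk_law M 0 = return borel 0"
| "walk_law M (Suc k) = convolution M (walk_law M k)"

lemma real_distribution_convolution:
  assumes "real_distribution M" "real_distribution N"
  shows "real_distribution (convolution M N)"
proof -
  interpret M: real_distribution M by fact
  interpret N: real_distribution N by fact
  interpret pair_prob_space M N ..
  have "prob_space (convolution M N)"
    unfolding convolution_def by (rule prob_space_distr) measurable
  then show ?thesis by (simp add: real_distribution_def real_distribution_axioms_def)
qed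

lemma integral_convolution:
  fixes f :: "real \<Rightarrow> 'b::{banach, second_countable_topology}"
  assumes "real_distribution M" "real_distribution N"
    and [measurable]: "f \<in> borel_measurable borel" and bd: "\<And>x. norm (f x) \<le> C"
  shows "(\<integral>x. f x \<partial>convolution M N) = (\<integral>x. \<integral>y. f (x + y) \<partial>N \<partial>M)"
proof -
  interpret M: real_distribution M by fact
  interpret N: real_distribution N by fact
  interpret pair_prob_space M N ..
  have i: "integrable (M \<Otimes>\<^sub>M N) (\<lambda>p. f (fst p + snd p))"
    by (rule P.integrable_const_bound[of _ C]) (auto simp: bd)
  have "(\<integral>x. f x \<partial>convolution M N) = (\<integral>p. f (fst p + snd p) \<partial>(M \<Otimes>\<^sub>M N))"
    unfolding convolution_def by (subst integral_distr) (auto simp: case_prod_beta)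
  also have "\<dots> = (\<integral>x. \<integral>y. f (x + y) \<partial>N \<partial>M)" using integral_fst'[OF i] by simp
  finally show ?thesis .
qed

lemma real_distribution_walk_law: "real_distribution M \<Longrightarrow> real_distribution (walk_law M k)"
proof (induction k)
  case 0
  show ?case by (simp add: real_distribution_def real_distribution_axioms_def prob_space_return)
next
  case (Suc k)
  then show ?case by (simp add: real_distribution_convolution)
qed

lemma char_walk_law:
  assumes M: "real_distribution M"
  shows "char (walk_law M k) t = char M t ^ k"
proof (induction k)
  case 0
  show ?case by (simp add: char_def integral_return)
next
  case (Suc k)
  have "char (walk_law M (Suc k)) t = (\<integral>x. \<integral>y. iexp (t * (x + y)) \<partial>walk_law M k \<partial>M)"
    unfolding char_def walk_law.simps
    by (rule integral_convolution[OF M real_distribution_walk_law[OF M], of _ 1]) auto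
  also have "\<dots> = (\<integral>x. iexp (t * x) * char (walk_law M k) t \<partial>M)"
    unfolding char_def by (simp add: distrib_left exp_add)
  also have "\<dots> = char M t * char (walk_law M k) t" by (simp add: char_def)
  finally show ?case using Suc by simp
qed

lemma char_gaussian:
  assumes s: "0 < s"
  shows "char (density lborel (normal_density 0 s)) t = of_real (exp (- (s * t)\<^sup>2 / 2))"
proof -
  have "char (density lborel (normal_density 0 s)) t = (\<integral>x. normal_density 0 s x *\<^sub>R iexp (t * x) \<partial>lborel)"
    unfolding char_def by (subst integral_density) auto
  also have "\<dots> = s *\<^sub>R (\<integral>x. normal_density 0 s (s * x) *\<^sub>R iexp (t * (s * x)) \<partial>lborel)"
    using s by (subst lborel_integral_real_affine[of s _ 0]) auto
  also have "\<dots> = (\<integral>x. (s * normal_density 0 s (s * x)) *\<^sub>R iexp (t * (s * x)) \<partial>lborel)"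
    by (simp flip: integral_scaleR_right)
  also have "\<dots> = (\<integral>x. std_normal_density x *\<^sub>R iexp ((s * t) * x) \<partial>lborel)"
  proof (rule Bochner_Integration.integral_cong[OF refl])
    fix x
    have "s * normal_density 0 s (s * x) = std_normal_density x"
      using s by (simp add: normal_density_def real_sqrt_mult power_mult_distrib)
    then show "(s * normal_density 0 s (s * x)) *\<^sub>R iexp (t * (s * x)) = std_normal_density x *\<^sub>R iexp ((s * t) * x)"
      by (simp add: mult_ac)
  qed
  also have "\<dots> = char std_normal_distribution (s * t)"
    unfolding char_def by (subst integral_density) auto
  finally show ?thesis by (simp add: char_std_normal_distribution)
qed

text \<open>Division by \<open>q\<close> reduces to the unit disc. The gain is the factor
  \<open>q ^ (m - 1)\<close>, which supplies the Gaussian decay below.\<close>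

lemma norm_power_diff_le:
  fixes z w :: complex
  assumes q: "0 < q" and "norm z \<le> q" "norm w \<le> q"
  shows "norm (z ^ m - w ^ m) \<le> m * q ^ (m - 1) * norm (z - w)"
proof (cases m)
  case (Suc j)
  have "norm ((z / q) ^ m - (w / q) ^ m) \<le> m * norm (z / q - w / q)"
    using assms by (intro norm_power_diff) (auto simp: norm_divide divide_le_eq)
  then have "norm (z ^ m - w ^ m) / q ^ m \<le> m * (norm (z - w) / q)"
    using q by (simp add: power_divide norm_divide norm_power flip: diff_divide_distrib)
  then show ?thesis using q Suc by (simp add: field_simps)
qed simp

context centred_law
begin

lemma free_iter_eq_integral:
  assumes f: "f \<in> borel_measurable borel" "\<And>u. \<bar>f u\<bar> \<le> C"
  shows "(P ^^ k) f u = (\<integral>s. f (u + s) \<partial>walk_law M k)"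
proof (induction k arbitrary: u)
  case 0
  show ?case using f by (simp add: integral_return)
next
  case (Suc k)
  note [measurable] = f(1)
  have M: "real_distribution M" ..
  have "(\<integral>s. f (u + s) \<partial>walk_law M (Suc k)) = (\<integral>x. \<integral>y. f (u + (x + y)) \<partial>walk_law M k \<partial>M)"
    unfolding walk_law.simps
    by (rule integral_convolution[OF M real_distribution_walk_law[OF M], of _ C]) (auto simp: f(2))
  also have "\<dots> = P ((P ^^ k) f) u"
    unfolding killed_step_def[of M UNIV "(P ^^ k) f"] Suc by (simp add: add.assoc)
  finally show ?case by simp
qed

lemma free_iter_indicator:
  assumes [measurable]: "A \<in> sets borel"
  shows "(P ^^ k) (indicator A) u = measure (walk_law M k) {s. u + s \<in> A}"
proof -
  interpret W: real_distribution "walk_law M k" by (rule real_distribution_walk_law) unfold_locales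
  have "(P ^^ k) (indicator A) u = (\<integral>s. indicator A (u + s) \<partial>walk_law M k)"
    by (rule free_iter_eq_integral[of _ 1]) (auto simp: indicator_def)
  also have "\<dots> = integral\<^sup>L (walk_law M k) (indicator {s. u + s \<in> A})"
    by (rule arg_cong[of _ _ "integral\<^sup>L (walk_law M k)"]) (auto simp: indicator_def fun_eq_iff)
  also have "\<dots> = measure (walk_law M k) {s. u + s \<in> A}" by (simp add: W.space_eq_univ)
  finally show ?thesis .
qed

lemma free_iter_square: "(P ^^ k) (\<lambda>u. u\<^sup>2) u = u\<^sup>2 + real k * \<sigma>\<^sup>2"
proof (induction k arbitrary: u)
  case (Suc k)
  have "P (\<lambda>u. u\<^sup>2 + real k * \<sigma>\<^sup>2) u = (\<integral>x. u\<^sup>2 + 2 * u * x + x\<^sup>2 + real k * \<sigma>\<^sup>2 \<partial>M)"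
    unfolding killed_step_def by (intro Bochner_Integration.integral_cong) (auto simp: power2_sum)
  also have "\<dots> = u\<^sup>2 + \<sigma>\<^sup>2 + real k * \<sigma>\<^sup>2"
    using square_integrable integrable_quad_growth[OF quad_growth_ident]
    by (simp add: mean_zero second_moment)
  moreover have "(P ^^ k) (\<lambda>u. u\<^sup>2) = (\<lambda>u. u\<^sup>2 + real k * \<sigma>\<^sup>2)" using Suc by (rule ext)
  ultimately show ?case by (simp add: algebra_simps)
qed simp

lemma walk_law_chebyshev:
  assumes a: "0 < a"
  shows "measure (walk_law M k) {s. a \<le> \<bar>s\<bar>} \<le> real k * \<sigma>\<^sup>2 / a\<^sup>2"
proof -
  have "measure (walk_law M k) {s. a \<le> \<bar>s\<bar>} = (P ^^ k) (indicator {s. a \<le> \<bar>s\<bar>}) 0"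
    by (subst free_iter_indicator) auto
  also have "\<dots> \<le> (P ^^ k) (\<lambda>u. (1 / a\<^sup>2) * u\<^sup>2) 0"
  proof (rule iter_mono)
    show "indicator {s. a \<le> \<bar>s\<bar>} u \<le> (1 / a\<^sup>2) * u\<^sup>2" for u :: real
    proof (cases "a \<le> \<bar>u\<bar>")
      case True
      then have "a\<^sup>2 \<le> u\<^sup>2" using a by (simp add: abs_le_square_iff[symmetric])
      then show ?thesis using a True by simp
    qed simp
    show "quad_growth (\<lambda>u. (1 / a\<^sup>2) * u\<^sup>2)" by (rule quad_growth_cmult[OF quad_growth_square])
  qed (auto intro!: quad_growth_indicator)
  also have "\<dots> = real k * \<sigma>\<^sup>2 / a\<^sup>2"
    by (subst iter_cmult) (auto simp: free_iter_square)
  finally show ?thesis .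
qed

end

text \<open>The Fourier form of the non-lattice hypothesis, the only form used for the local limit
  theorem; \<open>non_lattice_char_less_1\<close> derives it from the definition.\<close>

locale nonlattice_law = moment_law +
  assumes char_less_1: "t \<noteq> 0 \<Longrightarrow> cmod (char M t) < 1"
begin

abbreviation "gaussian_walk r \<equiv> density lborel (normal_density 0 (\<sigma> * sqrt (real r)))"

abbreviation "gaussian_char r t \<equiv> complex_of_real (exp (- (\<sigma>\<^sup>2 * real r * t\<^sup>2 / 2)))"

lemma char_gaussian_walk: "1 \<le> r \<Longrightarrow> char (gaussian_walk r) t = gaussian_char r t"
  using sd_pos by (subst char_gaussian) (simp_all add: power_mult_distrib mult_ac)

lemma char_step_diff_le:
  "cmod (char M t - of_real (exp (- (\<sigma>\<^sup>2 * t\<^sup>2 / 2)))) \<le> \<bar>t\<bar> powr (2 + \<delta>) * moment_sum"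
proof -
  have g: "char gaussian_law t = of_real (exp (- (\<sigma>\<^sup>2 * t\<^sup>2 / 2)))"
    using sd_pos by (subst char_gaussian) (simp_all add: power_mult_distrib)
  have "cmod (char M t - char gaussian_law t) \<le> cmod (char M t - of_real (1 - \<sigma>\<^sup>2 * t\<^sup>2 / 2))
      + cmod (char gaussian_law t - of_real (1 - \<sigma>\<^sup>2 * t\<^sup>2 / 2))"
    using norm_triangle_ineq4[of "char M t - of_real (1 - \<sigma>\<^sup>2 * t\<^sup>2 / 2)"
        "char gaussian_law t - of_real (1 - \<sigma>\<^sup>2 * t\<^sup>2 / 2)"] by simp
  also have "\<dots> \<le> \<bar>t\<bar> powr (2 + \<delta>) * abs_moment + \<bar>t\<bar> powr (2 + \<delta>) * moment_law.abs_moment gaussian_law \<delta>"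
    by (intro add_mono char_second_order moment_law.char_second_order[OF gaussian_moment_law[OF sd_pos \<delta>_pos \<delta>_le]])
  finally show ?thesis unfolding g moment_sum_def distrib_left .
qed

text \<open>For \<open>r \<ge> 2\<close> the exponent \<open>r - 1\<close> is at least
  \<open>r / 2\<close>, so the decay of the power is at least \<open>E * E\<close>. One factor
  \<open>E\<close> absorbs the polynomial in \<open>sqrt r * \<bar>t\<bar>\<close>, the other is
  kept for the integration over \<open>t\<close>.\<close>

lemma char_power_diff_le:
  "\<exists>c>0. \<exists>K\<ge>0. \<forall>r\<ge>2. \<forall>t. \<bar>t\<bar> \<le> c \<longrightarrow> cmod (char M t ^ r - gaussian_char r t)
    \<le> K * real r powr (- \<delta> / 2) * exp (- (\<sigma>\<^sup>2 * real r * t\<^sup>2 / 16))"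
proof -
  obtain c where c: "0 < c" and dec: "\<forall>t. \<bar>t\<bar> \<le> c \<longrightarrow> cmod (char M t) \<le> exp (- (\<sigma>\<^sup>2 * t\<^sup>2 / 4))"
    using char_gaussian_decay by blast
  \<comment> \<open>The second factor bounds \<open>(1 + v ^ 4) * E\<close>: with
    \<open>y = \<sigma>\<^sup>2 * v\<^sup>2 / 16\<close>, \<open>v ^ 4\<close> is
    \<open>256 / \<sigma> ^ 4 * y\<^sup>2\<close>, and \<open>y\<^sup>2 * exp (- y)\<close> is at
    most 2.\<close>
  define K where "K = moment_sum * (1 + 512 / \<sigma> ^ 4)"
  have K: "0 \<le> K" using moment_sum_nonneg by (simp add: K_def)
  have "cmod (char M t ^ r - gaussian_char r t)
    \<le> K * real r powr (- \<delta> / 2) * exp (- (\<sigma>\<^sup>2 * real r * t\<^sup>2 / 16))" if r: "2 \<le> r" and t: "\<bar>t\<bar> \<le> c" for r t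
  proof -
    define q where "q = exp (- (\<sigma>\<^sup>2 * t\<^sup>2 / 4))"
    define v where "v = sqrt (real r) * \<bar>t\<bar>"
    define E where "E = exp (- (\<sigma>\<^sup>2 * real r * t\<^sup>2 / 16))"
    have v2: "v\<^sup>2 = real r * t\<^sup>2" by (simp add: v_def power_mult_distrib)
    have v0: "0 \<le> v" by (simp add: v_def)
    have "exp (- (\<sigma>\<^sup>2 * t\<^sup>2 / 2)) \<le> q" by (simp add: q_def)
    then have "cmod (char M t ^ r - of_real (exp (- (\<sigma>\<^sup>2 * t\<^sup>2 / 2))) ^ r)
      \<le> r * q ^ (r - 1) * cmod (char M t - of_real (exp (- (\<sigma>\<^sup>2 * t\<^sup>2 / 2))))"
      using dec t by (intro norm_power_diff_le) (auto simp: q_def)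
    also have "\<dots> \<le> r * (E * E) * (\<bar>t\<bar> powr (2 + \<delta>) * moment_sum)"
    proof (intro mult_mono char_step_diff_le mult_nonneg_nonneg)
      have "q ^ (r - 1) = exp (- (real (r - 1) * (\<sigma>\<^sup>2 * t\<^sup>2 / 4)))"
        by (simp add: q_def flip: exp_of_nat_mult)
      also have "\<dots> \<le> exp (- ((real r / 2) * (\<sigma>\<^sup>2 * t\<^sup>2 / 4)))"
      proof -
        have "real r / 2 \<le> real (r - 1)" using r by (simp add: of_nat_diff)
        then have "(real r / 2) * (\<sigma>\<^sup>2 * t\<^sup>2 / 4) \<le> real (r - 1) * (\<sigma>\<^sup>2 * t\<^sup>2 / 4)"
          by (intro mult_right_mono) auto
        then show ?thesis by simp
      qed
      also have "\<dots> = E * E" by (simp add: E_def flip: exp_add)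
      finally show "q ^ (r - 1) \<le> E * E" .
    qed (auto simp: q_def E_def)
    also have "r * (E * E) * (\<bar>t\<bar> powr (2 + \<delta>) * moment_sum)
        = moment_sum * (real r powr (- \<delta> / 2) * E) * (v powr (2 + \<delta>) * E)"
    proof -
      have "v powr (2 + \<delta>) = (real r powr (1 / 2)) powr (2 + \<delta>) * \<bar>t\<bar> powr (2 + \<delta>)"
        using r by (simp add: v_def powr_mult powr_half_sqrt)
      also have "(real r powr (1 / 2)) powr (2 + \<delta>) = real r powr (1 + \<delta> / 2)"
        by (simp add: powr_powr add_divide_distrib)
      finally have "real r powr (- \<delta> / 2) * v powr (2 + \<delta>) = (real r powr (- \<delta> / 2) * real r powr (1 + \<delta> / 2)) * \<bar>t\<bar> powr (2 + \<delta>)"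
        by simp
      also have "real r powr (- \<delta> / 2) * real r powr (1 + \<delta> / 2) = r"
        using r by (simp flip: powr_add)
      finally show ?thesis by (simp add: mult_ac)
    qed
    also have "\<dots> \<le> moment_sum * (real r powr (- \<delta> / 2) * E) * (1 + 512 / \<sigma> ^ 4)"
    proof (intro mult_left_mono)
      have "v powr (2 + \<delta>) \<le> 1 + v ^ 4"
      proof (cases "v \<le> 1")
        case True
        then have "v powr (2 + \<delta>) \<le> 1" using \<delta>_pos v0 by (intro powr_le1) auto
        then show ?thesis using zero_le_power[OF v0, of 4] by linarith
      next
        case False
        then have "v powr (2 + \<delta>) \<le> v powr 4" using \<delta>_le by (intro powr_mono) auto
        also have "\<dots> = v ^ 4" using False by (subst powr_numeral) auto
        finally show ?thesis by simp
      qed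
      moreover have "(1 + v ^ 4) * E \<le> 1 + 512 / \<sigma> ^ 4"
      proof -
        define y where "y = \<sigma>\<^sup>2 * v\<^sup>2 / 16"
        have y0: "0 \<le> y" by (simp add: y_def)
        have E: "E = exp (- y)" unfolding E_def y_def v2 by (simp add: mult_ac)
        have "1 + y + y\<^sup>2 / 2 \<le> exp y" by (rule exp_lower_Taylor_quadratic[OF y0])
        then have "y\<^sup>2 \<le> 2 * exp y" using y0 by linarith
        then have "y\<^sup>2 * E \<le> 2" unfolding E by (simp add: exp_minus field_simps)
        then have "256 / \<sigma> ^ 4 * (y\<^sup>2 * E) \<le> 256 / \<sigma> ^ 4 * 2" by (intro mult_left_mono) auto
        then have "(256 / \<sigma> ^ 4 * y\<^sup>2) * E \<le> 512 / \<sigma> ^ 4" by (simp add: mult.assoc)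
        moreover have y4: "256 / \<sigma> ^ 4 * y\<^sup>2 = v ^ 4"
          using sd_pos by (simp add: y_def power_divide power_mult_distrib flip: power_mult)
        ultimately have "v ^ 4 * E \<le> 512 / \<sigma> ^ 4" by (simp only: y4)
        moreover have "E \<le> 1" unfolding E using y0 by simp
        ultimately show ?thesis unfolding distrib_right by linarith
      qed
      moreover have "0 \<le> E" by (simp add: E_def)
      ultimately show "v powr (2 + \<delta>) * E \<le> 1 + 512 / \<sigma> ^ 4"
        by (meson mult_right_mono order_trans)
    qed (use moment_sum_nonneg in \<open>auto simp: E_def\<close>)
    also have "\<dots> = K * real r powr (- \<delta> / 2) * E" by (simp add: K_def)
    also have "of_real (exp (- (\<sigma>\<^sup>2 * t\<^sup>2 / 2))) ^ r = gaussian_char r t"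
      by (simp add: mult_ac flip: of_real_power exp_of_nat_mult)
    finally show ?thesis by (simp add: E_def)
  qed
  with c K show ?thesis by blast
qed

text \<open>Away from zero continuity on a compact interval gives a maximum below one, and
  \<open>q\<close> dominates the Gaussian factor too. The right end \<open>max c T\<close> keeps the
  interval nonempty.\<close>

lemma char_diff_pointwise:
  assumes T: "0 < T"
  shows "\<exists>K\<ge>0. \<exists>q\<ge>0. q < 1 \<and> (\<forall>r\<ge>2. \<forall>t\<in>{0..T}. cmod (char M t ^ r - gaussian_char r t)
    \<le> K * real r powr (- \<delta> / 2) * exp (- (\<sigma>\<^sup>2 * real r * t\<^sup>2 / 16)) + 2 * q ^ r)"
proof -
  obtain c K where c: "0 < c" and K: "0 \<le> K"
    and near: "\<forall>r\<ge>2. \<forall>t. \<bar>t\<bar> \<le> c \<longrightarrow> cmod (char M t ^ r - gaussian_char r t)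
      \<le> K * real r powr (- \<delta> / 2) * exp (- (\<sigma>\<^sup>2 * real r * t\<^sup>2 / 16))"
    using char_power_diff_le by blast
  have "\<exists>x\<in>{c..max c T}. \<forall>y\<in>{c..max c T}. cmod (char M y) \<le> cmod (char M x)"
    by (rule continuous_attains_sup) (auto intro!: continuous_at_imp_continuous_on continuous_norm isCont_char)
  then obtain x where x: "c \<le> x" "\<forall>y\<in>{c..max c T}. cmod (char M y) \<le> cmod (char M x)" by auto
  define q where "q = max (cmod (char M x)) (exp (- (\<sigma>\<^sup>2 * c\<^sup>2 / 2)))"
  have q: "0 \<le> q" unfolding q_def by (rule max.coboundedI2) simp
  have q1: "q < 1" using char_less_1[of x] x c sd_pos by (auto simp: q_def)
  have "cmod (char M t ^ r - gaussian_char r t)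
    \<le> K * real r powr (- \<delta> / 2) * exp (- (\<sigma>\<^sup>2 * real r * t\<^sup>2 / 16)) + 2 * q ^ r" if r: "2 \<le> r" and t: "t \<in> {0..T}" for r t
  proof (cases "t \<le> c")
    case True
    then show ?thesis using near r t q by (auto intro!: add_increasing2)
  next
    case False
    then have "cmod (char M t) \<le> q" using x t by (auto simp: q_def intro: max.coboundedI1)
    then have 1: "cmod (char M t ^ r) \<le> q ^ r" by (simp add: norm_power power_mono)
    have "exp (- (\<sigma>\<^sup>2 * t\<^sup>2 / 2)) \<le> exp (- (\<sigma>\<^sup>2 * c\<^sup>2 / 2))"
      using False c sd_pos by (auto intro!: power_mono mult_left_mono)
    also have "\<dots> \<le> q" by (simp add: q_def)
    finally have "exp (- (\<sigma>\<^sup>2 * t\<^sup>2 / 2)) ^ r \<le> q ^ r" by (intro power_mono) auto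
    moreover have "exp (- (\<sigma>\<^sup>2 * t\<^sup>2 / 2)) ^ r = exp (- (\<sigma>\<^sup>2 * real r * t\<^sup>2 / 2))"
      by (simp add: mult_ac flip: exp_of_nat_mult)
    ultimately have 2: "cmod (gaussian_char r t) \<le> q ^ r" by (simp only: norm_of_real abs_exp_cancel)
    have "cmod (char M t ^ r - gaussian_char r t) \<le> q ^ r + q ^ r"
      by (rule order_trans[OF norm_triangle_ineq4 add_mono[OF 1 2]])
    then show ?thesis using K by (simp add: add_increasing)
  qed
  with K q q1 show ?thesis by blast
qed

text \<open>The part near zero integrates to order \<open>1 / sqrt r\<close>, which the prefactor
  cancels, leaving \<open>r powr (- \<delta> / 2)\<close>; the remaining part is geometrically
  small.\<close>

lemma char_diff_integral_tendsto:
  assumes T: "0 < T"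
  shows "(\<lambda>r. sqrt (real r) * (\<integral>t. cmod (char M t ^ r - gaussian_char r t) \<partial>fejer_weight T)) \<longlonglongrightarrow> 0"
proof -
  obtain K q where K: "0 \<le> K" and q: "0 \<le> q" "q < 1"
    and bd: "\<forall>r\<ge>2. \<forall>t\<in>{0..T}. cmod (char M t ^ r - gaussian_char r t)
      \<le> K * real r powr (- \<delta> / 2) * exp (- (\<sigma>\<^sup>2 * real r * t\<^sup>2 / 16)) + 2 * q ^ r"
    using char_diff_pointwise[OF T] by blast
  define B where "B = 2 * K * (sqrt (2 * pi) * sqrt 8 / \<sigma>)"
  have main: "sqrt (real r) * (\<integral>t. cmod (char M t ^ r - gaussian_char r t) \<partial>fejer_weight T)
     \<le> B * real r powr (- \<delta> / 2) + 4 * T * (real r * q ^ r)" if r: "2 \<le> r" for r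
  proof -
    define s where "s = sqrt 8 / (\<sigma> * sqrt (real r))"
    define A where "A = 2 * K * real r powr (- \<delta> / 2)"
    have s: "0 < s" using sd_pos r by (simp add: s_def)
    have A: "0 \<le> A" using K by (simp add: A_def)
    \<comment> \<open>As a multiple of a normal density of standard deviation \<open>s\<close>, the
      exponential has a known integral.\<close>
    have gs: "exp (- (\<sigma>\<^sup>2 * real r * t\<^sup>2 / 16)) = sqrt (2 * pi) * s * normal_density 0 s t" for t
    proof -
      have "2 * s\<^sup>2 = 16 / (\<sigma>\<^sup>2 * real r)" by (simp add: s_def power_divide power_mult_distrib)
      moreover have "sqrt (2 * pi * s\<^sup>2) = sqrt (2 * pi) * s" using s by (simp add: real_sqrt_mult)
      ultimately show ?thesis using s sd_pos r unfolding normal_density_def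
        by (simp add: field_simps)
    qed
    have "(\<integral>t. cmod (char M t ^ r - gaussian_char r t) \<partial>fejer_weight T)
        = (\<integral>t. 2 * (1 - t / T) * cmod (char M t ^ r - gaussian_char r t) * indicator {0..T} t \<partial>lborel)"
      by (rule integral_fejer_weight[OF T]) measurable
    also have "\<dots> \<le> (\<integral>t. A * (sqrt (2 * pi) * s * normal_density 0 s t) + (4 * q ^ r) * indicator {0..T} t \<partial>lborel)"
    proof (rule integral_mono')
      show "integrable lborel (\<lambda>t. A * (sqrt (2 * pi) * s * normal_density 0 s t) + (4 * q ^ r) * indicator {0..T} t)"
        using s T by (intro Bochner_Integration.integrable_add integrable_mult_right integrable_normal_density) auto
      fix t :: real
      have nn: "0 \<le> A * (sqrt (2 * pi) * s * normal_density 0 s t) + (4 * q ^ r) * indicator {0..T} t"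
        using A s q by simp
      show "2 * (1 - t / T) * cmod (char M t ^ r - gaussian_char r t) * indicator {0..T} t
        \<le> A * (sqrt (2 * pi) * s * normal_density 0 s t) + (4 * q ^ r) * indicator {0..T} t"
      proof (cases "t \<in> {0..T}")
        case True
        have "2 * (1 - t / T) * cmod (char M t ^ r - gaussian_char r t)
          \<le> 2 * (K * real r powr (- \<delta> / 2) * exp (- (\<sigma>\<^sup>2 * real r * t\<^sup>2 / 16)) + 2 * q ^ r)"
          using True T bd r by (intro mult_mono) auto
        then show ?thesis using True unfolding gs by (simp add: A_def algebra_simps)
      qed (use nn in simp)
      show "0 \<le> A * (sqrt (2 * pi) * s * normal_density 0 s t) + (4 * q ^ r) * indicator {0..T} t" by (rule nn)
    qed
    also have "\<dots> = A * (sqrt (2 * pi) * s) + 4 * q ^ r * T"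
      using s T by (subst Bochner_Integration.integral_add) auto
    finally have "sqrt (real r) * (\<integral>t. cmod (char M t ^ r - gaussian_char r t) \<partial>fejer_weight T)
      \<le> sqrt (real r) * (A * (sqrt (2 * pi) * s) + 4 * q ^ r * T)" by (intro mult_left_mono) auto
    also have "\<dots> = A * (sqrt (2 * pi) * (sqrt (real r) * s)) + 4 * T * (sqrt (real r) * q ^ r)"
      by (simp add: algebra_simps)
    also have "sqrt (real r) * s = sqrt 8 / \<sigma>" using r by (simp add: s_def)
    also have "A * (sqrt (2 * pi) * (sqrt 8 / \<sigma>)) = B * real r powr (- \<delta> / 2)"
      by (simp add: A_def B_def)
    also have "4 * T * (sqrt (real r) * q ^ r) \<le> 4 * T * (real r * q ^ r)"
    proof (intro mult_left_mono mult_right_mono)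
      show "sqrt (real r) \<le> real r" using r by (intro real_le_lsqrt) (auto simp: power2_eq_square)
    qed (use q T in auto)
    finally show ?thesis by simp
  qed
  have "(\<lambda>r. B * real r powr (- \<delta> / 2) + 4 * T * (real r * q ^ r)) \<longlonglongrightarrow> B * 0 + 4 * T * 0"
  proof (intro tendsto_intros)
    show "(\<lambda>r. real r powr (- \<delta> / 2)) \<longlonglongrightarrow> 0"
      using \<delta>_pos by (intro tendsto_neg_powr filterlim_real_sequentially) auto
    show "(\<lambda>r. real r * q ^ r) \<longlonglongrightarrow> 0" using powser_times_n_limit_0[of q] q by simp
  qed
  then have lim: "(\<lambda>r. B * real r powr (- \<delta> / 2) + 4 * T * (real r * q ^ r)) \<longlonglongrightarrow> 0" by simp
  show ?thesis
  proof (rule tendsto_sandwich[OF _ _ tendsto_const lim])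
    show "\<forall>\<^sub>F r in sequentially. 0 \<le> sqrt (real r) * (\<integral>t. cmod (char M t ^ r - gaussian_char r t) \<partial>fejer_weight T)"
      by (intro always_eventually allI mult_nonneg_nonneg integral_nonneg_AE) auto
    show "\<forall>\<^sub>F r in sequentially. sqrt (real r) * (\<integral>t. cmod (char M t ^ r - gaussian_char r t) \<partial>fejer_weight T)
        \<le> B * real r powr (- \<delta> / 2) + 4 * T * (real r * q ^ r)"
      using eventually_ge_at_top[of 2] by eventually_elim (rule main)
  qed
qed

end

section \<open>Gaussian probabilities of intervals\<close>

lemma integrable_indicator_Icc [simp]: "integrable lborel (indicator {a..b :: real} :: real \<Rightarrow> real)"
  by (cases "a \<le> b") (auto intro: integrable_real_indicator)

lemma gaussian_interval_eq:
  "measure (density lborel (normal_density 0 s)) {a..b} = (\<integral>v. normal_density 0 s v * indicator {a..b} v \<partial>lborel)"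
proof -
  have "emeasure (density lborel (normal_density 0 s)) {a..b} = (\<integral>\<^sup>+v. ennreal (normal_density 0 s v * indicator {a..b} v) \<partial>lborel)"
    by (subst emeasure_density) (auto intro!: nn_integral_cong simp: indicator_def)
  then show ?thesis unfolding measure_def by (subst integral_eq_nn_integral) auto
qed

lemma gaussian_interval_integrable:
  "0 < s \<Longrightarrow> integrable lborel (\<lambda>v. normal_density 0 s v * indicator {a..b} v)"
  using integrable_mult_indicator[of "{a..b}" lborel "normal_density 0 s"] by (simp add: mult.commute)

lemma gaussian_interval_le:
  assumes s: "0 < s" and ab: "a \<le> b"
  shows "measure (density lborel (normal_density 0 s)) {a..b} \<le> (b - a) / s"
proof -
  have "measure (density lborel (normal_density 0 s)) {a..b} \<le> (\<integral>v. (1 / s) * indicator {a..b} v \<partial>lborel)"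
    unfolding gaussian_interval_eq
  proof (rule integral_mono[OF gaussian_interval_integrable[OF s]])
    show "integrable lborel (\<lambda>v. (1 / s) * indicator {a..b} v :: real)"
      by (rule integrable_mult_right[OF integrable_indicator_Icc])
    show "normal_density 0 s v * indicator {a..b} v \<le> (1 / s) * indicator {a..b} v" for v
      using gauss_bounds(1)[OF s, of v] by (intro mult_right_mono) auto
  qed
  then show ?thesis using ab by simp
qed

lemma gaussian_interval_enlarge:
  assumes s: "0 < s" and h: "0 \<le> h" and ab: "a \<le> b"
  shows "measure (density lborel (normal_density 0 s)) {a - h..b + h}
    \<le> measure (density lborel (normal_density 0 s)) {a..b} + 2 * h / s" (is "measure ?G _ \<le> _")
proof -
  interpret G: prob_space ?G by (rule prob_space_normal_density[OF s])
  have "measure ?G {a - h..b + h} \<le> measure ?G (({a - h..a} \<union> {a..b}) \<union> {b..b + h})"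
    by (rule G.finite_measure_mono) auto
  also have "\<dots> \<le> measure ?G ({a - h..a} \<union> {a..b}) + measure ?G {b..b + h}"
    by (rule measure_Un_le) auto
  also have "\<dots> \<le> (measure ?G {a - h..a} + measure ?G {a..b}) + measure ?G {b..b + h}"
    by (intro add_right_mono measure_Un_le) auto
  also have "\<dots> \<le> (h / s + measure ?G {a..b}) + h / s"
    using gaussian_interval_le[OF s, of "a - h" a] gaussian_interval_le[OF s, of b "b + h"] h
    by (intro add_mono) auto
  finally show ?thesis by simp
qed

lemma normal_density_lipschitz:
  assumes s: "0 < s"
  shows "\<bar>normal_density 0 s v - normal_density 0 s w\<bar> \<le> 1 / s\<^sup>2 * \<bar>v - w\<bar>"
proof -
  have "norm (gauss 0 s v - gauss 0 s w) \<le> 1 / s\<^sup>2 * norm (v - w)"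
    by (rule field_differentiable_bound[of UNIV "gauss 0 s" "gauss (Suc 0) s"])
       (use gauss_deriv[OF s, of 0] gauss_bounds(2)[OF s] in auto)
  then show ?thesis by simp
qed

lemma gaussian_interval_approx:
  assumes s: "0 < s" and \<Delta>: "0 \<le> \<Delta>"
  shows "\<bar>measure (density lborel (normal_density 0 s)) {a..a + \<Delta>} - \<Delta> * normal_density 0 s a\<bar> \<le> \<Delta>\<^sup>2 / s\<^sup>2"
proof -
  note i = gaussian_interval_integrable[OF s, of a "a + \<Delta>"]
  have "measure (density lborel (normal_density 0 s)) {a..a + \<Delta>} - \<Delta> * normal_density 0 s a
      = (\<integral>v. normal_density 0 s v * indicator {a..a + \<Delta>} v - normal_density 0 s a * indicator {a..a + \<Delta>} v \<partial>lborel)"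
    (is "?L = ?R")
    unfolding gaussian_interval_eq using i \<Delta> by (subst Bochner_Integration.integral_diff) auto
  then have "\<bar>?L\<bar> = \<bar>?R\<bar>" by simp
  also have "\<dots> \<le> (\<integral>v. (1 / s\<^sup>2 * \<Delta>) * indicator {a..a + \<Delta>} v \<partial>lborel)"
  proof (rule order_trans[OF integral_abs_bound], rule integral_mono)
    show "integrable lborel (\<lambda>v. \<bar>normal_density 0 s v * indicator {a..a + \<Delta>} v - normal_density 0 s a * indicator {a..a + \<Delta>} v\<bar>)"
      using i by (intro integrable_abs Bochner_Integration.integrable_diff) auto
    show "integrable lborel (\<lambda>v. (1 / s\<^sup>2 * \<Delta>) * indicator {a..a + \<Delta>} v :: real)"
      by (rule integrable_mult_right[OF integrable_indicator_Icc])
    fix v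
    show "\<bar>normal_density 0 s v * indicator {a..a + \<Delta>} v - normal_density 0 s a * indicator {a..a + \<Delta>} v\<bar>
      \<le> (1 / s\<^sup>2 * \<Delta>) * indicator {a..a + \<Delta>} v"
    proof (cases "v \<in> {a..a + \<Delta>}")
      case True
      have "\<bar>normal_density 0 s v - normal_density 0 s a\<bar> \<le> 1 / s\<^sup>2 * \<bar>v - a\<bar>"
        by (rule normal_density_lipschitz[OF s])
      also have "\<dots> \<le> 1 / s\<^sup>2 * \<Delta>" using True by (intro mult_left_mono) auto
      finally show ?thesis using True by simp
    qed simp
  qed
  also have "\<dots> = \<Delta>\<^sup>2 / s\<^sup>2" using \<Delta> by (simp add: power2_eq_square)
  finally show ?thesis .
qed

section \<open>Uniform local limit theorem and concentration\<close>

context nonlattice_law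
begin

lemma real_distribution_M: "real_distribution M" ..

text \<open>The smoothing inequality is applied twice. With the walk on the left it gives the upper
  bound and hence concentration of the walk, which is the input for the application with exchanged
  roles. As \<kappa> is a fixed fraction of \<open>\<Delta>\<^sub>0\<close>, the cutoff
  \<open>T\<close> does not depend on \<open>r\<close>, and all errors are proportional to
  \<Delta>.\<close>

lemma local_limit:
  assumes \<Delta>\<^sub>0: "0 < \<Delta>\<^sub>0" and \<theta>: "0 < \<theta>"
  shows "\<exists>R\<ge>1. \<forall>r\<ge>R. \<forall>\<Delta>\<ge>\<Delta>\<^sub>0. \<forall>a.
    \<bar>measure (walk_law M r) {a..a + \<Delta>} - measure (gaussian_walk r) {a..a + \<Delta>}\<bar> \<le> \<theta> * \<Delta> / sqrt (real r)"
proof -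
  define c1 where "c1 = 1 / \<sigma>"
  have c1: "0 < c1" using sd_pos by (simp add: c1_def)
  \<comment> \<open>The constant collects the errors of the lower bound: \<open>7 * c1 + 2\<close>
    from concentration, 1 from the characteristic functions, \<open>4 * c1\<close> from enlarging
    the Gaussian interval. The cap 1/8 leaves room to shrink an interval of length \<Delta> by
    \<open>2 * \<kappa>\<close> at each end.\<close>
  define \<tau> where "\<tau> = min (1 / 8) (\<theta> / (11 * c1 + 3))"
  have \<tau>: "0 < \<tau>" "\<tau> \<le> 1 / 8" using \<theta> c1 unfolding \<tau>_def by (simp, intro min.cobounded1)
  have "\<tau> \<le> \<theta> / (11 * c1 + 3)" unfolding \<tau>_def by (rule min.cobounded2)
  then have \<tau>\<theta>: "\<tau> * (11 * c1 + 3) \<le> \<theta>" using c1 by (simp add: pos_le_divide_eq)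
  define \<kappa> where "\<kappa> = \<tau> * \<Delta>\<^sub>0"
  define T where "T = 8 / (\<kappa> * \<tau>)"
  have \<kappa>: "0 < \<kappa>" using \<tau> \<Delta>\<^sub>0 by (simp add: \<kappa>_def)
  have T: "0 < T" "8 / (T * \<kappa>) = \<tau>" using \<tau> \<kappa> by (simp_all add: T_def)
  have T\<kappa>: "1 / T \<le> \<kappa>" using \<tau> \<kappa> by (simp add: T_def)
  define D where "D r = (\<integral>t. cmod (char M t ^ r - gaussian_char r t) \<partial>fejer_weight T)" for r
  have "\<forall>\<^sub>F r in sequentially. sqrt (real r) * D r < \<tau>"
    using order_tendstoD(2)[OF char_diff_integral_tendsto[OF T(1)] \<tau>(1)] by (simp add: D_def)
  then obtain R0 where R0: "\<forall>r\<ge>R0. sqrt (real r) * D r < \<tau>"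
    unfolding eventually_sequentially by blast
  have main: "\<bar>measure (walk_law M r) {a..a + \<Delta>} - measure (gaussian_walk r) {a..a + \<Delta>}\<bar> \<le> \<theta> * \<Delta> / sqrt (real r)"
    if r: "max 1 R0 \<le> r" and \<Delta>: "\<Delta>\<^sub>0 \<le> \<Delta>" for r \<Delta> a
  proof -
    let ?W = "walk_law M r" and ?G = "gaussian_walk r"
    define s where "s = \<sigma> * sqrt (real r)"
    have s: "0 < s" using sd_pos r by (simp add: s_def)
    have s1: "1 / s = c1 / sqrt (real r)" by (simp add: s_def c1_def)
    have W: "real_distribution ?W" by (rule real_distribution_walk_law[OF real_distribution_M])
    have G: "real_distribution ?G"
      using prob_space_normal_density[OF s, of 0] by (simp add: s_def real_distribution_def real_distribution_axioms_def)
    interpret W: real_distribution ?W by fact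
    have D1: "(\<integral>t. cmod (char ?W t - char ?G t) \<partial>fejer_weight T) = D r"
      using r by (simp add: D_def char_walk_law[OF real_distribution_M] char_gaussian_walk)
    have D2: "(\<integral>t. cmod (char ?G t - char ?W t) \<partial>fejer_weight T) = D r"
      unfolding D1[symmetric] by (simp add: norm_minus_commute)
    have D: "D r \<le> \<tau> / sqrt (real r)" using R0 r by (simp add: pos_le_divide_eq mult.commute less_imp_le)
    define e where "e \<Delta> = \<Delta> / sqrt (real r)" for \<Delta>
    have up: "measure ?W {v..v + l} \<le> measure ?G {v..v + l} + \<tau> * (6 * c1 + 2) * e l" if l: "\<Delta>\<^sub>0 \<le> l" for v l
    proof -
      have k: "\<kappa> \<le> \<tau> * l" "\<kappa> \<le> l / 2"
        using l \<tau> \<Delta>\<^sub>0 mult_mono[of \<tau> "1 / 2" \<Delta>\<^sub>0 l] by (auto simp: \<kappa>_def)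
      have l0: "0 < l" using l \<Delta>\<^sub>0 by simp
      have "measure ?W {v..v + l} \<le> measure ?G {v - 2 * \<kappa>..v + l + 2 * \<kappa>} + 8 / (T * \<kappa>) * ((l + 2 * \<kappa>) / s)
          + (v + l - v + 2 * \<kappa>) * D r"
        unfolding D1[symmetric]
      proof (rule smoothing_inequality[OF W G T(1) T\<kappa>])
        show "measure ?G {w..w + (v + l - v + 2 * \<kappa>)} \<le> (l + 2 * \<kappa>) / s" for w
          using gaussian_interval_le[OF s, of w "w + (l + 2 * \<kappa>)"] l0 \<kappa> by (simp add: s_def)
      qed (use l0 in simp)
      also have "\<dots> \<le> (measure ?G {v..v + l} + 2 * (2 * \<kappa>) / s) + \<tau> * (2 * l / s) + (2 * l) * (\<tau> / sqrt (real r))"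
      proof (intro add_mono)
        show "measure ?G {v - 2 * \<kappa>..v + l + 2 * \<kappa>} \<le> measure ?G {v..v + l} + 2 * (2 * \<kappa>) / s"
          using gaussian_interval_enlarge[OF s, of "2 * \<kappa>" v "v + l"] \<kappa> l0 by (simp add: s_def)
        show "8 / (T * \<kappa>) * ((l + 2 * \<kappa>) / s) \<le> \<tau> * (2 * l / s)"
          unfolding T(2) using k \<tau> s by (intro mult_left_mono divide_right_mono) auto
        show "(v + l - v + 2 * \<kappa>) * D r \<le> (2 * l) * (\<tau> / sqrt (real r))"
          using D k l0 \<tau> \<kappa> by (intro mult_mono) (auto simp: D_def intro!: integral_nonneg_AE)
      qed
      also have "2 * (2 * \<kappa>) / s \<le> 4 * (\<tau> * l) / s" using k s by (intro divide_right_mono) auto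
      also have "(measure ?G {v..v + l} + 4 * (\<tau> * l) / s) + \<tau> * (2 * l / s) + (2 * l) * (\<tau> / sqrt (real r))
          = measure ?G {v..v + l} + 6 * \<tau> * l * (1 / s) + 2 * \<tau> * (l / sqrt (real r))"
        by (simp add: mult_ac)
      also have "\<dots> = measure ?G {v..v + l} + \<tau> * (6 * c1 + 2) * e l"
        unfolding s1 by (simp add: e_def algebra_simps)
      finally show ?thesis by simp
    qed
    have e0: "0 \<le> e \<Delta>" using \<Delta> \<Delta>\<^sub>0 by (simp add: e_def)
    have conc: "measure ?W {v..v + \<Delta>} \<le> (7 * c1 + 2) * e \<Delta>" for v
    proof -
      have "measure ?G {v..v + \<Delta>} \<le> \<Delta> * (1 / s)"
        using gaussian_interval_le[OF s, of v "v + \<Delta>"] \<Delta> \<Delta>\<^sub>0 by (simp add: s_def)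
      also have "\<dots> = c1 * e \<Delta>" unfolding s1 by (simp add: e_def)
      finally have g: "measure ?G {v..v + \<Delta>} \<le> c1 * e \<Delta>" .
      have "\<tau> * (6 * c1 + 2) * e \<Delta> \<le> 1 * (6 * c1 + 2) * e \<Delta>"
        using \<tau> c1 e0 by (intro mult_right_mono) auto
      with g up[OF \<Delta>, of v] show ?thesis by (simp add: algebra_simps)
    qed
    have k: "\<kappa> \<le> \<tau> * \<Delta>" "4 * \<kappa> \<le> \<Delta>"
      using \<Delta> \<tau> \<Delta>\<^sub>0 mult_mono[of \<tau> "1 / 4" \<Delta>\<^sub>0 \<Delta>] by (auto simp: \<kappa>_def)
    have low: "measure ?G {a..a + \<Delta>} \<le> measure ?W {a..a + \<Delta>} + \<tau> * (11 * c1 + 3) * e \<Delta>"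
    proof -
      \<comment> \<open>Shrinking first makes the interval that the smoothing inequality enlarges
        coincide with the given one.\<close>
      let ?a = "a + 2 * \<kappa>" and ?b = "a + \<Delta> - 2 * \<kappa>"
      have "measure ?G {?a..?b} \<le> measure ?W {?a - 2 * \<kappa>..?b + 2 * \<kappa>} + 8 / (T * \<kappa>) * ((7 * c1 + 2) * e \<Delta>)
          + (?b - ?a + 2 * \<kappa>) * D r"
        unfolding D2[symmetric]
      proof (rule smoothing_inequality[OF G W T(1) T\<kappa>])
        fix w
        have "measure ?W {w..w + (?b - ?a + 2 * \<kappa>)} \<le> measure ?W {w..w + \<Delta>}"
          using \<kappa> by (intro W.finite_measure_mono) auto
        also have "\<dots> \<le> (7 * c1 + 2) * e \<Delta>" by (rule conc)
        finally show "measure ?W {w..w + (?b - ?a + 2 * \<kappa>)} \<le> (7 * c1 + 2) * e \<Delta>" .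
      qed (use k in simp)
      also have "(?b - ?a + 2 * \<kappa>) * D r \<le> \<Delta> * (\<tau> / sqrt (real r))"
        using D k \<kappa> \<tau> by (intro mult_mono) (auto simp: D_def intro!: integral_nonneg_AE)
      also have "\<Delta> * (\<tau> / sqrt (real r)) = \<tau> * e \<Delta>" by (simp add: e_def)
      finally have 1: "measure ?G {?a..?b} \<le> measure ?W {a..a + \<Delta>} + \<tau> * ((7 * c1 + 2) * e \<Delta>) + \<tau> * e \<Delta>"
        unfolding T(2) by simp
      have "measure ?G {?a - 2 * \<kappa>..?b + 2 * \<kappa>} \<le> measure ?G {?a..?b} + 2 * (2 * \<kappa>) / s"
        using gaussian_interval_enlarge[OF s, of "2 * \<kappa>" ?a ?b] \<kappa> k by (simp add: s_def)
      also have "2 * (2 * \<kappa>) / s \<le> 4 * (\<tau> * \<Delta>) / s" using k s by (intro divide_right_mono) auto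
      also have "4 * (\<tau> * \<Delta>) / s = 4 * \<tau> * \<Delta> * (1 / s)" by simp
      also have "\<dots> = 4 * \<tau> * c1 * e \<Delta>" unfolding s1 by (simp add: e_def)
      finally have "measure ?G {a..a + \<Delta>} \<le> measure ?G {?a..?b} + 4 * \<tau> * c1 * e \<Delta>" by simp
      with 1 show ?thesis by (simp add: algebra_simps)
    qed
    have "\<tau> * (6 * c1 + 2) * e \<Delta> \<le> \<tau> * (11 * c1 + 3) * e \<Delta>"
      using \<tau> c1 e0 by (intro mult_right_mono mult_left_mono) auto
    with up[OF \<Delta>, of a] low have "\<bar>measure ?W {a..a + \<Delta>} - measure ?G {a..a + \<Delta>}\<bar> \<le> \<tau> * (11 * c1 + 3) * e \<Delta>"
      by linarith
    also have "\<dots> \<le> \<theta> * e \<Delta>" using \<tau>\<theta> e0 by (intro mult_right_mono)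
    finally show ?thesis by (simp add: e_def)
  qed
  show ?thesis
  proof (intro exI[of _ "max 1 R0"] conjI allI impI)
    fix r \<Delta> a assume "max 1 R0 \<le> r" "\<Delta>\<^sub>0 \<le> \<Delta>"
    then show "\<bar>measure (walk_law M r) {a..a + \<Delta>} - measure (gaussian_walk r) {a..a + \<Delta>}\<bar> \<le> \<theta> * \<Delta> / sqrt (real r)"
      by (rule main)
  qed simp
qed

text \<open>Large \<open>r\<close> follows from the local limit theorem. For the finitely many
  others the probability is at most 1, and \<open>\<Delta> \<ge> \<Delta>\<^sub>0\<close> lets the
  constant absorb this; \<open>r + 1\<close> includes \<open>r = 0\<close>.\<close>

lemma concentration:
  assumes \<Delta>\<^sub>0: "0 < \<Delta>\<^sub>0"
  shows "\<exists>C>0. \<forall>r. \<forall>\<Delta>\<ge>\<Delta>\<^sub>0. \<forall>a. measure (walk_law M r) {a..a + \<Delta>} \<le> C * \<Delta> / sqrt (real (r + 1))"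
proof -
  obtain R where R: "1 \<le> R" and ll: "\<forall>r\<ge>R. \<forall>\<Delta>\<ge>\<Delta>\<^sub>0. \<forall>a.
    \<bar>measure (walk_law M r) {a..a + \<Delta>} - measure (gaussian_walk r) {a..a + \<Delta>}\<bar> \<le> 1 * \<Delta> / sqrt (real r)"
    using local_limit[OF \<Delta>\<^sub>0, of 1] by auto
  define C where "C = max (sqrt (real (R + 1)) / \<Delta>\<^sub>0) (2 * (1 / \<sigma> + 1))"
  have C: "0 < C" using \<Delta>\<^sub>0 by (simp add: C_def less_max_iff_disj)
  have "measure (walk_law M r) {a..a + \<Delta>} \<le> C * \<Delta> / sqrt (real (r + 1))" if \<Delta>: "\<Delta>\<^sub>0 \<le> \<Delta>" for r \<Delta> a
  proof (cases "R \<le> r")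
    case True
    have s: "0 < \<sigma> * sqrt (real r)" using sd_pos True R by simp
    have \<Delta>': "0 < \<Delta>" using \<Delta> \<Delta>\<^sub>0 by simp
    have "measure (walk_law M r) {a..a + \<Delta>} \<le> measure (gaussian_walk r) {a..a + \<Delta>} + \<Delta> / sqrt (real r)"
      using ll[rule_format, OF True \<Delta>, of a] by simp
    also have "\<dots> \<le> \<Delta> / (\<sigma> * sqrt (real r)) + \<Delta> / sqrt (real r)"
      using gaussian_interval_le[OF s, of a "a + \<Delta>"] \<Delta>' by simp
    also have "\<dots> = (1 / \<sigma> + 1) * \<Delta> / sqrt (real r)" by (simp add: add_divide_distrib distrib_right)
    also have "\<dots> \<le> (2 * (1 / \<sigma> + 1)) * \<Delta> / sqrt (real (r + 1))"
    proof -
      have "sqrt (real (r + 1)) \<le> sqrt (2\<^sup>2 * real r)" using True R by (intro real_sqrt_le_mono) simp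
      then have le: "sqrt (real (r + 1)) \<le> 2 * sqrt (real r)" by (simp add: real_sqrt_mult)
      have "(1 / \<sigma> + 1) * \<Delta> / sqrt (real r) = (1 / \<sigma> + 1) * \<Delta> * 2 / (2 * sqrt (real r))" by simp
      also have "\<dots> \<le> (1 / \<sigma> + 1) * \<Delta> * 2 / sqrt (real (r + 1))"
        using le sd_pos \<Delta>' True R by (intro divide_left_mono) auto
      finally show ?thesis by (simp add: mult_ac)
    qed
    also have "\<dots> \<le> C * \<Delta> / sqrt (real (r + 1))"
      using \<Delta>' by (intro divide_right_mono mult_right_mono) (auto simp: C_def)
    finally show ?thesis .
  next
    case False
    interpret W: real_distribution "walk_law M r" by (rule real_distribution_walk_law[OF real_distribution_M])
    have "sqrt (real (r + 1)) * 1 \<le> sqrt (real (R + 1)) * (\<Delta> / \<Delta>\<^sub>0)"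
      using False \<Delta> \<Delta>\<^sub>0 by (intro mult_mono) auto
    also have "\<dots> = sqrt (real (R + 1)) / \<Delta>\<^sub>0 * \<Delta>" by simp
    also have "\<dots> \<le> C * \<Delta>" using \<Delta> \<Delta>\<^sub>0 by (intro mult_right_mono) (auto simp: C_def)
    finally have "1 \<le> C * \<Delta> / sqrt (real (r + 1))" by (simp add: pos_le_divide_eq)
    then show ?thesis using W.prob_le_1 order_trans by blast
  qed
  with C show ?thesis by blast
qed

end

section \<open>The cost of killing over a short time\<close>

context centred_law
begin

lemma killed_iter_le_free_iter:
  assumes f: "quad_growth f" "\<And>u. 0 \<le> f u"
  shows "(Q ^^ k) f u \<le> (P ^^ k) f u" "0 \<le> (P ^^ k) f u"
proof -
  have nn: "0 \<le> (P ^^ k) f u" for k u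
    using f by (intro iter_nonneg) auto
  then show "0 \<le> (P ^^ k) f u" .
  show "(Q ^^ k) f u \<le> (P ^^ k) f u"
  proof (induction k arbitrary: u)
    case (Suc k)
    have "Q ((Q ^^ k) f) u \<le> P ((P ^^ k) f) u"
      unfolding killed_step_def[of M _ "(Q ^^ k) f"] killed_step_def[of M _ "(P ^^ k) f"]
    proof (rule integral_mono)
      show "integrable M (\<lambda>x. indicator {0..} (u + x) * (Q ^^ k) f (u + x))"
        using f by (intro integrable_killed) auto
      show "integrable M (\<lambda>x. indicator UNIV (u + x) * (P ^^ k) f (u + x))"
        using f by (intro integrable_killed) auto
      show "indicator {0..} (u + x) * (Q ^^ k) f (u + x) \<le> indicator UNIV (u + x) * (P ^^ k) f (u + x)" for x
        using Suc[of "u + x"] nn[of k "u + x"] by (simp add: indicator_def)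
    qed
    then show ?case by simp
  qed simp
qed

text \<open>The difference counts the free paths that have visited the negative half-line. At the
  first such visit, at some \<open>v < 0\<close> with \<open>k < r\<close> steps left, the free
  expectation is at most \<open>B\<close>; the induction averages this over the first visit.\<close>

lemma free_iter_minus_killed_iter_le:
  assumes f: "quad_growth f" and B: "\<And>k v. k < r \<Longrightarrow> v < 0 \<Longrightarrow> (P ^^ k) f v \<le> B" and B0: "0 \<le> B"
  shows "(P ^^ r) f u - (Q ^^ r) f u \<le> B"
  using B
proof (induction r arbitrary: u)
  case (Suc r)
  have i: "integrable M (\<lambda>x. indicator {0..} (u + x) * (Q ^^ r) f (u + x))"
    "integrable M (\<lambda>x. indicator UNIV (u + x) * (P ^^ r) f (u + x))"
    by (intro integrable_killed quad_growth_iter f; simp)+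
  have "P ((P ^^ r) f) u - Q ((Q ^^ r) f) u
      = (\<integral>x. indicator UNIV (u + x) * (P ^^ r) f (u + x) - indicator {0..} (u + x) * (Q ^^ r) f (u + x) \<partial>M)"
    unfolding killed_step_def[of M _ "(Q ^^ r) f"] killed_step_def[of M _ "(P ^^ r) f"] using i by simp
  also have "\<dots> \<le> (\<integral>x. B \<partial>M)"
  proof (rule integral_mono)
    fix x
    have "(P ^^ r) f (u + x) - (Q ^^ r) f (u + x) \<le> B" using Suc by simp
    moreover have "(P ^^ r) f (u + x) \<le> B" if "u + x < 0" using Suc.prems[OF lessI that] .
    ultimately show "indicator UNIV (u + x) * (P ^^ r) f (u + x) - indicator {0..} (u + x) * (Q ^^ r) f (u + x) \<le> B"
      by (cases "0 \<le> u + x") auto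
  qed (use i in auto)
  finally show ?case by simp
qed (use B0 in simp)

text \<open>To reach distance \<open>d\<close>, one of the two halves of the walk must move by at least \<open>d / 2\<close>.\<close>

lemma walk_law_split:
  assumes d: "0 < d"
    and Ca: "\<And>v. measure (walk_law M a) {v..v + \<Delta>} \<le> Ca" and Cb: "\<And>v. measure (walk_law M b) {v..v + \<Delta>} \<le> Cb"
  shows "measure (walk_law M (a + b)) {d..d + \<Delta>}
    \<le> measure (walk_law M a) {s. d / 2 \<le> \<bar>s\<bar>} * Cb + measure (walk_law M b) {s. d / 2 \<le> \<bar>s\<bar>} * Ca"
proof -
  let ?A = "walk_law M a" and ?B = "walk_law M b"
  have M: "real_distribution M" ..
  interpret A: real_distribution ?A by (rule real_distribution_walk_law[OF M])
  interpret B: real_distribution ?B by (rule real_distribution_walk_law[OF M])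
  interpret W: real_distribution "walk_law M (a + b)" by (rule real_distribution_walk_law[OF M])
  interpret pair_prob_space ?A ?B ..
  define E where "E = {s :: real. d / 2 \<le> \<bar>s\<bar>}"
  define J where "J = {d..d + \<Delta>}"
  have [measurable]: "E \<in> sets borel" "J \<in> sets borel" by (auto simp: E_def J_def)
  have Cn: "0 \<le> Ca" "0 \<le> Cb" using order_trans[OF measure_nonneg Ca] order_trans[OF measure_nonneg Cb] by auto
  have m: "measure L {s. u + s \<in> J} = measure L {d - u..d - u + \<Delta>}" for L u
    by (rule arg_cong[of _ _ "measure L"]) (auto simp: J_def)
  have "measure (walk_law M (a + b)) J = (P ^^ (a + b)) (indicator J) 0"
    by (subst free_iter_indicator) auto
  also have "\<dots> = (P ^^ a) (\<lambda>u. measure ?B {s. u + s \<in> J}) 0"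
    unfolding funpow_add comp_def by (intro arg_cong2[of _ _ _ _ "\<lambda>f. (P ^^ a) f"] ext refl free_iter_indicator) auto
  finally have eq: "measure (walk_law M (a + b)) J = (P ^^ a) (\<lambda>u. measure ?B {s. u + s \<in> J}) 0" .
  have meas: "(\<lambda>u. measure ?B {s. u + s \<in> J}) \<in> borel_measurable borel"
  proof -
    have "(\<lambda>u. measure ?B {s. u + s \<in> J}) = (P ^^ b) (indicator J)"
      by (rule ext, subst free_iter_indicator) auto
    moreover have "quad_growth ((P ^^ b) (indicator J))" by (intro quad_growth_iter quad_growth_indicator) auto
    ultimately show ?thesis using quad_growth_measurable by simp
  qed
  have "(P ^^ a) (\<lambda>u. measure ?B {s. u + s \<in> J}) 0 = (\<integral>u. measure ?B {s. u + s \<in> J} \<partial>?A)"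
    by (subst free_iter_eq_integral[OF meas, of 1]) (auto simp: B.prob_le_1)
  then have "ennreal (measure (walk_law M (a + b)) J) = (\<integral>\<^sup>+u. ennreal (measure ?B {s. u + s \<in> J}) \<partial>?A)"
    unfolding eq using meas
    by (subst nn_integral_eq_integral) (auto intro!: A.integrable_const_bound[of _ 1])
  also have "\<dots> = (\<integral>\<^sup>+u. \<integral>\<^sup>+s. indicator J (u + s) \<partial>?B \<partial>?A)"
  proof (rule nn_integral_cong)
    fix u
    have "(\<integral>\<^sup>+s. indicator J (u + s) \<partial>?B) = (\<integral>\<^sup>+s. indicator {s. u + s \<in> J} s \<partial>?B)"
      by (intro nn_integral_cong) (auto simp: indicator_def)
    also have "\<dots> = emeasure ?B {s. u + s \<in> J}" by (rule nn_integral_indicator) measurable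
    finally show "ennreal (measure ?B {s. u + s \<in> J}) = (\<integral>\<^sup>+s. indicator J (u + s) \<partial>?B)"
      by (simp add: B.emeasure_eq_measure)
  qed
  \<comment> \<open>Given the half that moved far, the other is confined to a window of length
    \<Delta>; each term is a tail probability times a concentration bound.\<close>
  also have "\<dots> \<le> (\<integral>\<^sup>+u. \<integral>\<^sup>+s. indicator E u * indicator {d - u..d - u + \<Delta>} s + indicator E s * indicator {d - s..d - s + \<Delta>} u \<partial>?B \<partial>?A)"
  proof (intro nn_integral_mono)
    fix u s
    show "indicator J (u + s) \<le> (indicator E u * indicator {d - u..d - u + \<Delta>} s + indicator E s * indicator {d - s..d - s + \<Delta>} u :: ennreal)"
    proof (cases "u + s \<in> J")
      case True
      then have "d / 2 \<le> \<bar>u\<bar> \<or> d / 2 \<le> \<bar>s\<bar>" using d unfolding J_def by auto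
      then show ?thesis using True by (auto simp: E_def J_def indicator_def)
    qed simp
  qed
  also have "\<dots> = (\<integral>\<^sup>+u. \<integral>\<^sup>+s. indicator E u * indicator {d - u..d - u + \<Delta>} s \<partial>?B \<partial>?A)
      + (\<integral>\<^sup>+u. \<integral>\<^sup>+s. indicator E s * indicator {d - s..d - s + \<Delta>} u \<partial>?B \<partial>?A)"
    by (simp add: nn_integral_add indicator_def[of "{_.._}"])
  also have "(\<integral>\<^sup>+u. \<integral>\<^sup>+s. indicator E s * indicator {d - s..d - s + \<Delta>} u \<partial>?B \<partial>?A)
      = (\<integral>\<^sup>+s. \<integral>\<^sup>+u. indicator E s * indicator {d - s..d - s + \<Delta>} u \<partial>?A \<partial>?B)"
    by (rule Fubini'[symmetric]) (simp add: indicator_def[of "{_.._}"])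
  also have "\<dots> \<le> (\<integral>\<^sup>+s. ennreal Ca * indicator E s \<partial>?B)"
  proof (rule nn_integral_mono)
    fix s
    have "(\<integral>\<^sup>+u. indicator E s * indicator {d - s..d - s + \<Delta>} u \<partial>?A) = indicator E s * ennreal (measure ?A {d - s..d - s + \<Delta>})"
      by (simp add: nn_integral_cmult A.emeasure_eq_measure)
    also have "\<dots> \<le> indicator E s * ennreal Ca" by (intro mult_left_mono ennreal_leI Ca) auto
    finally show "(\<integral>\<^sup>+u. indicator E s * indicator {d - s..d - s + \<Delta>} u \<partial>?A) \<le> ennreal Ca * indicator E s"
      by (simp add: mult.commute)
  qed
  also have "(\<integral>\<^sup>+u. \<integral>\<^sup>+s. indicator E u * indicator {d - u..d - u + \<Delta>} s \<partial>?B \<partial>?A) \<le> (\<integral>\<^sup>+u. ennreal Cb * indicator E u \<partial>?A)"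
  proof (rule nn_integral_mono)
    fix u
    have "(\<integral>\<^sup>+s. indicator E u * indicator {d - u..d - u + \<Delta>} s \<partial>?B) = indicator E u * ennreal (measure ?B {d - u..d - u + \<Delta>})"
      by (simp add: nn_integral_cmult B.emeasure_eq_measure)
    also have "\<dots> \<le> indicator E u * ennreal Cb" by (intro mult_left_mono ennreal_leI Cb) auto
    finally show "(\<integral>\<^sup>+s. indicator E u * indicator {d - u..d - u + \<Delta>} s \<partial>?B) \<le> ennreal Cb * indicator E u"
      by (simp add: mult.commute)
  qed
  also have "(\<integral>\<^sup>+u. ennreal Cb * indicator E u \<partial>?A) + (\<integral>\<^sup>+s. ennreal Ca * indicator E s \<partial>?B)
      = ennreal (measure ?A E * Cb + measure ?B E * Ca)"
    using Cn by (simp add: nn_integral_cmult A.emeasure_eq_measure B.emeasure_eq_measure mult.commute flip: ennreal_mult ennreal_plus)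
  finally have "ennreal (measure (walk_law M (a + b)) J) \<le> ennreal (measure ?A E * Cb + measure ?B E * Ca)"
    by (simp add: add_mono)
  then show ?thesis unfolding E_def J_def using Cn by (subst (asm) ennreal_le_iff) auto
qed

end

context nonlattice_law
begin

text \<open>Each half has about \<open>i / 2\<close> steps. Chebyshev gives order
  \<open>i / d\<^sup>2\<close> for the far half and concentration gives
  \<open>\<Delta> / sqrt i\<close> for the other. Unlike the plain concentration bound, the product
  increases with \<open>i\<close>, so the largest remaining time controls all smaller ones.\<close>

lemma walk_law_far_interval:
  assumes \<Delta>\<^sub>0: "0 < \<Delta>\<^sub>0"
  shows "\<exists>C>0. \<forall>i. \<forall>\<Delta>\<ge>\<Delta>\<^sub>0. \<forall>d>0. measure (walk_law M i) {d..d + \<Delta>} \<le> C * \<Delta> * sqrt (real (i + 1)) / d\<^sup>2"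
proof -
  obtain C where C: "0 < C" and conc: "\<forall>r. \<forall>\<Delta>\<ge>\<Delta>\<^sub>0. \<forall>a. measure (walk_law M r) {a..a + \<Delta>} \<le> C * \<Delta> / sqrt (real (r + 1))"
    using concentration[OF \<Delta>\<^sub>0] by blast
  have "measure (walk_law M i) {d..d + \<Delta>} \<le> (8 * \<sigma>\<^sup>2 * C) * \<Delta> * sqrt (real (i + 1)) / d\<^sup>2"
    if \<Delta>: "\<Delta>\<^sub>0 \<le> \<Delta>" and d: "0 < d" for i \<Delta> d
  proof -
    define a b where "a = i div 2" and "b = i - i div 2"
    have ab: "a + b = i" "a \<le> b" "b \<le> a + 1" by (auto simp: a_def b_def)
    have \<Delta>': "0 < \<Delta>" using \<Delta> \<Delta>\<^sub>0 by simp
    define t where "t k = real k * \<sigma>\<^sup>2 / (d / 2)\<^sup>2" for k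
    have t: "measure (walk_law M k) {s. d / 2 \<le> \<bar>s\<bar>} \<le> t k" for k
      unfolding t_def using d by (intro walk_law_chebyshev) simp
    have key: "real k / sqrt (real (l + 1)) \<le> sqrt (real (i + 1))" if "k \<le> l + 1" "l \<le> i" for k l
    proof -
      have "real k / sqrt (real (l + 1)) \<le> real (l + 1) / sqrt (real (l + 1))"
        using that by (intro divide_right_mono) auto
      also have "\<dots> = sqrt (real (l + 1))" by (simp add: real_div_sqrt)
      also have "\<dots> \<le> sqrt (real (i + 1))" using that by simp
      finally show ?thesis .
    qed
    have "measure (walk_law M i) {d..d + \<Delta>}
      \<le> measure (walk_law M a) {s. d / 2 \<le> \<bar>s\<bar>} * (C * \<Delta> / sqrt (real (b + 1)))
       + measure (walk_law M b) {s. d / 2 \<le> \<bar>s\<bar>} * (C * \<Delta> / sqrt (real (a + 1)))"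
      unfolding ab(1)[symmetric] using conc \<Delta> d by (intro walk_law_split) auto
    also have "\<dots> \<le> t a * (C * \<Delta> / sqrt (real (b + 1))) + t b * (C * \<Delta> / sqrt (real (a + 1)))"
      using C \<Delta>' by (intro add_mono mult_right_mono t) auto
    also have "\<dots> = (4 * \<sigma>\<^sup>2 * C * \<Delta> / d\<^sup>2) * (real a / sqrt (real (b + 1)) + real b / sqrt (real (a + 1)))"
      by (simp add: t_def power_divide distrib_left mult_ac add_divide_distrib)
    also have "\<dots> \<le> (4 * \<sigma>\<^sup>2 * C * \<Delta> / d\<^sup>2) * (sqrt (real (i + 1)) + sqrt (real (i + 1)))"
      using C \<Delta>' ab by (intro mult_left_mono add_mono key) auto
    finally show ?thesis by (simp add: mult_ac)
  qed
  moreover have "0 < 8 * \<sigma>\<^sup>2 * C" using C sd_pos by simp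
  ultimately show ?thesis by blast
qed

text \<open>With \<open>r\<close> of order \<open>e\<^sup>2 * n\<close> and \<open>x\<close> of
  order \<open>sqrt n\<close> the loss is of order \<open>e * \<Delta> / sqrt n\<close>.\<close>

lemma killing_loss:
  assumes \<Delta>\<^sub>0: "0 < \<Delta>\<^sub>0"
  shows "\<exists>C>0. \<forall>r. \<forall>\<Delta>\<ge>\<Delta>\<^sub>0. \<forall>x>0. \<forall>u.
    \<bar>(P ^^ r) (indicator {x..x + \<Delta>}) u - (Q ^^ r) (indicator {x..x + \<Delta>}) u\<bar> \<le> C * \<Delta> * sqrt (real (r + 1)) / x\<^sup>2"
proof -
  obtain C where C: "0 < C" and far: "\<forall>i. \<forall>\<Delta>\<ge>\<Delta>\<^sub>0. \<forall>d>0. measure (walk_law M i) {d..d + \<Delta>} \<le> C * \<Delta> * sqrt (real (i + 1)) / d\<^sup>2"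
    using walk_law_far_interval[OF \<Delta>\<^sub>0] by blast
  have "\<bar>(P ^^ r) (indicator {x..x + \<Delta>}) u - (Q ^^ r) (indicator {x..x + \<Delta>}) u\<bar> \<le> C * \<Delta> * sqrt (real (r + 1)) / x\<^sup>2"
    if \<Delta>: "\<Delta>\<^sub>0 \<le> \<Delta>" and x: "0 < x" for r \<Delta> x u
  proof -
    let ?f = "indicator {x..x + \<Delta>} :: real \<Rightarrow> real"
    have f: "quad_growth ?f" by (rule quad_growth_indicator) simp
    have \<Delta>': "0 < \<Delta>" using \<Delta> \<Delta>\<^sub>0 by simp
    have "(P ^^ r) ?f u - (Q ^^ r) ?f u \<le> C * \<Delta> * sqrt (real (r + 1)) / x\<^sup>2"
    proof (rule free_iter_minus_killed_iter_le[OF f])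
      fix k v assume k: "k < r" and v: "v < (0 :: real)"
      have "{s. v + s \<in> {x..x + \<Delta>}} = {x - v..x - v + \<Delta>}" by auto
      then have "(P ^^ k) ?f v = measure (walk_law M k) {x - v..x - v + \<Delta>}"
        by (simp add: free_iter_indicator)
      also have "\<dots> \<le> C * \<Delta> * sqrt (real (k + 1)) / (x - v)\<^sup>2" using far \<Delta> x v by simp
      also have "\<dots> \<le> C * \<Delta> * sqrt (real (r + 1)) / x\<^sup>2"
        using C \<Delta>' x v k by (intro frac_le mult_left_mono power_mono) auto
      finally show "(P ^^ k) ?f v \<le> C * \<Delta> * sqrt (real (r + 1)) / x\<^sup>2" .
    qed (use C \<Delta>' in simp)
    moreover have "(Q ^^ r) ?f u \<le> (P ^^ r) ?f u" by (rule killed_iter_le_free_iter[OF f]) simp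
    ultimately show ?thesis by simp
  qed
  with C show ?thesis by blast
qed

end

subsection \<open>The local limit theorem for the killed walk\<close>

text \<open>The fraction of steps is written \<open>e\<^sup>2\<close> so that the last stage has
  spatial scale \<open>e * sqrt n\<close>. The lower bound on \<open>n\<close> ensures that the
  floor loses at most half.\<close>

lemma floor_fraction_bounds:
  fixes e :: real and n :: nat
  assumes e: "0 < e" "e \<le> 1 / 2" and n: "2 / e\<^sup>2 \<le> real n" and r: "r = nat \<lfloor>e\<^sup>2 * real n\<rfloor>"
  shows "1 \<le> r" "e\<^sup>2 * real n / 2 \<le> real r" "real r \<le> e\<^sup>2 * real n" "real r \<le> real n / 2" "r \<le> n"
    "sqrt (real (r + 1)) \<le> 2 * (e * sqrt (real n))" "e * sqrt (real n) / 2 \<le> sqrt (real r)"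
    "sqrt (real r) \<le> e * sqrt (real n)"
proof -
  have 2: "2 \<le> e\<^sup>2 * real n" using n e by (simp add: pos_divide_le_eq mult.commute)
  have rr: "real r = of_int \<lfloor>e\<^sup>2 * real n\<rfloor>" unfolding r using 2 by simp
  show le: "real r \<le> e\<^sup>2 * real n" unfolding rr by (rule of_int_floor_le)
  have gt: "e\<^sup>2 * real n - 1 < real r" unfolding rr by linarith
  show half: "e\<^sup>2 * real n / 2 \<le> real r" using gt 2 by linarith
  show r1: "1 \<le> r" using half 2 by linarith
  have "e\<^sup>2 \<le> (1 / 2)\<^sup>2" using e by (intro power_mono) auto
  then have "e\<^sup>2 * real n \<le> 1 / 4 * real n" by (intro mult_right_mono) (auto simp: power2_eq_square)
  with le show r2: "real r \<le> real n / 2" by linarith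
  then show "r \<le> n" by linarith
  have en: "(e * sqrt (real n))\<^sup>2 = e\<^sup>2 * real n" by (simp add: power_mult_distrib)
  have e0: "0 \<le> e * sqrt (real n)" using e by simp
  show "sqrt (real (r + 1)) \<le> 2 * (e * sqrt (real n))"
  proof (rule real_le_lsqrt)
    have "real (r + 1) \<le> 4 * (e\<^sup>2 * real n)" using le 2 by simp
    then show "real (r + 1) \<le> (2 * (e * sqrt (real n)))\<^sup>2" by (simp only: power_mult_distrib[of 2] en) simp
  qed (use e0 in simp)
  show "e * sqrt (real n) / 2 \<le> sqrt (real r)"
    by (rule real_le_rsqrt) (use half 2 in \<open>simp add: power_divide en\<close>)
  show "sqrt (real r) \<le> e * sqrt (real n)"
    by (rule real_le_lsqrt) (use le e0 in \<open>simp_all add: en\<close>)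
qed

text \<open>Meant for \<open>x\<close> large against \<open>s\<close>: it shows that the image
  charge is negligible in the last stage.\<close>

lemma normal_density_le_inverse:
  assumes s: "0 < s" and x: "0 < x"
  shows "normal_density 0 s x \<le> s / x\<^sup>2"
proof -
  have "(x / s)\<^sup>2 * exp (- (x / s)\<^sup>2 / 2) \<le> 1" by (rule power_mult_gaussian_le(2))
  then have "exp (- (x / s)\<^sup>2 / 2) \<le> s\<^sup>2 / x\<^sup>2" using s x by (simp add: power_divide field_simps)
  then have "exp (- (x / s)\<^sup>2 / 2) / s \<le> s\<^sup>2 / x\<^sup>2 / s" using s by (intro divide_right_mono) auto
  also have "\<dots> = s / x\<^sup>2" using s by (simp add: power2_eq_square)
  finally show ?thesis using normal_density_le[of s x] s by linarith
qed

context nonlattice_law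
begin

text \<open>\<open>A\<close> is chosen before \<open>e\<close>, so that \<open>e\<close> can later
  be taken small against it. The tolerance of the local limit theorem is \<open>e\<^sup>2\<close>,
  because \<open>sqrt r\<close> is of order \<open>e * sqrt n\<close> and one power is lost. The cap
  \<open>e ^ 4 * sqrt n\<close> on the window makes the variation of the density across it small
  even at the scale \<open>e * sqrt n\<close>.\<close>

lemma last_stage_approx:
  assumes \<Delta>\<^sub>0: "0 < \<Delta>\<^sub>0" and \<eta>: "0 < \<eta>"
  shows "\<exists>A>0. \<forall>e. 0 < e \<longrightarrow> e \<le> 1 / 2 \<longrightarrow> (\<exists>N. \<forall>n\<ge>N. \<forall>x \<Delta> u.
    sqrt (real n) / \<eta> \<le> x \<longrightarrow> \<Delta>\<^sub>0 \<le> \<Delta> \<longrightarrow> \<Delta> \<le> e ^ 4 * sqrt (real n) \<longrightarrow> 0 \<le> u \<longrightarrow>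
    \<bar>(Q ^^ nat \<lfloor>e\<^sup>2 * real n\<rfloor>) (indicator {x..x + \<Delta>}) u
      - \<Delta> * dipole 0 (\<sigma> * sqrt (real (nat \<lfloor>e\<^sup>2 * real n\<rfloor>))) x u\<bar> \<le> A * e * \<Delta> / sqrt (real n))"
proof -
  obtain Ck where Ck: "0 < Ck" and kill: "\<forall>r. \<forall>\<Delta>\<ge>\<Delta>\<^sub>0. \<forall>x>0. \<forall>u.
    \<bar>(P ^^ r) (indicator {x..x + \<Delta>}) u - (Q ^^ r) (indicator {x..x + \<Delta>}) u\<bar> \<le> Ck * \<Delta> * sqrt (real (r + 1)) / x\<^sup>2"
    using killing_loss[OF \<Delta>\<^sub>0] by blast
  \<comment> \<open>The four terms are, in order, the costs of killing, of the local limit theorem,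
    of the variation of the density over the window, and of the image charge.\<close>
  define A where "A = 2 * Ck * \<eta>\<^sup>2 + 2 + 2 / \<sigma>\<^sup>2 + \<sigma> * \<eta>\<^sup>2"
  have A: "0 < A" using Ck sd_pos by (simp add: A_def add_pos_nonneg add_nonneg_pos)
  have "\<exists>N. \<forall>n\<ge>N. \<forall>x \<Delta> u.
    sqrt (real n) / \<eta> \<le> x \<longrightarrow> \<Delta>\<^sub>0 \<le> \<Delta> \<longrightarrow> \<Delta> \<le> e ^ 4 * sqrt (real n) \<longrightarrow> 0 \<le> u \<longrightarrow>
    \<bar>(Q ^^ nat \<lfloor>e\<^sup>2 * real n\<rfloor>) (indicator {x..x + \<Delta>}) u
      - \<Delta> * dipole 0 (\<sigma> * sqrt (real (nat \<lfloor>e\<^sup>2 * real n\<rfloor>))) x u\<bar> \<le> A * e * \<Delta> / sqrt (real n)"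
    if e: "0 < e" "e \<le> 1 / 2" for e
  proof -
    obtain R where R: "1 \<le> R" and ll: "\<forall>r\<ge>R. \<forall>\<Delta>\<ge>\<Delta>\<^sub>0. \<forall>a.
      \<bar>measure (walk_law M r) {a..a + \<Delta>} - measure (gaussian_walk r) {a..a + \<Delta>}\<bar> \<le> e\<^sup>2 * \<Delta> / sqrt (real r)"
      using local_limit[OF \<Delta>\<^sub>0, of "e\<^sup>2"] e by auto
    define N where "N = nat \<lceil>2 * real R / e\<^sup>2\<rceil>"
    have main: "\<bar>(Q ^^ nat \<lfloor>e\<^sup>2 * real n\<rfloor>) (indicator {x..x + \<Delta>}) u
      - \<Delta> * dipole 0 (\<sigma> * sqrt (real (nat \<lfloor>e\<^sup>2 * real n\<rfloor>))) x u\<bar> \<le> A * e * \<Delta> / sqrt (real n)"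
      if n: "N \<le> n" and x: "sqrt (real n) / \<eta> \<le> x" and \<Delta>: "\<Delta>\<^sub>0 \<le> \<Delta>" "\<Delta> \<le> e ^ 4 * sqrt (real n)" and u: "0 \<le> u"
      for n x \<Delta> u
    proof -
      have nR: "2 * real R / e\<^sup>2 \<le> real n" using n unfolding N_def by linarith
      have "2 / e\<^sup>2 \<le> 2 * real R / e\<^sup>2" using R e by (intro divide_right_mono) auto
      with nR have n2: "2 / e\<^sup>2 \<le> real n" by linarith
      have "0 < 2 / e\<^sup>2" using e by simp
      then have npos: "0 < real n" using n2 by linarith
      define r where "r = nat \<lfloor>e\<^sup>2 * real n\<rfloor>"
      note rb = floor_fraction_bounds[OF e n2 r_def]
      have "real R \<le> e\<^sup>2 * real n / 2" using nR e by (simp add: pos_divide_le_eq mult.commute)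
      then have rR: "R \<le> r" using rb(2) by linarith
      define S where "S = sqrt (real n)"
      have S: "0 < S" "S * S = real n" "S\<^sup>2 = real n" using npos by (simp_all add: S_def)
      have \<Delta>': "0 < \<Delta>" using \<Delta>(1) \<Delta>\<^sub>0 by simp
      have x0: "0 < x" using x S \<eta> unfolding S_def[symmetric] by (meson divide_pos_pos less_le_trans)
      have "S \<le> x * \<eta>" using x \<eta> unfolding S_def[symmetric] by (simp add: pos_divide_le_eq)
      then have "S\<^sup>2 \<le> (x * \<eta>)\<^sup>2" using S by (intro power_mono) auto
      then have "1 \<le> \<eta>\<^sup>2 * x\<^sup>2 / (S * S)"
        using S(1) by (simp add: pos_le_divide_eq power_mult_distrib mult.commute flip: power2_eq_square)
      then have x2: "1 / x\<^sup>2 \<le> \<eta>\<^sup>2 / (S * S)"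
        using x0 by (simp add: pos_divide_le_eq)
      define s where "s = \<sigma> * sqrt (real r)"
      have s: "0 < s" "s \<le> \<sigma> * (e * S)" "s\<^sup>2 = \<sigma>\<^sup>2 * real r"
        using sd_pos rb(1,8) by (auto simp: s_def S_def power_mult_distrib)
      let ?f = "indicator {x..x + \<Delta>} :: real \<Rightarrow> real"
      have "{t. u + t \<in> {x..x + \<Delta>}} = {x - u..x - u + \<Delta>}" by auto
      then have Pm: "(P ^^ r) ?f u = measure (walk_law M r) {x - u..x - u + \<Delta>}" by (simp add: free_iter_indicator)
      have T1: "\<bar>(P ^^ r) ?f u - (Q ^^ r) ?f u\<bar> \<le> (2 * Ck * \<eta>\<^sup>2) * (e * \<Delta> / S)"
      proof -
        have "\<bar>(P ^^ r) ?f u - (Q ^^ r) ?f u\<bar> \<le> (Ck * \<Delta> * sqrt (real (r + 1))) * (1 / x\<^sup>2)"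
          using kill \<Delta>(1) x0 by simp
        also have "\<dots> \<le> (Ck * \<Delta> * (2 * (e * S))) * (\<eta>\<^sup>2 / (S * S))"
          using rb(6) x2 Ck \<Delta>' e S by (intro mult_mono mult_left_mono) (auto simp: S_def)
        also have "\<dots> = (2 * Ck * \<eta>\<^sup>2) * (e * \<Delta> / S)" using S(1) by (simp add: field_simps)
        finally show ?thesis .
      qed
      have T2: "\<bar>(P ^^ r) ?f u - measure (gaussian_walk r) {x - u..x - u + \<Delta>}\<bar> \<le> 2 * (e * \<Delta> / S)"
      proof -
        have "\<bar>(P ^^ r) ?f u - measure (gaussian_walk r) {x - u..x - u + \<Delta>}\<bar> \<le> e\<^sup>2 * \<Delta> / sqrt (real r)"
          unfolding Pm using ll rR \<Delta>(1) by simp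
        also have "\<dots> \<le> e\<^sup>2 * \<Delta> / (e * S / 2)"
          using rb(1,7) e \<Delta>' S by (intro divide_left_mono) (auto simp: S_def)
        also have "\<dots> = 2 * (e * \<Delta> / S)" using e S by (simp add: power2_eq_square)
        finally show ?thesis .
      qed
      have T3: "\<bar>measure (gaussian_walk r) {x - u..x - u + \<Delta>} - \<Delta> * normal_density 0 s (x - u)\<bar> \<le> (2 / \<sigma>\<^sup>2) * (e * \<Delta> / S)"
      proof -
        have "\<bar>measure (gaussian_walk r) {x - u..x - u + \<Delta>} - \<Delta> * normal_density 0 s (x - u)\<bar> \<le> \<Delta>\<^sup>2 / s\<^sup>2"
          using gaussian_interval_approx[OF s(1), of \<Delta> "x - u"] \<Delta>' by (simp add: s_def)
        also have "\<dots> \<le> (\<Delta> * (e ^ 4 * S)) / (\<sigma>\<^sup>2 * (e\<^sup>2 * (S * S) / 2))"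
        proof (rule frac_le)
          show "\<Delta>\<^sup>2 \<le> \<Delta> * (e ^ 4 * S)" unfolding power2_eq_square using \<Delta> \<Delta>' by (intro mult_left_mono) (auto simp: S_def)
          show "\<sigma>\<^sup>2 * (e\<^sup>2 * (S * S) / 2) \<le> s\<^sup>2" unfolding s(3) using rb(2) by (intro mult_left_mono) (auto simp: S(2))
        qed (use e S npos sd_pos \<Delta>' in auto)
        also have "\<dots> = (2 / \<sigma>\<^sup>2) * (e\<^sup>2 * \<Delta> / S)"
          using e S(1) sd_pos by (simp add: field_simps power2_eq_square power4_eq_xxxx)
        also have "\<dots> \<le> (2 / \<sigma>\<^sup>2) * (e * \<Delta> / S)"
          using e \<Delta>' S by (intro mult_left_mono divide_right_mono mult_right_mono) (auto simp: power2_eq_square mult_left_le)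
        finally show ?thesis .
      qed
      have T4: "\<bar>\<Delta> * normal_density 0 s (u + x)\<bar> \<le> (\<sigma> * \<eta>\<^sup>2) * (e * \<Delta> / S)"
      proof -
        have "normal_density 0 s (u + x) \<le> s / (u + x)\<^sup>2" using s x0 u by (intro normal_density_le_inverse) auto
        also have "\<dots> \<le> s * (1 / x\<^sup>2)" using s x0 u by (auto intro!: divide_left_mono power_mono)
        also have "\<dots> \<le> (\<sigma> * (e * S)) * (\<eta>\<^sup>2 / (S * S))" using s x2 by (intro mult_mono) auto
        finally have "\<Delta> * normal_density 0 s (u + x) \<le> \<Delta> * ((\<sigma> * (e * S)) * (\<eta>\<^sup>2 / (S * S)))"
          using \<Delta>' by (intro mult_left_mono) auto
        also have "\<dots> = (\<sigma> * \<eta>\<^sup>2) * (e * \<Delta> / S)" using S(1) by (simp add: field_simps)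
        finally show ?thesis using \<Delta>' by simp
      qed
      have ev: "normal_density 0 s (x - u) = normal_density 0 s (u - x)"
        by (simp add: normal_density_def power2_commute)
      have "\<bar>(Q ^^ r) ?f u - \<Delta> * dipole 0 s x u\<bar> \<le> (2 * Ck * \<eta>\<^sup>2) * (e * \<Delta> / S) + 2 * (e * \<Delta> / S)
          + (2 / \<sigma>\<^sup>2) * (e * \<Delta> / S) + (\<sigma> * \<eta>\<^sup>2) * (e * \<Delta> / S)"
        using T1 T2 T3 T4 unfolding dipole_def gauss_0 ev right_diff_distrib by linarith
      also have "\<dots> = A * (e * \<Delta> / S)" by (simp only: A_def distrib_right)
      finally show ?thesis by (simp add: r_def s_def S_def)
    qed
    then show ?thesis by (intro exI[of _ N]) blast
  qed
  with A show ?thesis by blast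
qed

text \<open>The order of choices matters: \<epsilon> determines \<open>e\<close>, which controls the
  last stage and the linearisation of the kernel. With \<open>e\<close> fixed, large
  \<open>n\<close> removes the Taylor errors and large \<open>y\<close> the undershoot.\<close>

theorem killed_local_limit:
  assumes \<Delta>\<^sub>0: "0 < \<Delta>\<^sub>0" and \<eta>: "0 < \<eta>" and \<epsilon>: "0 < \<epsilon>"
  shows "\<exists>N Y \<kappa>. 0 < \<kappa> \<and> (\<forall>n\<ge>N. \<forall>x y \<Delta>. sqrt (real n) / \<eta> \<le> x \<longrightarrow> Y \<le> y \<longrightarrow> y \<le> \<kappa> * sqrt (real n) \<longrightarrow>
    \<Delta>\<^sub>0 \<le> \<Delta> \<longrightarrow> \<Delta> \<le> \<kappa> * sqrt (real n) \<longrightarrow>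
    \<bar>(Q ^^ n) (indicator {x..x + \<Delta>}) y
      - \<Delta> * (2 * x / (\<sigma>\<^sup>2 * real n) * normal_density 0 (\<sigma> * sqrt (real n)) x * y)\<bar> \<le> \<epsilon> * \<Delta> * y / real n)"
proof -
  obtain A where A: "0 < A" and last: "\<forall>e. 0 < e \<longrightarrow> e \<le> 1 / 2 \<longrightarrow> (\<exists>N. \<forall>n\<ge>N. \<forall>x \<Delta> u.
    sqrt (real n) / \<eta> \<le> x \<longrightarrow> \<Delta>\<^sub>0 \<le> \<Delta> \<longrightarrow> \<Delta> \<le> e ^ 4 * sqrt (real n) \<longrightarrow> 0 \<le> u \<longrightarrow>
    \<bar>(Q ^^ nat \<lfloor>e\<^sup>2 * real n\<rfloor>) (indicator {x..x + \<Delta>}) u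
      - \<Delta> * dipole 0 (\<sigma> * sqrt (real (nat \<lfloor>e\<^sup>2 * real n\<rfloor>))) x u\<bar> \<le> A * e * \<Delta> / sqrt (real n))"
    using last_stage_approx[OF \<Delta>\<^sub>0 \<eta>] by blast
  obtain Cs where Cs: "0 < Cs" and surv: "\<forall>k. \<forall>y\<ge>0. (Q ^^ k) (\<lambda>_. 1) y \<le> Cs * (1 + y) / sqrt (real (k + 1))"
    using survival_le by blast
  obtain Cd where Cd: "0 < Cd" and dip: "\<forall>n r x y. 1 \<le> r \<longrightarrow> r \<le> n \<longrightarrow> 0 \<le> y \<longrightarrow>
    \<bar>(Q ^^ (n - r)) (dipole 0 (\<sigma> * sqrt (real r)) x) y - dipole 0 (\<sigma> * sqrt (real n)) x y\<bar>
    \<le> Cd * ((1 + y) * sqrt (real n) * real r powr (- (3 + \<delta>) / 2) + (1 + y) powr (1 - \<delta>) / real r)"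
    using killed_dipole_approx by blast
  \<comment> \<open>The two errors proportional to \<open>e\<close>: last stage times survival
    probability, and the quadratic error of the linearised kernel.\<close>
  define B where "B = 4 * A * Cs + 4 / \<sigma> ^ 3"
  have B: "0 < B" using A Cs sd_pos by (simp add: B_def add_pos_pos)
  define e where "e = min (1 / 2) (\<epsilon> / (3 * B))"
  have e: "0 < e" "e \<le> 1 / 2" using \<epsilon> B unfolding e_def by (simp, intro min.cobounded1)
  have "e \<le> \<epsilon> / (3 * B)" unfolding e_def by (rule min.cobounded2)
  then have eB: "B * e \<le> \<epsilon> / 3" using B by (simp add: field_simps)
  obtain N1 where N1: "\<forall>n\<ge>N1. \<forall>x \<Delta> u.
    sqrt (real n) / \<eta> \<le> x \<longrightarrow> \<Delta>\<^sub>0 \<le> \<Delta> \<longrightarrow> \<Delta> \<le> e ^ 4 * sqrt (real n) \<longrightarrow> 0 \<le> u \<longrightarrow>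
    \<bar>(Q ^^ nat \<lfloor>e\<^sup>2 * real n\<rfloor>) (indicator {x..x + \<Delta>}) u
      - \<Delta> * dipole 0 (\<sigma> * sqrt (real (nat \<lfloor>e\<^sup>2 * real n\<rfloor>))) x u\<bar> \<le> A * e * \<Delta> / sqrt (real n)"
    using last e by blast
  \<comment> \<open>Coefficient of the Taylor error once \<open>r\<close> is bounded below by
    \<open>e\<^sup>2 * n / 2\<close> and \<open>1 + y\<close> above by \<open>2 * y\<close>.\<close>
  define F where "F = 2 * Cd * (e\<^sup>2 / 2) powr (- (3 + \<delta>) / 2)"
  have "(\<lambda>n. F * real n powr (- \<delta> / 2)) \<longlonglongrightarrow> F * 0"
    using \<delta>_pos by (intro tendsto_intros tendsto_neg_powr filterlim_real_sequentially) auto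
  then have "\<forall>\<^sub>F n in sequentially. F * real n powr (- \<delta> / 2) < \<epsilon> / 3"
    using \<epsilon> by (intro order_tendstoD(2)) auto
  then obtain N2 where N2: "\<forall>n\<ge>N2. F * real n powr (- \<delta> / 2) < \<epsilon> / 3"
    unfolding eventually_sequentially by blast
  \<comment> \<open>Coefficient of the undershoot error after the same substitutions. It is
    multiplied by \<open>y powr (- \<delta>)\<close>, and this is where the threshold for
    \<open>y\<close> comes from.\<close>
  define G where "G = 4 * Cd / e\<^sup>2"
  have G: "0 < G" using Cd e by (simp add: G_def)
  have "((\<lambda>y. G * y powr (- \<delta>)) \<longlongrightarrow> G * 0) at_top"
    using \<delta>_pos by (intro tendsto_intros tendsto_neg_powr filterlim_ident) auto
  then have "\<forall>\<^sub>F y in at_top. G * y powr (- \<delta>) < \<epsilon> / 3"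
    using \<epsilon> by (intro order_tendstoD(2)) auto
  then obtain Y0 where Y0: "\<forall>y\<ge>Y0. G * y powr (- \<delta>) < \<epsilon> / 3"
    unfolding eventually_at_top_linorder by blast
  \<comment> \<open>The power 4 is the window condition of the last stage; it also gives
    \<open>y \<le> e * sqrt n\<close> for the linearisation.\<close>
  define \<kappa> where "\<kappa> = e ^ 4"
  define N where "N = max (max N1 N2) (nat \<lceil>2 / e\<^sup>2\<rceil>)"
  have main: "\<bar>(Q ^^ n) (indicator {x..x + \<Delta>}) y
      - \<Delta> * (2 * x / (\<sigma>\<^sup>2 * real n) * normal_density 0 (\<sigma> * sqrt (real n)) x * y)\<bar> \<le> \<epsilon> * \<Delta> * y / real n"
    if n: "N \<le> n" and x: "sqrt (real n) / \<eta> \<le> x" and y: "max 1 Y0 \<le> y" "y \<le> \<kappa> * sqrt (real n)"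
      and \<Delta>: "\<Delta>\<^sub>0 \<le> \<Delta>" "\<Delta> \<le> \<kappa> * sqrt (real n)" for n x y \<Delta>
  proof -
    have n2: "2 / e\<^sup>2 \<le> real n" using n unfolding N_def by linarith
    have "0 < 2 / e\<^sup>2" using e by simp
    then have npos: "0 < real n" using n2 by linarith
    define r where "r = nat \<lfloor>e\<^sup>2 * real n\<rfloor>"
    note rb = floor_fraction_bounds[OF e n2 r_def]
    define m where "m = n - r"
    define S where "S = sqrt (real n)"
    have S: "0 < S" "S * S = real n" "S\<^sup>2 = real n" using npos by (simp_all add: S_def)
    have \<Delta>': "0 < \<Delta>" using \<Delta>(1) \<Delta>\<^sub>0 by simp
    have y1: "1 \<le> y" "Y0 \<le> y" "0 \<le> y" "1 + y \<le> 2 * y" using y by auto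
    let ?f = "indicator {x..x + \<Delta>} :: real \<Rightarrow> real"
    let ?d = "dipole 0 (\<sigma> * sqrt (real r)) x"
    have qf: "quad_growth ?f" by (rule quad_growth_indicator) simp
    have qd: "quad_growth ?d" using sd_pos by (intro quad_growth_dipole) auto
    define \<rho> where "\<rho> = A * e * \<Delta> / S"
    have \<rho>: "0 \<le> \<rho>" using A e \<Delta>' S by (simp add: \<rho>_def)
    have stage: "\<bar>(Q ^^ r) ?f u - \<Delta> * ?d u\<bar> \<le> \<rho> * 1" if "u \<in> {0..}" for u
      using N1 n x \<Delta> that by (simp add: N_def r_def \<rho>_def S_def \<kappa>_def)
    \<comment> \<open>The error of the last stage is uniform in position and is incurred only by
      paths that survive the first \<open>m\<close> steps, which supplies the factor
      \<open>y / sqrt n\<close>.\<close>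
    have U1: "\<bar>(Q ^^ n) ?f y - \<Delta> * (Q ^^ m) ?d y\<bar> \<le> (4 * A * Cs) * e * (\<Delta> * y / real n)"
    proof -
      have "(Q ^^ n) ?f = (Q ^^ m) ((Q ^^ r) ?f)"
        using rb(5) by (simp add: m_def flip: comp_apply[of "Q ^^ (n - r)"] funpow_add)
      moreover have "(Q ^^ m) (\<lambda>u. (Q ^^ r) ?f u - \<Delta> * ?d u) y = (Q ^^ m) ((Q ^^ r) ?f) y - (Q ^^ m) (\<lambda>u. \<Delta> * ?d u) y"
        by (rule iter_diff[OF quad_growth_iter[OF qf] quad_growth_cmult[OF qd]]) auto
      moreover have "(Q ^^ m) (\<lambda>u. \<Delta> * ?d u) y = \<Delta> * (Q ^^ m) ?d y" by (rule iter_cmult[OF qd]) simp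
      ultimately have "\<bar>(Q ^^ n) ?f y - \<Delta> * (Q ^^ m) ?d y\<bar> = \<bar>(Q ^^ m) (\<lambda>u. (Q ^^ r) ?f u - \<Delta> * ?d u) y\<bar>" by simp
      also have "\<dots> \<le> (Q ^^ m) (\<lambda>_. \<rho> * 1) y"
      proof (rule iter_abs_le[OF _ _ _ stage])
        show "quad_growth (\<lambda>u. (Q ^^ r) ?f u - \<Delta> * ?d u)"
          by (rule quad_growth_diff[OF quad_growth_iter[OF qf] quad_growth_cmult[OF qd]]) simp
      qed (use y1 in auto)
      also have "\<dots> = \<rho> * (Q ^^ m) (\<lambda>_. 1) y" by (rule iter_cmult) auto
      also have "\<dots> \<le> \<rho> * (4 * Cs * y / S)"
      proof (intro mult_left_mono \<rho>)
        have "S / 2 \<le> sqrt (real (m + 1))"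
        proof (rule real_le_rsqrt)
          have "real n / 4 \<le> real (m + 1)" using rb(4,5) by (simp add: m_def of_nat_diff)
          then show "(S / 2)\<^sup>2 \<le> real (m + 1)" by (simp add: power_divide S(3))
        qed
        then have "Cs * (1 + y) / sqrt (real (m + 1)) \<le> Cs * (2 * y) / (S / 2)"
          using Cs y1 S by (intro frac_le mult_left_mono) auto
        then show "(Q ^^ m) (\<lambda>_. 1) y \<le> 4 * Cs * y / S"
          using surv[rule_format, OF y1(3), of m] by simp
      qed
      also have "\<dots> = (4 * A * Cs) * e * (\<Delta> * y / real n)"
        unfolding S(2)[symmetric] using S(1) by (simp add: \<rho>_def)
      finally show ?thesis .
    qed
    have U2: "\<bar>\<Delta> * (Q ^^ m) ?d y - \<Delta> * dipole 0 (\<sigma> * S) x y\<bar> \<le> (\<epsilon> / 3 + \<epsilon> / 3) * (\<Delta> * y / real n)"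
    proof -
      have p1: "(1 + y) * S * real r powr (- (3 + \<delta>) / 2)
        \<le> (2 * y) * S * ((e\<^sup>2 / 2) powr (- (3 + \<delta>) / 2) * real n powr (- (3 + \<delta>) / 2))"
      proof (intro mult_mono)
        have "real r powr (- (3 + \<delta>) / 2) \<le> (e\<^sup>2 * real n / 2) powr (- (3 + \<delta>) / 2)"
          using rb(2) e npos \<delta>_pos by (intro powr_mono2') auto
        also have "e\<^sup>2 * real n / 2 = (e\<^sup>2 / 2) * real n" by simp
        also have "((e\<^sup>2 / 2) * real n) powr (- (3 + \<delta>) / 2)
            = (e\<^sup>2 / 2) powr (- (3 + \<delta>) / 2) * real n powr (- (3 + \<delta>) / 2)"
          by (rule powr_mult)
        finally show "real r powr (- (3 + \<delta>) / 2) \<le> (e\<^sup>2 / 2) powr (- (3 + \<delta>) / 2) * real n powr (- (3 + \<delta>) / 2)" .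
      qed (use y1 S in auto)
      have "S * real n powr (- (3 + \<delta>) / 2) = real n powr (1 / 2 + - (3 + \<delta>) / 2)"
        by (simp only: powr_add) (simp add: S_def powr_half_sqrt)
      also have "1 / 2 + - (3 + \<delta>) / 2 = - \<delta> / 2 + - 1" by (simp add: field_simps)
      also have "real n powr (- \<delta> / 2 + - 1) = real n powr (- \<delta> / 2) / real n"
        using npos by (simp only: powr_add) (simp add: powr_minus_divide)
      finally have Sn: "S * real n powr (- (3 + \<delta>) / 2) = real n powr (- \<delta> / 2) / real n" .
      have q1: "Cd * ((1 + y) * S * real r powr (- (3 + \<delta>) / 2)) \<le> \<epsilon> / 3 * (y / real n)"
      proof -
        have "Cd * ((1 + y) * S * real r powr (- (3 + \<delta>) / 2))
          \<le> Cd * ((2 * y) * S * ((e\<^sup>2 / 2) powr (- (3 + \<delta>) / 2) * real n powr (- (3 + \<delta>) / 2)))"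
          using Cd by (intro mult_left_mono p1) auto
        also have "\<dots> = 2 * Cd * (e\<^sup>2 / 2) powr (- (3 + \<delta>) / 2) * y * (S * real n powr (- (3 + \<delta>) / 2))"
          by (simp only: mult_ac)
        also have "\<dots> = (F * real n powr (- \<delta> / 2)) * (y / real n)" unfolding Sn F_def by simp
        also have "\<dots> \<le> \<epsilon> / 3 * (y / real n)"
          using N2[rule_format, of n] n y1 by (intro mult_right_mono) (auto simp: N_def)
        finally show ?thesis .
      qed
      have q2: "Cd * ((1 + y) powr (1 - \<delta>) / real r) \<le> \<epsilon> / 3 * (y / real n)"
      proof -
        have "(1 + y) powr (1 - \<delta>) \<le> (1 + y) * y powr (- \<delta>)"
        proof -
          have "(1 + y) powr (1 - \<delta>) = (1 + y) * (1 + y) powr (- \<delta>)"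
            using y1 powr_add[of "1 + y" 1 "- \<delta>"] by simp
          also have "\<dots> \<le> (1 + y) * y powr (- \<delta>)"
            using y1 \<delta>_pos by (intro mult_left_mono powr_mono2') auto
          finally show ?thesis .
        qed
        also have "\<dots> \<le> (2 * y) * y powr (- \<delta>)" using y1 by (intro mult_right_mono) auto
        finally have "Cd * ((1 + y) powr (1 - \<delta>) / real r) \<le> Cd * ((2 * y * y powr (- \<delta>)) / (e\<^sup>2 * real n / 2))"
          using rb(2) e npos Cd y1 by (intro mult_left_mono frac_le) auto
        also have "\<dots> = (G * y powr (- \<delta>)) * (y / real n)" by (simp add: G_def)
        also have "\<dots> \<le> \<epsilon> / 3 * (y / real n)"
          using Y0[rule_format, OF y1(2)] y1 by (intro mult_right_mono) auto
        finally show ?thesis .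
      qed
      have "\<bar>(Q ^^ m) ?d y - dipole 0 (\<sigma> * S) x y\<bar>
        \<le> Cd * ((1 + y) * S * real r powr (- (3 + \<delta>) / 2) + (1 + y) powr (1 - \<delta>) / real r)"
        using dip rb(1,5) y1(3) by (simp add: m_def S_def)
      also have "\<dots> \<le> \<epsilon> / 3 * (y / real n) + \<epsilon> / 3 * (y / real n)"
        unfolding distrib_left by (intro add_mono q1 q2)
      finally have le: "\<bar>(Q ^^ m) ?d y - dipole 0 (\<sigma> * S) x y\<bar> \<le> \<epsilon> / 3 * (y / real n) + \<epsilon> / 3 * (y / real n)" .
      have "\<bar>\<Delta> * (Q ^^ m) ?d y - \<Delta> * dipole 0 (\<sigma> * S) x y\<bar> = \<Delta> * \<bar>(Q ^^ m) ?d y - dipole 0 (\<sigma> * S) x y\<bar>"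
        using \<Delta>' by (simp add: abs_mult flip: right_diff_distrib)
      also have "\<dots> \<le> \<Delta> * (\<epsilon> / 3 * (y / real n) + \<epsilon> / 3 * (y / real n))"
        using le \<Delta>' by (intro mult_left_mono) auto
      finally show ?thesis by (simp add: algebra_simps)
    qed
    have U3: "\<bar>\<Delta> * dipole 0 (\<sigma> * S) x y - \<Delta> * (2 * x / (\<sigma>\<^sup>2 * real n) * normal_density 0 (\<sigma> * S) x * y)\<bar>
      \<le> (4 / \<sigma> ^ 3) * e * (\<Delta> * y / real n)"
    proof -
      have s: "0 < \<sigma> * S" using sd_pos S by simp
      have "\<bar>dipole 0 (\<sigma> * S) x y - 2 * x / (\<sigma>\<^sup>2 * real n) * normal_density 0 (\<sigma> * S) x * y\<bar> \<le> 4 / (\<sigma> * S) ^ 3 * y\<^sup>2"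
        using dipole_linear_approx[OF s, of x y] by (simp add: power_mult_distrib S(3))
      also have "\<dots> \<le> 4 / (\<sigma> * S) ^ 3 * (y * (e * S))"
      proof (rule mult_left_mono)
        have "e ^ 4 \<le> e ^ 1" using e by (intro power_decreasing) auto
        then have "\<kappa> * S \<le> e * S" using S by (intro mult_right_mono) (auto simp: \<kappa>_def)
        then have "y \<le> e * S" using y(2) by (simp add: S_def)
        then show "y\<^sup>2 \<le> y * (e * S)" unfolding power2_eq_square using y1 by (intro mult_left_mono) auto
      qed (use s in simp)
      also have "\<dots> = (4 / \<sigma> ^ 3) * e * (y / real n)"
        unfolding S(2)[symmetric] using S(1) sd_pos by (simp add: field_simps power3_eq_cube)
      finally have le: "\<bar>dipole 0 (\<sigma> * S) x y - 2 * x / (\<sigma>\<^sup>2 * real n) * normal_density 0 (\<sigma> * S) x * y\<bar>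
        \<le> (4 / \<sigma> ^ 3) * e * (y / real n)" .
      have "\<bar>\<Delta> * dipole 0 (\<sigma> * S) x y - \<Delta> * (2 * x / (\<sigma>\<^sup>2 * real n) * normal_density 0 (\<sigma> * S) x * y)\<bar>
          = \<Delta> * \<bar>dipole 0 (\<sigma> * S) x y - 2 * x / (\<sigma>\<^sup>2 * real n) * normal_density 0 (\<sigma> * S) x * y\<bar>"
        unfolding right_diff_distrib[symmetric] abs_mult using \<Delta>' by simp
      also have "\<dots> \<le> \<Delta> * ((4 / \<sigma> ^ 3) * e * (y / real n))" using le \<Delta>' by (intro mult_left_mono) auto
      finally show ?thesis by (simp add: mult_ac)
    qed
    have yn: "0 \<le> \<Delta> * y / real n" using \<Delta>' y1 by simp
    have "\<bar>(Q ^^ n) ?f y - \<Delta> * (2 * x / (\<sigma>\<^sup>2 * real n) * normal_density 0 (\<sigma> * S) x * y)\<bar>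
      \<le> (4 * A * Cs) * e * (\<Delta> * y / real n) + (\<epsilon> / 3 + \<epsilon> / 3) * (\<Delta> * y / real n) + (4 / \<sigma> ^ 3) * e * (\<Delta> * y / real n)"
      using U1 U2 U3 by linarith
    also have "\<dots> = (B * e + (\<epsilon> / 3 + \<epsilon> / 3)) * (\<Delta> * y / real n)"
      by (simp only: B_def distrib_right)
    also have "\<dots> \<le> \<epsilon> * (\<Delta> * y / real n)" using eB yn by (intro mult_right_mono) auto
    finally show ?thesis by (simp add: S_def)
  qed
  have "0 < \<kappa>" using e by (simp add: \<kappa>_def)
  show ?thesis
  proof (rule exI[of _ N], rule exI[of _ "max 1 Y0"], rule exI[of _ \<kappa>], intro conjI allI impI)
    fix n x y \<Delta>
    assume "N \<le> n" "sqrt (real n) / \<eta> \<le> x" "max 1 Y0 \<le> y" "y \<le> \<kappa> * sqrt (real n)" "\<Delta>\<^sub>0 \<le> \<Delta>" "\<Delta> \<le> \<kappa> * sqrt (real n)"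
    then show "\<bar>(Q ^^ n) (indicator {x..x + \<Delta>}) y
      - \<Delta> * (2 * x / (\<sigma>\<^sup>2 * real n) * normal_density 0 (\<sigma> * sqrt (real n)) x * y)\<bar> \<le> \<epsilon> * \<Delta> * y / real n"
      by (rule main)
  qed (fact \<open>0 < \<kappa>\<close>)
qed

end

subsection \<open>Path probabilities and time reversal\<close>

context prob_space
begin

text \<open>Serves to reverse the order of the steps. Injectivity lets events indexed by
  \<open>K\<close> be carried to its image through the inverse of \<open>g\<close>.\<close>

lemma indep_vars_reindex:
  assumes ind: "indep_vars M' X I" and inj: "inj_on g J" and sub: "g ` J \<subseteq> I"
  shows "indep_vars (\<lambda>j. M' (g j)) (\<lambda>j. X (g j)) J"
proof -
  define F where "F i = {X i -` A \<inter> space M |A. A \<in> sets (M' i)}" for i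
  have rv: "\<forall>i\<in>I. random_variable (M' i) (X i)" and isF: "indep_sets F I"
    using ind unfolding indep_vars_def2 F_def by auto
  have "indep_sets (\<lambda>j. F (g j)) J"
  proof (rule indep_setsI)
    show "F (g j) \<subseteq> events" if "j \<in> J" for j
      using isF sub that unfolding indep_sets_def by auto
    fix A K assume K: "K \<noteq> {}" "K \<subseteq> J" "finite K" and A: "\<forall>j\<in>K. A j \<in> F (g j)"
    define B where "B i = A (the_inv_into K g i)" for i
    have injK: "inj_on g K" using inj K(2) by (rule inj_on_subset)
    have B: "B (g j) = A j" if "j \<in> K" for j using that injK by (simp add: B_def the_inv_into_f_f)
    have "prob (\<Inter>i\<in>g ` K. B i) = (\<Prod>i\<in>g ` K. prob (B i))"
    proof (rule indep_setsD[OF isF])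
      show "g ` K \<subseteq> I" using K(2) sub by auto
      show "\<forall>j\<in>g ` K. B j \<in> F j" using A B by auto
    qed (use K in auto)
    moreover have "(\<Inter>i\<in>g ` K. B i) = (\<Inter>j\<in>K. A j)" using B by auto
    moreover have "(\<Prod>i\<in>g ` K. prob (B i)) = (\<Prod>j\<in>K. prob (A j))"
      using B by (simp add: prod.reindex[OF injK])
    ultimately show "prob (\<Inter>j\<in>K. A j) = (\<Prod>j\<in>K. prob (A j))" by simp
  qed
  with rv sub show ?thesis unfolding indep_vars_def2 F_def by auto
qed

text \<open>The last step is integrated out, which turns \<open>f\<close> into
  \<open>killed_step L {0..} f\<close> at the previous time; hence the induction is for arbitrary
  bounded \<open>f\<close>.\<close>

lemma killed_iter_eq_expectation:
  fixes Z :: "nat \<Rightarrow> 'a \<Rightarrow> real"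
  assumes ind: "indep_vars (\<lambda>_. borel) Z {1..n}"
    and law: "\<And>i. i \<in> {1..n} \<Longrightarrow> distr M borel (Z i) = L" and L: "real_distribution L"
    and f: "f \<in> borel_measurable borel" "\<And>u. \<bar>f u\<bar> \<le> C" and k: "k \<le> n"
  shows "expectation (\<lambda>\<omega>. indicator {\<omega>. \<forall>j\<in>{1..k}. 0 \<le> y + (\<Sum>i=1..j. Z i \<omega>)} \<omega> * f (y + (\<Sum>i=1..k. Z i \<omega>)))
    = (killed_step L {0..} ^^ k) f y"
  using f k
proof (induction k arbitrary: f)
  case 0
  then show ?case by (simp add: prob_space)
next
  case (Suc k)
  interpret L: real_distribution L by fact
  note [measurable] = Suc.prems(1)
  have k: "{1..k} \<subseteq> {1..n}" "Suc k \<in> {1..n}" "{Suc k} \<subseteq> {1..n}" "{1..k} \<inter> {Suc k} = {}" using Suc.prems by auto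
  have Z [measurable]: "random_variable borel (Z i)" if "i \<in> {1..n}" for i
    using ind that by (auto simp: indep_vars_def)
  let ?P = "PiM {1..k} (\<lambda>_. borel) :: (nat \<Rightarrow> real) measure"
  define V where "V \<omega> = restrict (\<lambda>i. Z i \<omega>) {1..k}" for \<omega>
  let ?P2 = "PiM {Suc k} (\<lambda>_. borel) :: (nat \<Rightarrow> real) measure"
  \<comment> \<open>A block with one index, since the independence rule speaks about restrictions to
    disjoint index sets.\<close>
  define V2 where "V2 \<omega> = restrict (\<lambda>i. Z i \<omega>) {Suc k}" for \<omega>
  have "indep_var ?P V ?P2 V2"
    unfolding V_def V2_def by (rule indep_var_restrict[OF ind k(4,1,3)])
  then have V [measurable]: "random_variable ?P V" and V2 [measurable]: "random_variable ?P2 V2"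
    and joint: "distr M ?P V \<Otimes>\<^sub>M distr M ?P2 V2 = distr M (?P \<Otimes>\<^sub>M ?P2) (\<lambda>\<omega>. (V \<omega>, V2 \<omega>))"
    unfolding indep_var_distribution_eq by auto
  have c2 [measurable]: "(\<lambda>w. w (Suc k)) \<in> borel_measurable ?P2" by (rule measurable_component_singleton) simp
  have V2Z: "V2 \<omega> (Suc k) = Z (Suc k) \<omega>" for \<omega> by (simp add: V2_def)
  define s :: "nat \<Rightarrow> (nat \<Rightarrow> real) \<Rightarrow> real" where "s j v = (\<Sum>i=1..j. v i)" for j v
  have s [measurable]: "s j \<in> borel_measurable ?P" if "j \<le> k" for j
    unfolding s_def[abs_def] by (intro borel_measurable_sum measurable_component_singleton) (use that in auto)
  have sV: "s j (V \<omega>) = (\<Sum>i=1..j. Z i \<omega>)" if "j \<le> k" for j \<omega>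
    unfolding s_def V_def by (intro sum.cong) (use that in auto)
  define h :: "(nat \<Rightarrow> real) \<Rightarrow> real" where "h v = indicator {v. \<forall>j\<in>{1..k}. 0 \<le> y + s j v} v" for v
  have h [measurable]: "h \<in> borel_measurable ?P"
  proof -
    have "{v \<in> space ?P. \<forall>j\<in>{1..k}. 0 \<le> y + s j v} \<in> sets ?P"
      by (intro sets.sets_Collect_finite_All borel_measurable_le borel_measurable_add borel_measurable_const s) auto
    then have "indicator {v \<in> space ?P. \<forall>j\<in>{1..k}. 0 \<le> y + s j v} \<in> borel_measurable ?P" by (rule borel_measurable_indicator)
    then show ?thesis
      by (rule measurable_cong[THEN iffD1, rotated]) (auto simp: h_def indicator_def)
  qed
  have h01: "\<bar>h v\<bar> \<le> 1" "0 \<le> h v" for v by (auto simp: h_def indicator_def)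
  define F where "F v z = h v * (indicator {0..} (y + s k v + z) * f (y + s k v + z))" for v z
  have F [measurable]: "case_prod F \<in> borel_measurable (?P \<Otimes>\<^sub>M borel)"
    unfolding F_def using s[of k] by measurable
  have C0: "0 \<le> C" using Suc.prems(2)[of 0] by simp
  have Fb: "\<bar>F v z\<bar> \<le> C" for v z
  proof -
    have "\<bar>F v z\<bar> = \<bar>h v\<bar> * (indicator {0..} (y + s k v + z) * \<bar>f (y + s k v + z)\<bar>)" by (simp add: F_def abs_mult)
    also have "\<dots> \<le> 1 * (1 * C)" using h01 Suc.prems(2) by (intro mult_mono) (auto simp: indicator_def)
    finally show ?thesis by simp
  qed
  interpret VP: prob_space "distr M ?P V" by (rule prob_space_distr[OF V])
  interpret V2P: prob_space "distr M ?P2 V2" by (rule prob_space_distr[OF V2])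
  interpret pair_prob_space "distr M ?P V" "distr M ?P2 V2" ..
  have F2 [measurable]: "(\<lambda>(v, w). F v (w (Suc k))) \<in> borel_measurable (?P \<Otimes>\<^sub>M ?P2)"
    by measurable
  have iF: "integrable (distr M ?P V \<Otimes>\<^sub>M distr M ?P2 V2) (\<lambda>(v, w). F v (w (Suc k)))"
  proof (rule P.integrable_const_bound[of _ C])
    show "AE x in distr M ?P V \<Otimes>\<^sub>M distr M ?P2 V2. norm ((\<lambda>(v, w). F v (w (Suc k))) x) \<le> C"
      using Fb by (auto simp: case_prod_beta)
    have "sets (distr M ?P V \<Otimes>\<^sub>M distr M ?P2 V2) = sets (?P \<Otimes>\<^sub>M ?P2)" by (intro sets_pair_measure_cong) auto
    then show "(\<lambda>(v, w). F v (w (Suc k))) \<in> borel_measurable (distr M ?P V \<Otimes>\<^sub>M distr M ?P2 V2)"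
      using F2 measurable_cong_sets by blast
  qed
  have inner: "(\<integral>w. F v (w (Suc k)) \<partial>distr M ?P2 V2) = (\<integral>z. F v z \<partial>L)" if v: "v \<in> space ?P" for v
  proof -
    have [measurable]: "F v \<in> borel_measurable borel" using measurable_Pair2[OF F v] by simp
    have "(\<integral>w. F v (w (Suc k)) \<partial>distr M ?P2 V2) = integral\<^sup>L M (\<lambda>\<omega>. F v (Z (Suc k) \<omega>))"
      by (subst integral_distr) (auto simp: V2Z)
    also have "\<dots> = (\<integral>z. F v z \<partial>L)"
      unfolding law[OF k(2), symmetric] using Z[OF k(2)] by (subst integral_distr) auto
    finally show ?thesis .
  qed
  have bd: "\<bar>killed_step L {0..} f u\<bar> \<le> C" for u
  proof -
    have "\<bar>killed_step L {0..} f u\<bar> \<le> (\<integral>x. C \<partial>L)"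
      unfolding killed_step_def
    proof (rule order_trans[OF integral_abs_bound], rule integral_mono')
      show "\<bar>indicator {0..} (u + x) * f (u + x)\<bar> \<le> C" for x
        using Suc.prems(2)[of "u + x"] C0 by (auto simp: indicator_def)
    qed (use C0 in auto)
    then show ?thesis using L.prob_space by (simp add: L.space_eq_univ)
  qed
  have meas: "killed_step L {0..} f \<in> borel_measurable borel"
    unfolding killed_step_def by measurable
  have "integral\<^sup>L M (\<lambda>\<omega>. indicator {\<omega>. \<forall>j\<in>{1..Suc k}. 0 \<le> y + (\<Sum>i=1..j. Z i \<omega>)} \<omega> * f (y + (\<Sum>i=1..Suc k. Z i \<omega>)))
      = integral\<^sup>L M (\<lambda>\<omega>. (\<lambda>(v, w). F v (w (Suc k))) (V \<omega>, V2 \<omega>))"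
  proof (rule Bochner_Integration.integral_cong[OF refl])
    fix \<omega>
    have "(\<forall>j\<in>{1..Suc k}. 0 \<le> y + (\<Sum>i=1..j. Z i \<omega>)) \<longleftrightarrow>
      (\<forall>j\<in>{1..k}. 0 \<le> y + s j (V \<omega>)) \<and> 0 \<le> y + s k (V \<omega>) + Z (Suc k) \<omega>"
      by (auto simp: sV atLeastAtMostSuc_conv add.assoc)
    then show "indicator {\<omega>. \<forall>j\<in>{1..Suc k}. 0 \<le> y + (\<Sum>i=1..j. Z i \<omega>)} \<omega> * f (y + (\<Sum>i=1..Suc k. Z i \<omega>))
      = (\<lambda>(v, w). F v (w (Suc k))) (V \<omega>, V2 \<omega>)"
      by (simp add: F_def h_def indicator_def sV add.assoc V2Z)
  qed
  also have "\<dots> = integral\<^sup>L (distr M (?P \<Otimes>\<^sub>M ?P2) (\<lambda>\<omega>. (V \<omega>, V2 \<omega>))) (\<lambda>(v, w). F v (w (Suc k)))"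
    by (rule integral_distr[symmetric, OF measurable_Pair[OF V V2] F2])
  also have "\<dots> = (\<integral>v. (\<integral>w. F v (w (Suc k)) \<partial>distr M ?P2 V2) \<partial>distr M ?P V)"
    unfolding joint[symmetric] by (rule integral_fst[symmetric, OF iF])
  also have "\<dots> = (\<integral>v. (\<integral>z. F v z \<partial>L) \<partial>distr M ?P V)"
    by (rule Bochner_Integration.integral_cong[OF refl inner]) simp
  also have "\<dots> = (\<integral>v. h v * killed_step L {0..} f (y + s k v) \<partial>distr M ?P V)"
    by (simp add: F_def killed_step_def add.assoc)
  also have "\<dots> = integral\<^sup>L M (\<lambda>\<omega>. h (V \<omega>) * killed_step L {0..} f (y + s k (V \<omega>)))"
  proof (rule integral_distr[OF V])
    note [measurable] = meas s[OF order_refl]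
    show "(\<lambda>v. h v * killed_step L {0..} f (y + s k v)) \<in> borel_measurable ?P" by measurable
  qed
  also have "\<dots> = integral\<^sup>L M (\<lambda>\<omega>. indicator {\<omega>. \<forall>j\<in>{1..k}. 0 \<le> y + (\<Sum>i=1..j. Z i \<omega>)} \<omega> * killed_step L {0..} f (y + (\<Sum>i=1..k. Z i \<omega>)))"
    by (intro Bochner_Integration.integral_cong refl) (auto simp: h_def indicator_def sV)
  also have "\<dots> = (killed_step L {0..} ^^ k) (killed_step L {0..} f) y"
    using Suc.prems(3) by (intro Suc.IH meas bd) auto
  finally show ?case by (simp add: funpow_swap1)
qed

lemma killed_iter_eq_prob:
  fixes Z :: "nat \<Rightarrow> 'a \<Rightarrow> real"
  assumes ind: "indep_vars (\<lambda>_. borel) Z {1..n}"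
    and law: "\<And>i. i \<in> {1..n} \<Longrightarrow> distr M borel (Z i) = L" and L: "real_distribution L" and J: "J \<in> sets borel"
  shows "prob {\<omega> \<in> space M. (\<forall>j\<in>{1..n}. 0 \<le> y + (\<Sum>i=1..j. Z i \<omega>)) \<and> y + (\<Sum>i=1..n. Z i \<omega>) \<in> J}
    = (killed_step L {0..} ^^ n) (indicator J) y" (is "prob ?E = _")
proof -
  have "(killed_step L {0..} ^^ n) (indicator J) y
    = expectation (\<lambda>\<omega>. indicator {\<omega>. \<forall>j\<in>{1..n}. 0 \<le> y + (\<Sum>i=1..j. Z i \<omega>)} \<omega> * indicator J (y + (\<Sum>i=1..n. Z i \<omega>)))"
    using killed_iter_eq_expectation[OF ind law L, of "indicator J" 1 n y] J by (simp add: indicator_def)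
  also have "\<dots> = expectation (indicator ?E)"
    by (intro Bochner_Integration.integral_cong refl) (auto simp: indicator_def)
  also have "\<dots> = prob (?E \<inter> space M)" by simp
  also have "?E \<inter> space M = ?E" by auto
  finally show ?thesis ..
qed

end

section \<open>From the hypotheses on the steps to the law of the reversed steps\<close>

context prob_space
begin

text \<open>If the modulus is one, with argument \<theta>, then
  \<open>cos (t * x - \<theta>)\<close> has mean one and so equals one almost surely. Thus
  \<open>t * x - \<theta>\<close> is almost surely a multiple of \<open>2 * pi\<close>, and
  \<open>X\<close> lives on a lattice.\<close>

lemma non_lattice_char_less_1:
  assumes X [measurable]: "random_variable borel X" and nl: "non_lattice M X" and t: "t \<noteq> 0"
  shows "cmod (char (distr M borel (\<lambda>\<omega>. - X \<omega>)) t) < 1"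
proof (rule ccontr)
  let ?L = "distr M borel (\<lambda>\<omega>. - X \<omega>)"
  interpret L: real_distribution ?L by (rule real_distribution_distr) measurable
  assume "\<not> cmod (char ?L t) < 1"
  then have n1: "cmod (char ?L t) = 1" using L.cmod_char_le_1[of t] by linarith
  define \<theta> where "\<theta> = Arg (char ?L t)"
  have "char ?L t \<noteq> 0" using n1 by (metis norm_zero zero_neq_one)
  then have ch: "char ?L t = iexp \<theta>" using Arg_eq[of "char ?L t"] n1 by (simp add: \<theta>_def)
  have int: "integrable ?L (\<lambda>x. iexp (t * x))" by (rule L.integrable_iexp) auto
  have icos: "integrable ?L (\<lambda>x. 1 - cos (t * x - \<theta>))"
    by (rule L.integrable_const_bound[of _ 2]) (auto simp: abs_le_iff intro: order_trans[OF _ cos_ge_minus_one] order_trans[OF cos_le_one])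
  have cosE: "cos (t * x - \<theta>) = Re (iexp (- \<theta>) * iexp (t * x))" for x
  proof -
    have "iexp (- \<theta>) * iexp (t * x) = iexp (t * x - \<theta>)" by (simp add: algebra_simps flip: exp_add)
    then show ?thesis by (simp only: cis_conv_exp[symmetric]) simp
  qed
  have "(\<integral>x. cos (t * x - \<theta>) \<partial>?L) = Re (\<integral>x. iexp (- \<theta>) * iexp (t * x) \<partial>?L)"
    unfolding cosE using int by (intro integral_Re) auto
  also have "\<dots> = Re (iexp (- \<theta>) * char ?L t)" using int by (simp add: char_def)
  also have "\<dots> = 1" unfolding ch by (simp flip: exp_add)
  finally have "(\<integral>x. 1 - cos (t * x - \<theta>) \<partial>?L) = 0"
    using L.prob_space L.integrable_const_bound[of "\<lambda>x. cos (t * x - \<theta>)" 1]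
    by (subst Bochner_Integration.integral_diff) (auto simp: L.prob_space)
  then have "AE x in ?L. 1 - cos (t * x - \<theta>) = 0"
    using icos by (subst (asm) integral_nonneg_eq_0_iff_AE) auto
  then have ae: "AE \<omega> in M. cos (t * (- X \<omega>) - \<theta>) = 1"
    by (subst (asm) AE_distr_iff) auto
  \<comment> \<open>The lattice has span \<open>2 * pi / \<bar>t\<bar>\<close> and contains
    \<open>c\<close>; \<open>a\<close> is \<open>c\<close> reduced modulo \<open>h\<close> into the
    range required by the definition.\<close>
  define h where "h = 2 * pi / \<bar>t\<bar>"
  define c where "c = - \<theta> / t"
  define a where "a = c - h * of_int \<lfloor>c / h\<rfloor>"
  have h: "0 < h" using t by (simp add: h_def)
  have a: "a \<in> {0..<h}"
  proof -
    have "h * of_int \<lfloor>c / h\<rfloor> \<le> h * (c / h)"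
      using h by (intro mult_left_mono of_int_floor_le) auto
    moreover have "h * (c / h) < h * (of_int \<lfloor>c / h\<rfloor> + 1)"
      using h by (intro mult_strict_left_mono) linarith+
    moreover have "h * (c / h) = c" using h by simp
    ultimately have "h * of_int \<lfloor>c / h\<rfloor> \<le> c" "c < h * (of_int \<lfloor>c / h\<rfloor> + 1)" by simp_all
    then show ?thesis by (simp add: a_def algebra_simps)
  qed
  let ?C = "{h * of_int k + a |k::int. True}"
  have C: "?C \<in> sets borel"
  proof (rule sets.countable)
    have "?C = range (\<lambda>k::int. h * of_int k + a)" by auto
    then show "countable ?C" by simp
  qed auto
  have "AE \<omega> in M. X \<omega> \<in> ?C"
    using ae
  proof eventually_elim
    case (elim \<omega>)
    then obtain k :: int where k: "t * (- X \<omega>) - \<theta> = of_int k * 2 * pi" by (auto simp: cos_one_2pi_int)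
    then have "t * X \<omega> = - \<theta> - of_int k * 2 * pi" by simp
    then have "X \<omega> = (- \<theta> - of_int k * 2 * pi) / t" using t by (simp add: nonzero_eq_divide_eq mult.commute)
    then have X1: "X \<omega> = c - of_int k * (2 * pi / t)" by (simp add: c_def diff_divide_distrib)
    have "\<exists>j::int. X \<omega> = h * of_int j + c"
    proof (cases "0 < t")
      case True
      then have "X \<omega> = h * of_int (- k) + c" using X1 by (simp add: h_def)
      then show ?thesis by blast
    next
      case False
      then have "X \<omega> = h * of_int k + c" using X1 t by (simp add: h_def)
      then show ?thesis by blast
    qed
    then obtain j :: int where "X \<omega> = h * of_int j + c" by blast
    then have "X \<omega> = h * of_int (j + \<lfloor>c / h\<rfloor>) + a" by (simp add: a_def algebra_simps)
    then show "X \<omega> \<in> ?C" by blast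
  qed
  moreover have ev: "{\<omega> \<in> space M. X \<omega> \<in> ?C} \<in> events"
    using measurable_sets[OF X C] by (simp add: vimage_def Int_def conj_commute)
  ultimately have "prob {\<omega> \<in> space M. X \<omega> \<in> ?C} = 1"
    by (subst prob_eq_1[OF ev]) (auto elim: eventually_mono)
  then show False using nl h a unfolding non_lattice_def by blast
qed

text \<open>The reversed walk has steps \<open>- X\<close>. The exponent is cut at 1/2, and the
  smaller moment is bounded by one plus the given one.\<close>

lemma nonlattice_law_uminus:
  assumes X: "random_variable borel X" and "integrable M X" "expectation X = 0"
    and "integrable M (\<lambda>\<omega>. (X \<omega>)\<^sup>2)" "expectation (\<lambda>\<omega>. (X \<omega>)\<^sup>2) = \<sigma>\<^sup>2" and \<sigma>: "0 < \<sigma>"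
    and nl: "non_lattice M X" and \<delta>: "0 < \<delta>" and mom: "integrable M (\<lambda>\<omega>. \<bar>X \<omega>\<bar> powr (2 + \<delta>))"
  shows "nonlattice_law (distr M borel (\<lambda>\<omega>. - X \<omega>)) \<sigma> (min \<delta> (1 / 2))"
proof -
  note [measurable] = X
  let ?L = "distr M borel (\<lambda>\<omega>. - X \<omega>)"
  interpret L: real_distribution ?L by (rule real_distribution_distr) measurable
  show ?thesis
  proof unfold_locales
    show "integrable ?L (\<lambda>x. x\<^sup>2)" using assms(4) by (subst integrable_distr_eq) auto
    show "(\<integral>x. x \<partial>?L) = 0" using assms(2,3) by (subst integral_distr) auto
    show "(\<integral>x. x\<^sup>2 \<partial>?L) = \<sigma>\<^sup>2" using assms(5) by (subst integral_distr) auto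
    show "0 < min \<delta> (1 / 2)" using \<delta> by simp
    show "min \<delta> (1 / 2) \<le> 1 / 2" by (rule min.cobounded2)
    have "integrable M (\<lambda>\<omega>. \<bar>X \<omega>\<bar> powr (2 + min \<delta> (1 / 2)))"
    proof (rule Bochner_Integration.integrable_bound)
      show "integrable M (\<lambda>\<omega>. 1 + \<bar>X \<omega>\<bar> powr (2 + \<delta>))" using mom by simp
      have "\<bar>x\<bar> powr (2 + min \<delta> (1 / 2)) \<le> 1 + \<bar>x\<bar> powr (2 + \<delta>)" for x :: real
      proof (cases "\<bar>x\<bar> \<le> 1")
        case True
        then have "\<bar>x\<bar> powr (2 + min \<delta> (1 / 2)) \<le> 1" using \<delta> by (intro powr_le1) auto
        then show ?thesis by (simp add: add_increasing2)
      next
        case False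
        then have "\<bar>x\<bar> powr (2 + min \<delta> (1 / 2)) \<le> \<bar>x\<bar> powr (2 + \<delta>)" by (intro powr_mono) auto
        then show ?thesis by simp
      qed
      then show "AE \<omega> in M. norm (\<bar>X \<omega>\<bar> powr (2 + min \<delta> (1 / 2))) \<le> norm (1 + \<bar>X \<omega>\<bar> powr (2 + \<delta>))"
        by (intro AE_I2) (simp add: abs_of_nonneg add_nonneg_nonneg)
    qed measurable
    then show "integrable ?L (\<lambda>x. \<bar>x\<bar> powr (2 + min \<delta> (1 / 2)))" by (subst integrable_distr_eq) auto
    show "cmod (char ?L t) < 1" if "t \<noteq> 0" for t by (rule non_lattice_char_less_1[OF X nl that])
  qed (fact \<sigma>)
qed

end

lemma exit_time_greater_iff: "enat n < exit_time X x \<omega> \<longleftrightarrow> (\<forall>k\<in>{1..n}. 0 \<le> x + walk X k \<omega>)"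
proof
  assume n: "enat n < exit_time X x \<omega>"
  show "\<forall>k\<in>{1..n}. 0 \<le> x + walk X k \<omega>"
  proof (rule ballI, rule ccontr)
    fix k assume k: "k \<in> {1..n}" "\<not> 0 \<le> x + walk X k \<omega>"
    then have "exit_time X x \<omega> \<le> enat k" unfolding exit_time_def by (intro Inf_lower) auto
    also have "\<dots> \<le> enat n" using k by simp
    finally show False using n by simp
  qed
next
  assume a: "\<forall>k\<in>{1..n}. 0 \<le> x + walk X k \<omega>"
  \<comment> \<open>The lower bound on all members also covers the empty set, whose infimum is
    infinity.\<close>
  have "enat (Suc n) \<le> exit_time X x \<omega>"
    unfolding exit_time_def
  proof (rule Inf_greatest)
    fix z assume "z \<in> {enat k |k. 1 \<le> k \<and> x + walk X k \<omega> < 0}"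
    then obtain k where k: "z = enat k" "1 \<le> k" "x + walk X k \<omega> < 0" by blast
    have "\<not> k \<le> n" using a k by force
    then show "enat (Suc n) \<le> z" using k by simp
  qed
  then show "enat n < exit_time X x \<omega>" by (meson enat_ord_simps(2) lessI less_le_trans)
qed

lemma reversed_walk:
  "j \<le> n \<Longrightarrow> (\<Sum>i=1..j. - X (n + 1 - i) \<omega>) = walk X (n - j) \<omega> - walk X n \<omega>"
proof (induction j)
  case (Suc j)
  have "walk X (n - j) \<omega> = walk X (n - Suc j) \<omega> + X (n - j) \<omega>"
    using Suc.prems by (simp add: walk_def Suc_diff_Suc[symmetric])
  moreover have "n + 1 - Suc j = n - j" by simp
  ultimately show ?case using Suc by simp
qed simp

text \<open>The reversed walk starts at the unknown end point in \<open>[y, y + \<Delta>]\<close>; moving its start to \<open>y\<close> or to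
  \<open>y + \<Delta>\<close> makes survival harder or easier.\<close>

lemma (in prob_space) reversal_bounds:
  fixes X :: "nat \<Rightarrow> 'a \<Rightarrow> real" and n :: nat
  assumes ind: "indep_vars (\<lambda>_. borel) X {1..}"
    and law: "\<And>i. 1 \<le> i \<Longrightarrow> distr M borel (X i) = distr M borel (X 1)"
    and x: "0 \<le> x" and y: "0 \<le> y" and \<Delta>: "0 \<le> \<Delta>"
  defines "L \<equiv> distr M borel (\<lambda>\<omega>. - X 1 \<omega>)"
    and "p \<equiv> prob {\<omega> \<in> space M. x + walk X n \<omega> \<in> {y..y + \<Delta>} \<and> exit_time X x \<omega> > enat n}"
  shows "(killed_step L {0..} ^^ n) (indicator {x - \<Delta>..x - \<Delta> + \<Delta>}) y \<le> p"
    and "p \<le> (killed_step L {0..} ^^ n) (indicator {x..x + \<Delta>}) (y + \<Delta>)"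
proof -
  have X [measurable]: "random_variable borel (X i)" if "1 \<le> i" for i
    using ind that by (auto simp: indep_vars_def)
  define Z where "Z i \<omega> = - X (n + 1 - i) \<omega>" for i \<omega>
  have "indep_vars (\<lambda>_. borel) (\<lambda>i. X (n + 1 - i)) {1..n}"
    by (rule indep_vars_reindex[OF ind]) (auto simp: inj_on_def)
  then have Zind: "indep_vars (\<lambda>_. borel) Z {1..n}"
    unfolding Z_def by (rule indep_vars_compose2) auto
  have L: "real_distribution L" unfolding L_def by (rule real_distribution_distr) measurable
  have Zlaw: "distr M borel (Z i) = L" if "i \<in> {1..n}" for i
  proof -
    have i: "1 \<le> n + 1 - i" using that by auto
    have "distr M borel (Z i) = distr (distr M borel (X (n + 1 - i))) borel uminus"
      unfolding Z_def using X[OF i] by (subst distr_distr) (auto simp: comp_def)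
    also have "\<dots> = distr (distr M borel (X 1)) borel uminus" by (simp only: law[OF i])
    also have "\<dots> = L" unfolding L_def by (subst distr_distr) (auto simp: comp_def)
    finally show ?thesis .
  qed
  have U: "(\<Sum>i=1..j. Z i \<omega>) = walk X (n - j) \<omega> - walk X n \<omega>" if "j \<le> n" for j \<omega>
    unfolding Z_def by (rule reversed_walk[OF that])
  have W [measurable]: "walk X k \<in> borel_measurable M" for k
    unfolding walk_def[abs_def] by (intro borel_measurable_sum X) auto
  define E where "E = {\<omega> \<in> space M. x + walk X n \<omega> \<in> {y..y + \<Delta>} \<and> exit_time X x \<omega> > enat n}"
  \<comment> \<open>A walk started at \<open>y\<close> instead of the true end point ends at
    \<open>x\<close> shifted down by at most \<Delta>; one started at \<open>y + \<Delta>\<close>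
    ends at \<open>x\<close> shifted up by at most \<Delta>. Both windows have the form
    \<open>{v..v + \<Delta>}\<close> of the local limit theorem.\<close>
  define E0 where "E0 = {\<omega> \<in> space M. (\<forall>j\<in>{1..n}. 0 \<le> y + (\<Sum>i=1..j. Z i \<omega>)) \<and> y + (\<Sum>i=1..n. Z i \<omega>) \<in> {x - \<Delta>..x - \<Delta> + \<Delta>}}"
  define E1 where "E1 = {\<omega> \<in> space M. (\<forall>j\<in>{1..n}. 0 \<le> (y + \<Delta>) + (\<Sum>i=1..j. Z i \<omega>)) \<and> (y + \<Delta>) + (\<Sum>i=1..n. Z i \<omega>) \<in> {x..x + \<Delta>}}"
  have w0: "walk X 0 \<omega> = 0" for \<omega> by (simp add: walk_def)
  have E: "E \<in> events" unfolding E_def exit_time_greater_iff by measurable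
  have [measurable]: "random_variable borel (Z i)" if "i \<in> {1..n}" for i
    using Zind that by (auto simp: indep_vars_def)
  have ZS [measurable]: "(\<lambda>\<omega>. \<Sum>i=1..j. Z i \<omega>) \<in> borel_measurable M" if "j \<le> n" for j
  proof -
    have "(\<lambda>\<omega>. \<Sum>i=1..j. Z i \<omega>) = (\<lambda>\<omega>. walk X (n - j) \<omega> - walk X n \<omega>)" using U[OF that] by (intro ext)
    then show ?thesis by simp
  qed
  have "E1 = {\<omega> \<in> space M. (\<forall>j\<in>{1..n}. 0 \<le> (y + \<Delta>) + (walk X (n - j) \<omega> - walk X n \<omega>)) \<and> (y + \<Delta>) + (walk X (n - n) \<omega> - walk X n \<omega>) \<in> {x..x + \<Delta>}}"
    unfolding E1_def using U by (intro Collect_cong) auto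
  also have "\<dots> \<in> events" by measurable
  finally have E1: "E1 \<in> events" .
  have "E0 \<subseteq> E"
  proof
    fix \<omega> assume "\<omega> \<in> E0"
    then have \<omega>: "\<omega> \<in> space M" and pos: "\<forall>j\<in>{1..n}. 0 \<le> y + (walk X (n - j) \<omega> - walk X n \<omega>)"
      and e: "y + (walk X 0 \<omega> - walk X n \<omega>) \<in> {x - \<Delta>..x}"
      using U unfolding E0_def by auto
    have fin: "x + walk X n \<omega> \<in> {y..y + \<Delta>}" using e by (auto simp: w0)
    have "0 \<le> x + walk X k \<omega>" if "k \<in> {1..n}" for k
    \<comment> \<open>Time \<open>n\<close> of the walk is time 0 of the reversed walk, which is not
      tested; there the end window and \<open>y \<ge> 0\<close> suffice.\<close>
    proof (cases "k = n")
      case True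
      then show ?thesis using fin y by auto
    next
      case False
      then have "n - k \<in> {1..n}" "n - (n - k) = k" using that by auto
      with pos have "0 \<le> y + (walk X k \<omega> - walk X n \<omega>)" by metis
      then show ?thesis using fin by auto
    qed
    with \<omega> fin show "\<omega> \<in> E" unfolding E_def exit_time_greater_iff by auto
  qed
  then have "prob E0 \<le> prob E" using E by (rule finite_measure_mono)
  moreover have "prob E0 = (killed_step L {0..} ^^ n) (indicator {x - \<Delta>..x - \<Delta> + \<Delta>}) y"
    unfolding E0_def by (rule killed_iter_eq_prob[OF Zind Zlaw L]) auto
  ultimately show "(killed_step L {0..} ^^ n) (indicator {x - \<Delta>..x - \<Delta> + \<Delta>}) y \<le> p"
    unfolding p_def E_def by simp
  have "E \<subseteq> E1"
  proof
    fix \<omega> assume "\<omega> \<in> E"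
    then have \<omega>: "\<omega> \<in> space M" and fin: "x + walk X n \<omega> \<in> {y..y + \<Delta>}"
      and pos: "\<forall>k\<in>{1..n}. 0 \<le> x + walk X k \<omega>"
      unfolding E_def exit_time_greater_iff by auto
    have "0 \<le> (y + \<Delta>) + (\<Sum>i=1..j. Z i \<omega>)" if "j \<in> {1..n}" for j
    proof -
      have "0 \<le> x + walk X (n - j) \<omega>"
      \<comment> \<open>Conversely, time \<open>n\<close> of the reversed walk is time 0 of the
        walk, where nonnegativity is that of the start \<open>x\<close>.\<close>
      proof (cases "j = n")
        case False
        then have "n - j \<in> {1..n}" using that by auto
        then show ?thesis using pos by blast
      qed (use x w0 in simp)
      then show ?thesis using U[of j \<omega>] that fin by auto
    qed
    moreover have "(y + \<Delta>) + (\<Sum>i=1..n. Z i \<omega>) \<in> {x..x + \<Delta>}"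
      using U[of n \<omega>] fin w0[of \<omega>] by auto
    ultimately show "\<omega> \<in> E1" using \<omega> unfolding E1_def by blast
  qed
  then have "prob E \<le> prob E1" using E1 by (rule finite_measure_mono)
  moreover have "prob E1 = (killed_step L {0..} ^^ n) (indicator {x..x + \<Delta>}) (y + \<Delta>)"
    unfolding E1_def by (rule killed_iter_eq_prob[OF Zind Zlaw L]) auto
  ultimately show "p \<le> (killed_step L {0..} ^^ n) (indicator {x..x + \<Delta>}) (y + \<Delta>)"
    unfolding p_def E_def by simp
qed

section \<open>Elementary estimates for the final comparison\<close>

lemma phi_plus_lipschitz:
  assumes "0 \<le> s" "0 \<le> t"
  shows "\<bar>phi_plus s - phi_plus t\<bar> \<le> 2 * \<bar>s - t\<bar>"
proof -
  have "norm (s * exp (- s\<^sup>2 / 2) - t * exp (- t\<^sup>2 / 2)) \<le> 2 * norm (s - t)"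
  proof (rule field_differentiable_bound[of UNIV "\<lambda>s. s * exp (- s\<^sup>2 / 2)" "\<lambda>s. exp (- s\<^sup>2 / 2) - s\<^sup>2 * exp (- s\<^sup>2 / 2)"])
    fix z :: real
    show "((\<lambda>s. s * exp (- s\<^sup>2 / 2)) has_field_derivative exp (- z\<^sup>2 / 2) - z\<^sup>2 * exp (- z\<^sup>2 / 2)) (at z within UNIV)"
      by (auto intro!: derivative_eq_intros simp: power2_eq_square)
    have "exp (- z\<^sup>2 / 2) \<le> 1" by simp
    then show "norm (exp (- z\<^sup>2 / 2) - z\<^sup>2 * exp (- z\<^sup>2 / 2)) \<le> 2"
      using power_mult_gaussian_le(2)[of z] zero_le_power2[of z] exp_ge_zero[of "- z\<^sup>2 / 2"]
        mult_nonneg_nonneg[of "z\<^sup>2" "exp (- z\<^sup>2 / 2)"]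
      unfolding real_norm_def by linarith
  qed auto
  then show ?thesis using assms by (simp add: phi_plus_def)
qed

text \<open>Identifies the slope of the kernel at the origin with the Rayleigh profile.\<close>

lemma gaussian_profile_eq:
  assumes "0 < \<sigma>" "0 < n" "0 \<le> x"
  shows "2 * x / (\<sigma>\<^sup>2 * real n) * normal_density 0 (\<sigma> * sqrt (real n)) x
    = 2 / (sqrt (2 * pi) * \<sigma>\<^sup>2) * phi_plus (x / (\<sigma> * sqrt (real n))) / real n"
proof -
  define s where "s = \<sigma> * sqrt (real n)"
  have s: "0 < s" "s\<^sup>2 = \<sigma>\<^sup>2 * real n" using assms by (simp_all add: s_def power_mult_distrib)
  have d: "normal_density 0 s x = 1 / (sqrt (2 * pi) * s) * exp (- (x / s)\<^sup>2 / 2)"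
    using s(1) by (simp add: normal_density_def real_sqrt_mult power_divide mult.commute)
  have p: "phi_plus (x / s) = x / s * exp (- (x / s)\<^sup>2 / 2)" using s(1) assms by (simp add: phi_plus_def)
  show ?thesis unfolding s_def[symmetric] s(2)[symmetric] d p
    using s(1) assms by (simp add: s_def field_simps)
qed

lemma unif_asymp_equivI:
  assumes "\<And>e. 0 < e \<Longrightarrow> e \<le> 1 \<Longrightarrow> \<forall>\<^sub>F n in sequentially. \<forall>\<theta>\<in>A n. \<bar>a n \<theta> / b n \<theta> - 1\<bar> \<le> e"
  shows "unif_asymp_equiv A a b"
  unfolding unif_asymp_equiv_def
proof (rule order_tendstoI)
  fix c :: ennreal assume c: "0 < c"
  \<comment> \<open>Pointwise bounds control a supremum only non-strictly, hence an intermediate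
    value below \<open>c\<close>; it is finite even if \<open>c\<close> is not.\<close>
  obtain d where d: "0 < d" "d < c" using dense[OF c] by blast
  then obtain e where e: "d = ennreal e" "0 < e" by (cases d) (auto simp: top_unique less_top[symmetric])
  show "\<forall>\<^sub>F n in sequentially. (SUP \<theta>\<in>A n. ennreal \<bar>a n \<theta> / b n \<theta> - 1\<bar>) < c"
    using assms[of "min 1 e"]
  proof (rule eventually_mono)
    fix n assume *: "\<forall>\<theta>\<in>A n. \<bar>a n \<theta> / b n \<theta> - 1\<bar> \<le> min 1 e"
    have "(SUP \<theta>\<in>A n. ennreal \<bar>a n \<theta> / b n \<theta> - 1\<bar>) \<le> d"
      unfolding e(1) by (rule SUP_least) (use * in \<open>auto intro!: ennreal_leI\<close>)
    with d(2) show "(SUP \<theta>\<in>A n. ennreal \<bar>a n \<theta> / b n \<theta> - 1\<bar>) < c" by (rule le_less_trans[rotated])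
  qed (use e in auto)
qed (simp add: not_less)

text \<open>Each source gets a share \<open>e / 4\<close>: the absolute error relative to the
  smallest profile value \<open>m\<close>, the shift of the start from \<open>y\<close> to
  \<open>y + D\<close>, and the shift of the profile from \<psi> to \<open>\<psi>'\<close>. The
  upper bound needs \<open>(1 + e / 4)\<^sup>2 \<le> 1 + e\<close>, which uses
  \<open>e \<le> 1\<close>.\<close>

lemma relative_error_le:
  fixes c \<psi> \<psi>' \<epsilon> e \<beta> p D N y :: real
  assumes c: "0 < c" and m: "0 < m" "m \<le> \<psi>" and e: "0 < e" "e \<le> 1" and \<epsilon>: "\<epsilon> = c * m * (e / 4)"
    and D: "0 < D" and y: "0 < y" and N: "0 < N" and \<beta>: "D \<le> \<beta> * y" "\<beta> \<le> e / 4"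
    and close: "\<bar>\<psi>' - \<psi>\<bar> \<le> m * (e / 4)"
    and up: "p \<le> D * (c * \<psi> / N * (y + D)) + \<epsilon> * D * (y + D) / N"
    and low: "D * (c * \<psi>' / N * y) - \<epsilon> * D * y / N \<le> p"
  shows "\<bar>p / (D * (c * y / N) * \<psi>) - 1\<bar> \<le> e"
proof -
  define b where "b = D * (c * y / N) * \<psi>"
  have \<psi>: "0 < \<psi>" using m by simp
  have b: "0 < b" using D c y N \<psi> by (simp add: b_def)
  define k where "k = D * c * y / N"
  have k: "0 < k" "b = k * \<psi>" using D c y N by (simp_all add: k_def b_def)
  have "D \<le> e / 4 * y" using y by (intro order_trans[OF \<beta>(1) mult_right_mono[OF \<beta>(2)]]) simp
  then have "y + D \<le> y * (1 + e / 4)" by (simp add: algebra_simps)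
  have "p \<le> (D * (c * \<psi> + \<epsilon>) / N) * (y + D)" using up by (simp add: algebra_simps add_divide_distrib)
  also have "\<dots> \<le> (D * (c * \<psi> + \<epsilon>) / N) * (y * (1 + e / 4))"
    using \<open>y + D \<le> _\<close> D c \<psi> m e N by (intro mult_left_mono) (auto simp: \<epsilon> intro!: divide_nonneg_pos mult_nonneg_nonneg add_nonneg_nonneg)
  also have "\<dots> = k * (\<psi> + m * (e / 4)) * (1 + e / 4)" by (simp add: k_def \<epsilon> algebra_simps add_divide_distrib)
  also have "\<dots> \<le> k * (\<psi> + \<psi> * (e / 4)) * (1 + e / 4)"
    using k m e by (intro mult_right_mono mult_left_mono add_left_mono) auto
  also have "\<psi> + \<psi> * (e / 4) = \<psi> * (1 + e / 4)" by (simp add: distrib_left)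
  also have "k * (\<psi> * (1 + e / 4)) * (1 + e / 4) = b * ((1 + e / 4) * (1 + e / 4))"
    by (simp only: k(2) mult.assoc)
  also have "\<dots> \<le> b * (1 + e)"
  proof (intro mult_left_mono)
    have "e * e \<le> e * 1" using e by (intro mult_left_mono) auto
    moreover have "(1 + e / 4) * (1 + e / 4) = 1 + e / 2 + e * e / 16" by (simp add: algebra_simps)
    ultimately show "(1 + e / 4) * (1 + e / 4) \<le> 1 + e" using e by linarith
  qed (use b in simp)
  finally have "p \<le> b * (1 + e)" .
  then have 1: "p / b - 1 \<le> e" using b by (simp add: field_simps)
  have "m * (e / 4) \<le> \<psi> * (e / 4)" using m e by (intro mult_right_mono) auto
  moreover have "\<psi> * (e / 4) = \<psi> * e / 4" "\<psi> * (1 - e) = \<psi> - \<psi> * e" by (simp_all add: algebra_simps)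
  moreover have "0 \<le> \<psi> * e" using \<psi> e by simp
  ultimately have "\<psi> * (1 - e) \<le> \<psi>' - m * (e / 4)" using close by linarith
  then have "k * (\<psi> * (1 - e)) \<le> k * (\<psi>' - m * (e / 4))" using k by (intro mult_left_mono) auto
  also have "\<dots> = D * (c * \<psi>' / N * y) - \<epsilon> * D * y / N" by (simp add: k_def \<epsilon> algebra_simps diff_divide_distrib)
  also have "\<dots> \<le> p" by (rule low)
  finally have "b * (1 - e) \<le> p" by (simp add: k mult.assoc)
  then have 2: "- e \<le> p / b - 1" using b by (simp add: field_simps)
  from 1 2 show ?thesis unfolding b_def by linarith
qed

theorem theorem1p8:
  fixes M :: "'a measure"
    and X :: "nat \<Rightarrow> 'a \<Rightarrow> real"
    and \<sigma> \<delta> \<eta> \<Delta>\<^sub>0 :: real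
    and \<alpha> \<beta> :: "nat \<Rightarrow> real"
  assumes "prob_space M"
    and "prob_space.indep_vars M (\<lambda>_. borel) X {1..}"
    and "\<And>i. 1 \<le> i \<Longrightarrow> distr M borel (X i) = distr M borel (X 1)"
    and "integrable M (X 1)"
    and "prob_space.expectation M (X 1) = 0"
    and "integrable M (\<lambda>\<omega>. (X 1 \<omega>)\<^sup>2)"
    and "prob_space.expectation M (\<lambda>\<omega>. (X 1 \<omega>)\<^sup>2) = \<sigma>\<^sup>2"
    and "0 < \<sigma>"
    and "non_lattice M (X 1)"
    and "0 < \<delta>"
    and "integrable M (\<lambda>\<omega>. \<bar>X 1 \<omega>\<bar> powr (2 + \<delta>))"
    and "1 \<le> \<eta>"
    and "\<And>n. 1 \<le> n \<Longrightarrow> 0 < \<alpha> n"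
    and "\<alpha> \<longlonglongrightarrow> 0"
    and "\<And>n. 1 \<le> n \<Longrightarrow> real n powr (1 / 4) * \<alpha> n \<ge> 1"
    and "0 < \<Delta>\<^sub>0"
    and "\<And>n. 1 \<le> n \<Longrightarrow> 0 < \<beta> n"
    and "\<beta> \<longlonglongrightarrow> 0"
  shows "unif_asymp_equiv
     (\<lambda>n. {(x, y, \<Delta>). x \<in> {inverse \<eta> * sqrt (real n) .. \<eta> * sqrt (real n)} \<and>
                      y \<in> {inverse (\<alpha> n) .. \<alpha> n * sqrt (real n)} \<and>
                      \<Delta> \<in> {\<Delta>\<^sub>0 .. \<beta> n * y}})
     (\<lambda>n (x, y, \<Delta>). measure M {\<omega> \<in> space M.
         x + walk X n \<omega> \<in> {y .. y + \<Delta>} \<and> exit_time X x \<omega> > enat n})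
     (\<lambda>n (x, y, \<Delta>). \<Delta> * (2 * y / (sqrt (2 * pi) * \<sigma>\<^sup>2 * real n)) *
         phi_plus (x / (\<sigma> * sqrt (real n))))"
proof (rule unif_asymp_equivI)
  fix e :: real assume e: "0 < e" "e \<le> 1"
  interpret prob_space M by fact
  note ind = assms(2) and law = assms(3) and \<sigma> = \<open>0 < \<sigma>\<close> and \<eta> = \<open>1 \<le> \<eta>\<close> and \<Delta>\<^sub>0 = \<open>0 < \<Delta>\<^sub>0\<close>
  have X: "random_variable borel (X 1)" using ind by (auto simp: indep_vars_def)
  define L where "L = distr M borel (\<lambda>\<omega>. - X 1 \<omega>)"
  interpret L: nonlattice_law L \<sigma> "min \<delta> (1 / 2)"
    unfolding L_def by (rule nonlattice_law_uminus[OF X]) (use assms in auto)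
  define c where "c = 2 / (sqrt (2 * pi) * \<sigma>\<^sup>2)"
  have c: "0 < c" using \<sigma> by (simp add: c_def)
  \<comment> \<open>A lower bound for \<open>phi_plus\<close> on the range of
    \<open>x / (\<sigma> * sqrt n)\<close>: the smallest linear factor times the smallest
    exponential factor.\<close>
  define m where "m = 1 / (\<eta> * \<sigma>) * exp (- (\<eta> / \<sigma>)\<^sup>2 / 2)"
  have m: "0 < m" using \<eta> \<sigma> by (simp add: m_def)
  define \<epsilon> where "\<epsilon> = c * m * (e / 4)"
  have \<epsilon>: "0 < \<epsilon>" using c m e by (simp add: \<epsilon>_def)
  \<comment> \<open>The constant is doubled because the lower bound uses the window starting at
    \<open>x - \<Delta>\<close>, which may lie below \<open>sqrt n / \<eta>\<close>.\<close>
  have "\<exists>N Y \<kappa>. 0 < \<kappa> \<and> (\<forall>n\<ge>N. \<forall>x y \<Delta>. sqrt (real n) / (2 * \<eta>) \<le> x \<longrightarrow> Y \<le> y \<longrightarrow> y \<le> \<kappa> * sqrt (real n) \<longrightarrow>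
    \<Delta>\<^sub>0 \<le> \<Delta> \<longrightarrow> \<Delta> \<le> \<kappa> * sqrt (real n) \<longrightarrow>
    \<bar>(L.Q ^^ n) (indicator {x..x + \<Delta>}) y
      - \<Delta> * (2 * x / (\<sigma>\<^sup>2 * real n) * normal_density 0 (\<sigma> * sqrt (real n)) x * y)\<bar> \<le> \<epsilon> * \<Delta> * y / real n)"
    by (rule L.killed_local_limit[OF \<Delta>\<^sub>0 _ \<epsilon>]) (use \<eta> in simp)
  then obtain N Y \<kappa> where \<kappa>: "0 < \<kappa>"
    and core: "\<forall>n\<ge>N. \<forall>x y \<Delta>. sqrt (real n) / (2 * \<eta>) \<le> x \<longrightarrow> Y \<le> y \<longrightarrow> y \<le> \<kappa> * sqrt (real n) \<longrightarrow>
    \<Delta>\<^sub>0 \<le> \<Delta> \<longrightarrow> \<Delta> \<le> \<kappa> * sqrt (real n) \<longrightarrow>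
    \<bar>(L.Q ^^ n) (indicator {x..x + \<Delta>}) y
      - \<Delta> * (2 * x / (\<sigma>\<^sup>2 * real n) * normal_density 0 (\<sigma> * sqrt (real n)) x * y)\<bar> \<le> \<epsilon> * \<Delta> * y / real n"
    by blast
  \<comment> \<open>The four caps ensure, in order: \<open>y + \<Delta>\<close> is within the range
    \<kappa>; \<open>x - \<Delta>\<close> stays above \<open>sqrt n / (2 * \<eta>)\<close>;
    \<open>y\<close> exceeds the threshold \<open>Y\<close>; moving \<open>x\<close> by \<Delta>
    changes the profile by at most \<open>m * e / 4\<close>.\<close>
  define a where "a = min (min (\<kappa> / 2) (1 / (2 * \<eta>))) (min (1 / (\<bar>Y\<bar> + 1)) (\<sigma> * m * e / 8))"
  have a: "0 < a" using \<kappa> \<eta> \<sigma> m e by (simp add: a_def)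
  have aa: "a \<le> \<kappa> / 2" "a \<le> 1 / (2 * \<eta>)" "a \<le> 1 / (\<bar>Y\<bar> + 1)" "a \<le> \<sigma> * m * e / 8"
    unfolding a_def by (simp_all add: min.coboundedI1 min.coboundedI2)
  have ev\<alpha>: "\<forall>\<^sub>F n in sequentially. \<alpha> n < a" by (rule order_tendstoD(2)[OF \<open>\<alpha> \<longlonglongrightarrow> 0\<close> a])
  have ev\<beta>: "\<forall>\<^sub>F n in sequentially. \<beta> n < e / 4" using e by (intro order_tendstoD(2)[OF \<open>\<beta> \<longlonglongrightarrow> 0\<close>]) simp
  show "\<forall>\<^sub>F n in sequentially. \<forall>\<theta>\<in>{(x, y, \<Delta>). x \<in> {inverse \<eta> * sqrt (real n) .. \<eta> * sqrt (real n)} \<and>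
                      y \<in> {inverse (\<alpha> n) .. \<alpha> n * sqrt (real n)} \<and> \<Delta> \<in> {\<Delta>\<^sub>0 .. \<beta> n * y}}.
     \<bar>(case \<theta> of (x, y, \<Delta>) \<Rightarrow> measure M {\<omega> \<in> space M. x + walk X n \<omega> \<in> {y .. y + \<Delta>} \<and> exit_time X x \<omega> > enat n}) /
      (case \<theta> of (x, y, \<Delta>) \<Rightarrow> \<Delta> * (2 * y / (sqrt (2 * pi) * \<sigma>\<^sup>2 * real n)) * phi_plus (x / (\<sigma> * sqrt (real n)))) - 1\<bar> \<le> e"
    using ev\<alpha> ev\<beta> eventually_ge_at_top[of "max 1 N"]
  proof eventually_elim
    case (elim n)
    have n: "1 \<le> n" "N \<le> n" using elim(3) by auto
    define S where "S = sqrt (real n)"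
    have S: "0 < S" using n by (simp add: S_def)
    have \<alpha>0: "0 < \<alpha> n" and \<beta>0: "0 < \<beta> n" using assms(13,17) n by auto
    show ?case
    proof (rule ballI)
      fix \<theta> assume \<theta>: "\<theta> \<in> {(x, y, \<Delta>). x \<in> {inverse \<eta> * sqrt (real n) .. \<eta> * sqrt (real n)} \<and>
                      y \<in> {inverse (\<alpha> n) .. \<alpha> n * sqrt (real n)} \<and> \<Delta> \<in> {\<Delta>\<^sub>0 .. \<beta> n * y}}"
      obtain x y \<Delta> where \<theta>_eq: "\<theta> = (x, y, \<Delta>)" by (cases \<theta>)
      have "x \<in> {inverse \<eta> * sqrt (real n) .. \<eta> * sqrt (real n)}" "y \<in> {inverse (\<alpha> n) .. \<alpha> n * sqrt (real n)}" "\<Delta> \<in> {\<Delta>\<^sub>0 .. \<beta> n * y}"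
        using \<theta> unfolding \<theta>_eq by blast+
      then have x: "S / \<eta> \<le> x" "x \<le> \<eta> * S" and y: "inverse (\<alpha> n) \<le> y" "y \<le> \<alpha> n * S" and \<Delta>: "\<Delta>\<^sub>0 \<le> \<Delta>" "\<Delta> \<le> \<beta> n * y"
        by (auto simp: S_def divide_inverse mult.commute)
      define p where "p = measure M {\<omega> \<in> space M. x + walk X n \<omega> \<in> {y .. y + \<Delta>} \<and> exit_time X x \<omega> > enat n}"
      have y0: "0 < y" using y(1) \<alpha>0 by (meson less_le_trans positive_imp_inverse_positive)
      have \<Delta>p: "0 < \<Delta>" using \<Delta> \<Delta>\<^sub>0 by simp
      have "0 < S / \<eta>" using S \<eta> by simp
      then have x0: "0 < x" using x by simp
      have yS: "y \<le> a * S" using S elim(1) by (intro order_trans[OF y(2) mult_right_mono]) auto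
      \<comment> \<open>Eventually \<open>\<beta> n\<close> is below 1, so every bound on
        \<open>y\<close> is inherited by \<Delta>.\<close>
      have "\<Delta> \<le> 1 * y" using elim(2) e y0 by (intro order_trans[OF \<Delta>(2) mult_right_mono]) auto
      then have \<Delta>y: "\<Delta> \<le> y" by simp
      have aS: "a * S \<le> \<kappa> / 2 * S" "a * S \<le> 1 / (2 * \<eta>) * S" "a * S \<le> \<sigma> * m * e / 8 * S"
        using mult_right_mono[OF aa(1), of S] mult_right_mono[OF aa(2), of S] mult_right_mono[OF aa(4), of S]
          less_imp_le[OF S] by blast+
      have Yy: "Y \<le> y"
      proof -
        have "\<alpha> n \<le> 1 / (\<bar>Y\<bar> + 1)" using elim(1) aa by simp
        then have "inverse (1 / (\<bar>Y\<bar> + 1)) \<le> inverse (\<alpha> n)" using \<alpha>0 by (intro le_imp_inverse_le)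
        then show ?thesis using y(1) by simp
      qed
      have y\<kappa>: "y + \<Delta> \<le> \<kappa> * S" using yS \<Delta>y aS by simp
      have \<Delta>\<kappa>: "\<Delta> \<le> \<kappa> * S" using y\<kappa> y0 by simp
      have half: "S / \<eta> = S / (2 * \<eta>) + S / (2 * \<eta>)" by simp
      have \<Delta>\<eta>: "\<Delta> \<le> S / (2 * \<eta>)" using \<Delta>y yS aS(2) by simp
      have x1: "S / (2 * \<eta>) \<le> x - \<Delta>" "S / (2 * \<eta>) \<le> x"
        using x(1) \<Delta>\<eta> \<Delta>p half by linarith+
      have x10: "0 \<le> x - \<Delta>" using x1 S \<eta> by (meson divide_nonneg_pos less_imp_le mult_pos_pos order_trans zero_less_numeral zero_less_one less_le_trans)
      define \<xi> where "\<xi> = x / (\<sigma> * S)"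
      define \<xi>' where "\<xi>' = (x - \<Delta>) / (\<sigma> * S)"
      have \<sigma>S: "0 < \<sigma> * S" using \<sigma> S by simp
      have prof: "2 * v / (\<sigma>\<^sup>2 * real n) * normal_density 0 (\<sigma> * sqrt (real n)) v = c * phi_plus (v / (\<sigma> * S)) / real n" if "0 \<le> v" for v
        using gaussian_profile_eq[OF \<sigma> _ that, of n] n by (simp add: c_def S_def)
      have up: "p \<le> \<Delta> * (c * phi_plus \<xi> / real n * (y + \<Delta>)) + \<epsilon> * \<Delta> * (y + \<Delta>) / real n"
      proof -
        have "p \<le> (L.Q ^^ n) (indicator {x..x + \<Delta>}) (y + \<Delta>)"
          unfolding p_def L_def using reversal_bounds(2)[OF ind law, of x y \<Delta> n] x0 y0 \<Delta>p by simp
        moreover have "\<bar>(L.Q ^^ n) (indicator {x..x + \<Delta>}) (y + \<Delta>)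
            - \<Delta> * (2 * x / (\<sigma>\<^sup>2 * real n) * normal_density 0 (\<sigma> * sqrt (real n)) x * (y + \<Delta>))\<bar> \<le> \<epsilon> * \<Delta> * (y + \<Delta>) / real n"
          using core n(2) x1 Yy y\<kappa> \<Delta>(1) \<Delta>\<kappa> \<Delta>p by (simp add: S_def)
        ultimately show ?thesis unfolding prof[OF less_imp_le[OF x0]] \<xi>_def by linarith
      qed
      have low: "\<Delta> * (c * phi_plus \<xi>' / real n * y) - \<epsilon> * \<Delta> * y / real n \<le> p"
      proof -
        have "(L.Q ^^ n) (indicator {x - \<Delta>..x - \<Delta> + \<Delta>}) y \<le> p"
          unfolding p_def L_def using x0 y0 \<Delta>p by (intro reversal_bounds(1)[OF ind law]) auto
        moreover have "\<bar>(L.Q ^^ n) (indicator {x - \<Delta>..x - \<Delta> + \<Delta>}) y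
            - \<Delta> * (2 * (x - \<Delta>) / (\<sigma>\<^sup>2 * real n) * normal_density 0 (\<sigma> * sqrt (real n)) (x - \<Delta>) * y)\<bar> \<le> \<epsilon> * \<Delta> * y / real n"
          using core[rule_format, OF n(2), of "x - \<Delta>" y \<Delta>] x1 Yy y\<kappa> \<Delta>(1) \<Delta>\<kappa> \<Delta>p unfolding S_def by linarith
        ultimately show ?thesis unfolding prof[OF x10] \<xi>'_def by linarith
      qed
      have \<psi>: "m \<le> phi_plus \<xi>"
      proof -
        have l: "1 / (\<eta> * \<sigma>) \<le> \<xi>"
          using x(1) \<sigma> S \<eta> by (simp add: \<xi>_def field_simps)
        have u: "\<xi> \<le> \<eta> / \<sigma>" using x(2) \<sigma> S by (simp add: \<xi>_def field_simps)
        have "0 \<le> 1 / (\<eta> * \<sigma>)" using \<eta> \<sigma> by simp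
        then have \<xi>0: "0 \<le> \<xi>" using l by (rule order_trans)
        have "\<xi>\<^sup>2 \<le> (\<eta> / \<sigma>)\<^sup>2" using u \<xi>0 by (intro power_mono)
        then have "exp (- (\<eta> / \<sigma>)\<^sup>2 / 2) \<le> exp (- \<xi>\<^sup>2 / 2)" by simp
        then have "m \<le> \<xi> * exp (- \<xi>\<^sup>2 / 2)" unfolding m_def using l \<xi>0 by (intro mult_mono) auto
        then show ?thesis using \<xi>0 by (simp add: phi_plus_def)
      qed
      have close: "\<bar>phi_plus \<xi>' - phi_plus \<xi>\<bar> \<le> m * (e / 4)"
      proof -
        have "\<bar>phi_plus \<xi>' - phi_plus \<xi>\<bar> \<le> 2 * \<bar>\<xi>' - \<xi>\<bar>"
          using x10 x0 \<sigma>S by (intro phi_plus_lipschitz) (auto simp: \<xi>_def \<xi>'_def)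
        also have "\<bar>\<xi>' - \<xi>\<bar> = \<Delta> / (\<sigma> * S)"
          using \<Delta>p \<sigma>S by (simp add: \<xi>_def \<xi>'_def flip: diff_divide_distrib)
        also have "\<dots> \<le> (\<sigma> * m * e / 8 * S) / (\<sigma> * S)"
          using \<Delta>y yS aS(3) \<sigma>S by (intro divide_right_mono) auto
        finally show ?thesis using \<sigma> S by (simp add: mult.commute)
      qed
      have "\<bar>p / (\<Delta> * (c * y / real n) * phi_plus \<xi>) - 1\<bar> \<le> e"
        by (rule relative_error_le[OF c m \<psi> e \<epsilon>_def \<Delta>p y0 _ \<Delta>(2) _ close up low]) (use n elim(2) in auto)
      then show "\<bar>(case \<theta> of (x, y, \<Delta>) \<Rightarrow> measure M {\<omega> \<in> space M. x + walk X n \<omega> \<in> {y .. y + \<Delta>} \<and> exit_time X x \<omega> > enat n}) /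
        (case \<theta> of (x, y, \<Delta>) \<Rightarrow> \<Delta> * (2 * y / (sqrt (2 * pi) * \<sigma>\<^sup>2 * real n)) * phi_plus (x / (\<sigma> * sqrt (real n)))) - 1\<bar> \<le> e"
        by (simp add: \<theta>_eq p_def c_def \<xi>_def S_def)
    qed
  qed
qed

end
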